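(* Let $p=3$. For every integer $n\ge1$, the $3$-adic Mazur–Tate element $\theta_{n,\Delta}\in\mathbb{Z}_3[\mathcal{G}_n]$ of level $n$ attached to $\Delta$ satisfies $\lambda(\theta_{n,\Delta})=3^n-2$.
   Context: $\Delta=\sum_{n\ge1}\tau(n)q^n=q\prod_{n\ge1}(1-q^n)^{24}$. $V_k(R)$ is the module of homogeneous degree-$k$ polynomials in $X,Y$ over a ring $R$. $\varphi^+_\Delta$ is the sign-$+1$ (plus) part of the modular symbol $\{r\}-\{s\}\mapsto 2\pi i\int_s^r\Delta(z)(zX+Y)^{10}dz$ on degree-zero divisors of $\mathbb{P}^1(\mathbb{Q})$, with values in $V_{10}(\mathbb{C})$, divided by its cohomological period at $3$ (Pollack–Weston), so that it takes values in $V_{10}(\mathbb{Z}_{(3)})$ and not all values lie in $3V_{10}(\mathbb{Z}_{(3)})$. For $m\ge1$, $G_m=\mathrm{Gal}(\mathbb{Q}(\mu_{3^m})/\mathbb{Q})\cong(\mathbb{Z}/3^m\mathbb{Z})^\times$ via $a\mapsto\sigma_a$, $\sigma_a(\zeta)=\zeta^a$; $K_n\subset\mathbb{Q}(\mu_{3^{n+1}})$ is the subfield of degree $3^n$, $\mathcal{G}_n=\mathrm{Gal}(K_n/\mathbb{Q})$, $\pi_n:G_{n+1}\to\mathcal{G}_n$ restriction. $\theta_{n,\Delta}$ is the image under $\pi_n$ of $\sum_{a\in(\mathbb{Z}/3^{n+1}\mathbb{Z})^\times}\varphi^+_\Delta(\{\infty\}-\{a/3^{n+1}\})(0,1)\,\sigma_a$.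 For $F\in\mathbb{Z}_3[\mathcal{G}_n]$, choose a generator $\gamma_n$ of $\mathcal{G}_n$, set $T=\gamma_n-1$, write $F=\sum_{i=0}^{3^n-1}a_iT^i$ with $a_i\in\mathbb{Z}_3$; $\mu(F)=\min_i\mathrm{ord}_3(a_i)$ and $\lambda(F)=\min\{i:\mathrm{ord}_3(a_i)=\mu(F)\}$ (both $\infty$ if $F=0$); these are independent of $\gamma_n$. *)

theory Defs
  imports "HOL-Analysis.Analysis" "HOL-Computational_Algebra.Computational_Algebra" "HOL-Number_Theory.Cong"
begin

definition qpar :: "complex \<Rightarrow> complex" where
  "qpar z = exp (2 * of_real pi * \<i> * z)"

definition Delta :: "complex \<Rightarrow> complex" where
  "Delta z = qpar z * (prodinf (\<lambda>n. 1 - qpar z ^ Suc n)) ^ 24"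

(* Elements of V_10(C) are represented by coefficient functions k \<mapsto> coefficient of X^k Y^(10-k),
   k = 0..10 (coefficients with k > 10 are 0). *)
definition V_eval :: "(nat \<Rightarrow> complex) \<Rightarrow> complex \<Rightarrow> complex \<Rightarrow> complex" where
  "V_eval P X Y = (\<Sum>k\<le>10. P k * X ^ k * Y ^ (10 - k))"

(* Phi r = 2 pi i \<integral>_r^{i\<infinity>} Delta(z) (zX+Y)^10 dz, along the vertical path z = r + i t, t > 0.
   Coefficient of X^k Y^(10-k) is 2 pi i (10 choose k) \<integral> Delta(z) z^k dz. *)
definition Phi :: "rat \<Rightarrow> nat \<Rightarrow> complex" where
  "Phi r k = (if k \<le> 10 then
      2 * of_real pi * \<i> * of_nat (10 choose k) *
      set_lebesgue_integral lborel {0<..}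
        (\<lambda>t::real. Delta (of_rat r + \<i> * of_real t) * (of_rat r + \<i> * of_real t) ^ k * \<i>)
    else 0)"

(* P^1(Q) = rat option, None = \<infinity>; Phi at \<infinity> is 0 *)
definition PhiC :: "rat option \<Rightarrow> nat \<Rightarrow> complex" where
  "PhiC x k = (case x of None \<Rightarrow> 0 | Some r \<Rightarrow> Phi r k)"

definition deg0_div :: "(rat option \<Rightarrow> int) \<Rightarrow> bool" where
  "deg0_div D \<longleftrightarrow> finite {x. D x \<noteq> 0} \<and> sum D {x. D x \<noteq> 0} = 0"

(* modular symbol: {r} - {s} \<mapsto> 2 pi i \<integral>_s^r = Phi s - Phi r, extended Z-linearly *)
definition phiDelta :: "(rat option \<Rightarrow> int) \<Rightarrow> nat \<Rightarrow> complex" where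
  "phiDelta D k = - (\<Sum>x\<in>{x. D x \<noteq> 0}. of_int (D x) * PhiC x k)"

(* the involution iota = diag(-1,1): on cusps r \<mapsto> -r, on V_10: P(X,Y) \<mapsto> P(-X,Y) *)
definition cusp_neg :: "rat option \<Rightarrow> rat option" where
  "cusp_neg x = map_option uminus x"

definition phiDelta_plus :: "(rat option \<Rightarrow> int) \<Rightarrow> nat \<Rightarrow> complex" where
  "phiDelta_plus D k = (phiDelta D k + (-1) ^ k * phiDelta (\<lambda>x. D (cusp_neg x)) k) / 2"

definition inZ3loc :: "complex \<Rightarrow> bool" where
  "inZ3loc z \<longleftrightarrow> (\<exists>q::rat. z = of_rat q \<and> \<not> (3::int) dvd snd (quotient_of q))"

definition coh_period3 :: "complex \<Rightarrow> bool" where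
  "coh_period3 \<Omega> \<longleftrightarrow> \<Omega> \<noteq> 0 \<and>
     (\<forall>D k. deg0_div D \<longrightarrow> inZ3loc (phiDelta_plus D k / \<Omega>)) \<and>
     (\<exists>D k. deg0_div D \<and> \<not> inZ3loc (phiDelta_plus D k / (3 * \<Omega>)))"

definition div_inf_minus :: "rat \<Rightarrow> rat option \<Rightarrow> int" where
  "div_inf_minus r x = (if x = None then 1 else if x = Some r then -1 else 0)"

definition mt_val :: "complex \<Rightarrow> rat \<Rightarrow> complex" where
  "mt_val \<Omega> r = V_eval (\<lambda>k. phiDelta_plus (div_inf_minus r) k / \<Omega>) 0 1"

definition ratval :: "complex \<Rightarrow> rat" where
  "ratval z = (THE q. of_rat q = z)"

(* g (an integer prime to 3) gives, via sigma_g, a generator gamma_n of \<G>_n =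
   (Z/3^(n+1))^\<times> / {\<plusminus>1}: every unit is \<plusminus> g^j mod 3^(n+1) for some j < 3^n *)
definition gen_Gn :: "nat \<Rightarrow> int \<Rightarrow> bool" where
  "gen_Gn n g \<longleftrightarrow> \<not> 3 dvd g \<and>
     (\<forall>a::int. \<not> 3 dvd a \<longrightarrow> (\<exists>j<3^n. [a = g ^ j] (mod 3^(n+1)) \<or> [a = - (g ^ j)] (mod 3^(n+1))))"

(* coefficient of gamma^j in theta_{n,Delta} = pi_n(sum_a phi^+(...)(0,1) sigma_a) *)
definition theta_coeff :: "complex \<Rightarrow> nat \<Rightarrow> int \<Rightarrow> nat \<Rightarrow> rat" where
  "theta_coeff \<Omega> n g j =
     (\<Sum>a\<in>{a::int. 1 \<le> a \<and> a \<le> 3^(n+1) \<and> \<not> 3 dvd a \<and>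
                  ([a = g ^ j] (mod 3^(n+1)) \<or> [a = - (g ^ j)] (mod 3^(n+1)))}.
        ratval (mt_val \<Omega> (of_int a / 3^(n+1))))"

(* coefficients a_i in theta = sum_{i<3^n} a_i T^i, T = gamma - 1, gamma^j = (1+T)^j *)
definition theta_T_coeff :: "complex \<Rightarrow> nat \<Rightarrow> int \<Rightarrow> nat \<Rightarrow> rat" where
  "theta_T_coeff \<Omega> n g i = (\<Sum>j<3^n. theta_coeff \<Omega> n g j * of_nat (j choose i))"

definition ord3 :: "rat \<Rightarrow> int" where
  "ord3 q = int (multiplicity (3::int) (fst (quotient_of q))) - int (multiplicity (3::int) (snd (quotient_of q)))"

definition lambda_inv :: "nat \<Rightarrow> (nat \<Rightarrow> rat) \<Rightarrow> enat" where
  "lambda_inv N c = (if \<forall>i<N. c i = 0 then \<infinity> else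
      enat (LEAST i. i < N \<and> c i \<noteq> 0 \<and> (\<forall>j<N. c j \<noteq> 0 \<longrightarrow> ord3 (c i) \<le> ord3 (c j))))"

end

(* The symbol is controlled by the even period polynomial of Delta. Logarithmic differentiation turns the
   transformation of Delta under z -> -1/z into that of the Eisenstein series of weight 2, which is obtained
   by exchanging a conditionally convergent lattice sum after subtracting a telescoping one. The relations
   coming from S and T leave two free parameters in the even period polynomial; evaluating the T_2-eigenform
   relation on the path from 1/2 to infinity fixes their ratio, and up to a scalar the polynomial is
     P(x, y) = 691 x^2 y^2 (x^2 - y^2)^3 - 36 (x^10 - y^10).
   Decomposing {infinity} - {p/q} into unimodular paths, whose values are P at pairs of adjacent denominators,
   gives a value congruent to 54 - 18 q^2 modulo 81 when 3 does not divide q, and to 9 (p^2 - 1) when 9 divides q.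
   Since a |-> (a^2 - 1)/3 mod 3 is a nontrivial homomorphism on (Z/9)^*, the element theta_n / 27 is, modulo 3
   and up to a unit, the sum of j gamma^j, and this is a unit multiple of T^(3^n - 2) modulo T^(3^n - 1). *)
theory Submission
  imports Defs "HOL-Complex_Analysis.Complex_Analysis" "HOL-Real_Asymp.Real_Asymp"
begin

section \<open>Partial fractions and a lattice sum\<close>

text \<open>The analytic obstacle is the inversion. \<open>Phi\<close> integrates over vertical
  half-lines, and z -> -1/z turns these into semicircles ending at rational cusps. Instead of moving
  contours, boundary values of a primitive are compared along two paths to the same cusp, which
  requires \<open>Delta\<close> to be bounded in cones at every rational point. The modulus 81 is
  forced: for n >= 1 the symbol values at level 3^(n+1) are already divisible by 27, so the next
  3-adic digit decides lambda. Modulo 81 the period polynomial at two denominators prime to 3 is a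
  difference of one function of the denominator, so a path through such denominators telescopes to a
  closed form. The factor 691 and the ratio of two cohomological periods shift all valuations
  equally and leave lambda unchanged. The exponent 3^n - 2 comes from a derivative: modulo 3, the
  sum of gamma^j is T^(3^n - 1), and applying gamma d/dgamma gives -(1 + T) T^(3^n - 2).\<close>

lemma dominated_double_series:
  fixes f :: "nat \<Rightarrow> nat \<Rightarrow> complex" and a b :: "nat \<Rightarrow> real"
  assumes bd: "\<And>m n. norm (f m n) \<le> a m * b n"
    and sa: "summable a" and sb: "summable b"
    and a0: "\<And>m. a m \<ge> 0" and b0: "\<And>n. b n \<ge> 0"
    and R: "\<And>m. (\<lambda>n. f m n) sums R m" and C: "\<And>n. (\<lambda>m. f m n) sums C n"
  obtains S where "R sums S" "C sums S"
proof -
  have Sa: "a summable_on UNIV" and Sb: "b summable_on UNIV"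
    using sa sb a0 b0 by (auto intro!: norm_summable_imp_summable_on)
  have ab: "(\<lambda>x. norm ((\<lambda>(m,n). a m * b n) x)) summable_on (UNIV \<times> UNIV)"
    unfolding Infinite_Sum.abs_summable_on_Sigma_iff
    using Sa Sb a0 b0 by (auto simp: infsum_cmult_right' abs_mult
        intro!: summable_on_cmult_right summable_on_cmult_left infsum_nonneg)
  have "(\<lambda>x. norm ((\<lambda>(m,n). f m n) x)) summable_on (UNIV \<times> UNIV)"
    by (rule Infinite_Sum.abs_summable_on_comparison_test[OF ab]) (auto simp: a0 b0 bd)
  then have fs: "(\<lambda>(m,n). f m n) summable_on (UNIV \<times> UNIV)"
    by (rule abs_summable_summable)
  have fs': "(\<lambda>(n,m). f m n) summable_on (UNIV \<times> UNIV)"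
    using fs by (subst summable_on_swap) (simp add: case_prod_unfold)
  have R': "infsum (f m) UNIV = R m" for m
  proof -
    have "f m summable_on UNIV"
      using summable_on_SigmaD1[of f UNIV "\<lambda>_. UNIV" m] fs by simp
    then show ?thesis
      by (meson R has_sum_imp_sums has_sum_infsum sums_unique2)
  qed
  have C': "infsum (\<lambda>m. f m n) UNIV = C n" for n
  proof -
    have "(\<lambda>m. f m n) summable_on UNIV"
      using summable_on_SigmaD1[of "\<lambda>n m. f m n" UNIV "\<lambda>_. UNIV" n] fs' by simp
    then show ?thesis
      using has_sum_imp_sums[OF has_sum_infsum] C[of n] sums_unique2 by blast
  qed
  have "R summable_on UNIV"
    using summable_on_Sigma_banach[OF fs] by (simp add: R')
  moreover have "C summable_on UNIV"
    using summable_on_Sigma_banach[OF fs'] by (simp add: C')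
  moreover have "infsum R UNIV = infsum C UNIV"
    using infsum_swap_banach[OF fs] by (simp add: R' C')
  ultimately show ?thesis
    by (metis has_sum_imp_sums has_sum_infsum that)
qed

text \<open>The sum of \<open>1 / (w + n)\<^sup>2\<close> over all integers \<open>n\<close>.\<close>

definition csc_sq :: "complex \<Rightarrow> complex" where
  "csc_sq w = Polygamma 1 w + Polygamma 1 (1 - w)"

lemma Im_nonzero_not_Int: "Im w \<noteq> 0 \<Longrightarrow> w \<notin> \<int>\<^sub>\<le>\<^sub>0"
  by (auto elim!: nonpos_Ints_cases)

lemma sin_pi_nonzero:
  fixes w :: complex
  assumes "Im w \<noteq> 0" shows "sin (of_real pi * w) \<noteq> 0"
proof
  assume "sin (of_real pi * w) = 0"
  then obtain n where "of_real pi * w = of_real pi * of_int n"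
    by (auto simp: sin_eq_0 mult.commute)
  then have "w = of_int n" by simp
  with assms show False by simp
qed

text \<open>Logarithmic derivative of the reflection formula for Gamma; off the real axis both
  arguments avoid the poles and the sine does not vanish.\<close>

lemma Digamma_reflection:
  fixes w :: complex
  assumes "Im w \<noteq> 0"
  shows "Digamma w - Digamma (1 - w) = - of_real pi * cot (of_real pi * w)"
proof -
  have w: "w \<notin> \<int>\<^sub>\<le>\<^sub>0" "1 - w \<notin> \<int>\<^sub>\<le>\<^sub>0"
    using assms by (auto intro!: Im_nonzero_not_Int)
  have s: "sin (of_real pi * w) \<noteq> 0" by (rule sin_pi_nonzero[OF assms])
  have "((\<lambda>z. Gamma z * Gamma (1 - z)) has_field_derivative
      Gamma w * Digamma w * Gamma (1 - w) - Gamma w * (Gamma (1 - w) * Digamma (1 - w))) (at w)"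
    using w by (auto intro!: derivative_eq_intros)
  then have "((\<lambda>z. of_real pi / sin (of_real pi * z)) has_field_derivative
      Gamma w * Digamma w * Gamma (1 - w) - Gamma w * (Gamma (1 - w) * Digamma (1 - w))) (at w)"
    by (simp add: Gamma_reflection_complex)
  moreover have "((\<lambda>z. of_real pi / sin (of_real pi * z)) has_field_derivative
      - (of_real pi * (cos (of_real pi * w) * of_real pi)) / (sin (of_real pi * w))^2) (at w)"
    using s by (auto intro!: derivative_eq_intros simp: power2_eq_square)
  ultimately have "Gamma w * Gamma (1 - w) * (Digamma w - Digamma (1 - w)) =
      - (of_real pi * (cos (of_real pi * w) * of_real pi)) / (sin (of_real pi * w))^2"
    using DERIV_unique by (fastforce simp: algebra_simps)
  then have "of_real pi / sin (of_real pi * w) * (Digamma w - Digamma (1 - w)) =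
      of_real pi / sin (of_real pi * w) * (- of_real pi * cot (of_real pi * w))"
    by (simp add: Gamma_reflection_complex cot_def power2_eq_square)
  then show ?thesis using s
    by (metis divide_eq_0_iff mult_cancel_left of_real_eq_0_iff pi_neq_zero)
qed

text \<open>Obtained by differentiating \<open>Digamma_reflection\<close>, which holds on a
  neighbourhood of w.\<close>

lemma csc_sq_eq:
  fixes w :: complex
  assumes "Im w \<noteq> 0"
  shows "csc_sq w = (of_real pi)^2 / (sin (of_real pi * w))^2"
proof -
  have w: "w \<notin> \<int>\<^sub>\<le>\<^sub>0" "1 - w \<notin> \<int>\<^sub>\<le>\<^sub>0"
    using assms by (auto intro!: Im_nonzero_not_Int)
  have s: "sin (of_real pi * w) \<noteq> 0" by (rule sin_pi_nonzero[OF assms])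
  have "((\<lambda>z. Digamma z - Digamma (1 - z)) has_field_derivative csc_sq w) (at w)"
    unfolding csc_sq_def using w by (auto intro!: derivative_eq_intros)
  moreover have "eventually (\<lambda>z. Im z \<noteq> 0) (nhds w)"
    by (rule eventually_nhds_in_open[where s="{z. Im z \<noteq> 0}", simplified])
      (auto simp: assms intro!: open_Collect_neq continuous_intros)
  then have ev: "eventually (\<lambda>z. Digamma z - Digamma (1 - z) = - of_real pi * cot (of_real pi * z)) (nhds w)"
    by eventually_elim (rule Digamma_reflection)
  ultimately have "((\<lambda>z. - of_real pi * cot (of_real pi * z)) has_field_derivative csc_sq w) (at w)"
    by (simp only: DERIV_cong_ev[OF refl ev refl])
  moreover have "((\<lambda>z. - of_real pi * cot (of_real pi * z)) has_field_derivative
      (of_real pi)^2 / (sin (of_real pi * w))^2) (at w)"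
    using s DERIV_chain2[OF DERIV_cot[OF s] DERIV_cmult_Id[of "of_real pi" w]]
    by (auto intro!: derivative_eq_intros simp: field_simps power2_eq_square)
  ultimately show ?thesis by (rule DERIV_unique)
qed

lemma csc_sq_sums:
  fixes w :: complex
  assumes "Im w \<noteq> 0"
  shows "(\<lambda>n. 1 / (w + of_nat (Suc n))^2 + 1 / (w - of_nat (Suc n))^2) sums (csc_sq w - 1 / w^2)"
proof -
  have w: "w \<noteq> 0" "1 - w \<noteq> 0" using assms by auto
  have "(\<lambda>k. inverse ((w + of_nat k)^2)) sums Polygamma 1 w"
    using Polygamma_LIMSEQ[of w 1] w by (simp add: power2_eq_square)
  then have "(\<lambda>k. inverse ((w + of_nat (Suc k))^2)) sums (Polygamma 1 w - inverse (w^2))"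
    by (subst sums_Suc_iff[of "\<lambda>k. inverse ((w + of_nat k)^2)"]) simp
  moreover have "(\<lambda>k. inverse (((1 - w) + of_nat k)^2)) sums Polygamma 1 (1 - w)"
    using Polygamma_LIMSEQ[of "1-w" 1] w by (simp add: power2_eq_square)
  moreover have "(1 - w + of_nat k)^2 = (w - of_nat (Suc k))^2" for k
    by (simp add: power2_eq_square algebra_simps)
  ultimately have "(\<lambda>k. inverse ((w + of_nat (Suc k))^2) + inverse ((w - of_nat (Suc k))^2)) sums
      (Polygamma 1 w - inverse (w^2) + Polygamma 1 (1 - w))"
    by (simp only: sums_add)
  then show ?thesis by (simp add: csc_sq_def inverse_eq_divide add_diff_eq diff_add_eq)
qed

text \<open>In the difference of the limit formulas for the digamma function at 1 + w and 1 - w the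
  logarithms cancel, and the terms pair up to those of the partial fraction series of the
  cotangent.\<close>

lemma cot_sums:
  fixes w :: complex
  assumes "Im w \<noteq> 0"
  shows "(\<lambda>m. 2 * w / ((of_nat (Suc m))^2 - w^2)) sums (1 / w - of_real pi * cot (of_real pi * w))"
proof -
  have w: "1 + w \<noteq> 0" "1 - w \<noteq> 0" "w \<noteq> 0" using assms by (auto simp: complex_eq_iff)
  have "(\<lambda>m. (of_real (ln (real m)) - (\<Sum>n<m. inverse (1 + w + of_nat n)))
      - (of_real (ln (real m)) - (\<Sum>n<m. inverse (1 - w + of_nat n)))) \<longlonglongrightarrow> Digamma (1 + w) - Digamma (1 - w)"
    by (intro tendsto_diff Digamma_LIMSEQ w)
  then have "(\<lambda>m. \<Sum>n<m. inverse (1 - w + of_nat n) - inverse (1 + w + of_nat n)) \<longlonglongrightarrow> Digamma (1 + w) - Digamma (1 - w)"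
    by (simp add: sum_subtractf)
  moreover have "inverse (1 - w + of_nat n) - inverse (1 + w + of_nat n) = 2 * w / ((of_nat (Suc n))^2 - w^2)" for n
  proof -
    have "1 - w + of_nat n \<noteq> 0" "1 + w + of_nat n \<noteq> 0" using assms by (auto simp: complex_eq_iff)
    moreover have "(of_nat (Suc n))^2 - w^2 = (1 - w + of_nat n) * (1 + w + of_nat n)"
      by (simp add: power2_eq_square algebra_simps)
    ultimately show ?thesis by (simp add: field_simps)
  qed
  moreover have "Digamma (1 + w) - Digamma (1 - w) = 1 / w - of_real pi * cot (of_real pi * w)"
    using Digamma_plus1[of w] w Digamma_reflection[OF assms] by (simp add: add.commute diff_eq_eq algebra_simps)
  ultimately show ?thesis by (simp add: sums_def)
qed

text \<open>Each of the factors p, p, p + 1, p - 1 is bounded below by a constant times m and also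
  by a constant times n; using each bound twice yields the product m^2 n^2 that
  \<open>dominated_double_series\<close> needs. The first entry of \<open>c\<close> comes from Im p
  = m Im z, the second from n <= |p| + m |z| <= |p| (1 + |z| / Im z).\<close>

lemma quartic_lower_bound:
  fixes z :: complex and m n :: nat and \<epsilon> :: real
  defines "c \<equiv> min (Im z) (1 / (1 + norm z / Im z))"
  assumes z: "Im z > 0" and m: "m \<ge> 1" and n: "n \<ge> 1" and p: "p = of_nat m * z + of_nat n \<or> p = of_nat m * z - of_nat n"
  shows "norm (p^2 * (p^2 - 1)) \<ge> c^4 / 4 * (real m)^2 * (real n)^2"
proof -
  have c0: "c > 0" unfolding c_def using z by (auto intro!: divide_pos_pos add_pos_nonneg)
  have gen: "norm (of_nat m * z + of_real x) \<ge> c * real m \<and> norm (of_nat m * z + of_real x) \<ge> c * \<bar>x\<bar>" for x :: real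
  proof
    have "c * real m \<le> Im z * real m" unfolding c_def by (intro mult_right_mono) auto
    also have "\<dots> = Im (of_nat m * z + of_real x)" by simp
    also have "\<dots> \<le> norm (of_nat m * z + of_real x)" using abs_Im_le_cmod abs_le_D1 by blast
    finally show 1: "norm (of_nat m * z + of_real x) \<ge> c * real m" .
    let ?N = "norm (of_nat m * z + of_real x)"
    have "Im (of_nat m * z + of_real x) \<le> ?N" using abs_Im_le_cmod abs_le_D1 by blast
    then have mN: "real m * Im z \<le> ?N" by simp
    have "\<bar>x\<bar> = norm ((of_nat m * z + of_real x) - of_nat m * z)" by simp
    also have "\<dots> \<le> ?N + real m * norm z" by (rule order_trans[OF norm_triangle_ineq4]) (simp add: norm_mult)
    also have "real m * norm z \<le> ?N * (norm z / Im z)"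
      using mult_right_mono[OF mN, of "norm z / Im z"] z by simp
    finally have "\<bar>x\<bar> \<le> ?N * (1 + norm z / Im z)" by (simp add: algebra_simps)
    then have "\<bar>x\<bar> / (1 + norm z / Im z) \<le> ?N"
      using z by (subst pos_divide_le_eq) (auto intro!: add_pos_nonneg)
    moreover have "c * \<bar>x\<bar> \<le> (1 / (1 + norm z / Im z)) * \<bar>x\<bar>"
      unfolding c_def by (intro mult_right_mono) auto
    ultimately show "?N \<ge> c * \<bar>x\<bar>" by simp
  qed
  obtain x :: real where x: "p = of_nat m * z + of_real x" "\<bar>x\<bar> = real n"
    using p by (metis abs_minus_cancel abs_of_nat add_uminus_conv_diff of_real_minus of_real_of_nat_eq)
  have A: "norm p \<ge> c * real m" "norm p \<ge> c * real n"
    using gen[of x] x by auto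
  \<comment> \<open>Shifting p by a unit lowers the bound in n to c (n - 1); adding the bound c m >=
    c repairs this, at the price of a factor 2.\<close>
  have B: "norm (p + of_real e) \<ge> c / 2 * real m \<and> norm (p + of_real e) \<ge> c / 2 * real n" if e: "\<bar>e\<bar> = 1" for e :: real
  proof -
    have eq: "p + of_real e = of_nat m * z + of_real (x + e)" using x by simp
    have "norm (p + of_real e) \<ge> c * real m" "norm (p + of_real e) \<ge> c * \<bar>x + e\<bar>"
      using gen[of "x + e"] unfolding eq by auto
    moreover have "c * \<bar>x + e\<bar> \<ge> c * (real n - 1)"
      using c0 x e by (intro mult_left_mono) auto
    moreover have "c * real m \<ge> c * 1" using c0 m by (intro mult_left_mono) auto
    moreover have "c * real m \<ge> 0" using c0 by simp
    ultimately show ?thesis by (auto simp: algebra_simps)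
  qed
  have "c^4 / 4 * (real m)^2 * (real n)^2 = (c * real m) * (c * real n) * ((c / 2 * real m) * (c / 2 * real n))"
    by (simp add: power2_eq_square power4_eq_xxxx)
  also have "\<dots> \<le> norm p * norm p * (norm (p + of_real 1) * norm (p + of_real (-1)))"
    using A B[of 1] B[of "-1"] c0 by (intro mult_mono) auto
  also have "\<dots> = norm (p * p * ((p + of_real 1) * (p + of_real (-1))))"
    by (simp only: norm_mult)
  also have "p * p * ((p + of_real 1) * (p + of_real (-1))) = p^2 * (p^2 - 1)"
    by (simp add: power2_eq_square algebra_simps)
  finally show ?thesis .
qed

lemma telescope2_sums:
  fixes f :: "nat \<Rightarrow> complex"
  assumes "f \<longlonglongrightarrow> L"
  shows "(\<lambda>n. f (Suc (Suc n)) - f n) sums (2 * L - f 0 - f 1)"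
proof -
  have "(\<lambda>n. (f (Suc n) - f n) + (f (Suc (Suc n)) - f (Suc n))) sums ((L - f 0) + (L - f 1))"
    using telescope_sums[OF assms] telescope_sums[OF LIMSEQ_Suc[OF assms]] by (intro sums_add) auto
  then show ?thesis by (simp add: algebra_simps)
qed

lemma tendsto_inverse_shift:
  fixes w a :: complex
  assumes "a \<noteq> 0"
  shows "(\<lambda>n. 1 / (w + a * of_nat n)) \<longlonglongrightarrow> 0"
proof -
  have "filterlim (\<lambda>n. a * of_nat n :: complex) at_infinity sequentially"
    using assms tendsto_of_nat
    by (intro tendsto_mult_filterlim_at_infinity[of _ a]) auto
  then have "filterlim (\<lambda>n. w + a * of_nat n :: complex) at_infinity sequentially"
    by (intro tendsto_add_filterlim_at_infinity[of _ w]) auto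
  then show ?thesis by (intro tendsto_divide_0[of _ 1]) auto
qed

text \<open>The cotangent is a fraction in exp(-2 i x), which decays along multiples of a point in
  the lower half-plane. Applied to a = pi / z, this limit is what breaks the symmetry of the lattice
  sum.\<close>

lemma cot_tendsto:
  fixes a :: complex
  assumes "Im a < 0"
  shows "(\<lambda>k. cot (of_nat k * a)) \<longlonglongrightarrow> \<i>"
proof -
  have eq: "cot x = \<i> * (1 + exp (-2 * \<i> * x)) / (1 - exp (-2 * \<i> * x))" if "x = of_nat k * a" "k \<ge> 1" for k :: nat and x
  proof -
    have e: "exp (- (\<i> * x)) = exp (\<i> * x) * exp (-2 * \<i> * x)" by (simp flip: exp_add)
    have nz: "exp (\<i> * x) \<noteq> 0" by simp
    define u where "u = exp (\<i> * x)" define v where "v = exp (-2 * \<i> * x)"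
    have "cos x = u * (1 + v) / 2" "sin x = u * (1 - v) / (2 * \<i>)"
      unfolding cos_exp_eq sin_exp_eq e u_def v_def by (simp_all add: algebra_simps)
    moreover have "(a * (1 + b) / 2) / (a * (1 - b) / (2 * \<i>)) = \<i> * (1 + b) / (1 - b)" if "a \<noteq> 0" for a b :: complex
      using that by (cases "b = 1") (auto simp: field_simps)
    ultimately show ?thesis using nz unfolding cot_def u_def[symmetric] v_def[symmetric] by metis
  qed
  have v: "(\<lambda>k. exp (-2 * \<i> * (of_nat k * a))) \<longlonglongrightarrow> 0"
  proof -
    have "norm (exp (-2 * \<i> * a)) < 1" using assms by (simp add: norm_exp_eq_Re)
    then have "(\<lambda>k. exp (-2 * \<i> * a) ^ k) \<longlonglongrightarrow> 0" by (rule LIMSEQ_power_zero)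
    then show ?thesis by (simp add: exp_of_nat_mult[symmetric] algebra_simps)
  qed
  have "(\<lambda>k. \<i> * (1 + exp (-2 * \<i> * (of_nat k * a))) / (1 - exp (-2 * \<i> * (of_nat k * a)))) \<longlonglongrightarrow> \<i> * (1 + 0) / (1 - 0)"
    by (intro tendsto_intros v) auto
  then have "(\<lambda>k. \<i> * (1 + exp (-2 * \<i> * (of_nat k * a))) / (1 - exp (-2 * \<i> * (of_nat k * a)))) \<longlonglongrightarrow> \<i>" by simp
  then show ?thesis
    by (rule Lim_transform_eventually) (rule eventually_sequentiallyI[of 1], rule eq[symmetric], rule refl)
qed

text \<open>The sums over \<open>m\<close> and \<open>n\<close> of \<open>1 / (m z + n)\<^sup>2\<close> cannot be exchanged directly. With \<open>p = m z + n\<close>,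
  the difference of \<open>1 / p\<^sup>2\<close> and \<open>1 / (p\<^sup>2 - 1)\<close> is absolutely summable over the lattice, while
  \<open>1 / (p\<^sup>2 - 1)\<close> telescopes in \<open>n\<close>; summing the telescoped terms over \<open>m\<close> first instead leaves
  cotangents, whose limit is the term \<open>\<pi> \<i> / z\<close>.\<close>

lemma csc_sq_lattice_identity:
  fixes z :: complex
  assumes z: "Im z > 0"
  obtains A B where "(\<lambda>m. csc_sq (of_nat (Suc m) * z)) sums A" "(\<lambda>n. csc_sq (of_nat (Suc n) / z)) sums B"
    "A = B / z^2 + of_real (pi^2 / 6) * (1 / z^2 - 1) + of_real pi * \<i> / z"
proof -
  have z0: "z \<noteq> 0" using z by auto
  have lin_nz: "of_nat (Suc m) * z + of_int j \<noteq> 0" for m and j :: int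
    using z by (auto simp: complex_eq_iff)
  define h where "h p = 1 / (p^2 - 1)" for p :: complex
  define d where "d m n = (1 / (of_nat (Suc m) * z + of_nat (Suc n))^2 + 1 / (of_nat (Suc m) * z - of_nat (Suc n))^2)
     - (h (of_nat (Suc m) * z + of_nat (Suc n)) + h (of_nat (Suc m) * z - of_nat (Suc n)))" for m n :: nat
  define c where "c = min (Im z) (1 / (1 + norm z / Im z))"
  have c0: "c > 0" unfolding c_def using z by (auto intro!: divide_pos_pos add_pos_nonneg)
  \<comment> \<open>\<open>kap\<close> below shows that this is 1/(w - k) - 1/(w + k) with w = (m +
    1) z. The pair of terms of \<open>h\<close> at n + 1 is half the difference of it at k = n + 2
    and k = n, so its sum \<open>K\<close> over m makes the column sums of \<open>h\<close>
    telescope in steps of two.\<close>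
  define \<kappa> where "\<kappa> k m = 2 * of_nat k / ((of_nat (Suc m))^2 * z^2 - (of_nat k)^2)" for k m :: nat
  define K where "K k = (if k = 0 then 0 else 1 / of_nat k - of_real pi / z * cot (of_nat k * (of_real pi / z)))" for k :: nat
  \<comment> \<open>The terms of \<open>h\<close> over all integers n sum to zero in each row; those
    with n nonzero therefore contribute minus the term at n = 0, which enters here with a plus
    sign.\<close>
  define R where "R m = csc_sq (of_nat (Suc m) * z) - 1 / (of_nat (Suc m) * z)^2 + h (of_nat (Suc m) * z)" for m
  define C where "C n = csc_sq (of_nat (Suc n) / z) / z^2 - 1 / (of_nat (Suc n))^2 - (K (Suc (Suc n)) - K n) / 2" for n
  have K_sums: "\<kappa> k sums K k" for k
  proof (cases "k = 0")
    case True then show ?thesis by (simp add: \<kappa>_def[abs_def] K_def)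
  next
    case False
    let ?w = "of_nat k / z"
    have im: "Im ?w \<noteq> 0" using z False by (auto simp: Im_divide)
    have "(\<lambda>m. 2 * ?w / ((of_nat (Suc m))^2 - ?w^2) * (1 / z)) sums ((1 / ?w - of_real pi * cot (of_real pi * ?w)) * (1 / z))"
      by (intro sums_mult2 cot_sums im)
    moreover have "2 * ?w / ((of_nat (Suc m))^2 - ?w^2) * (1 / z) = \<kappa> k m" for m
    proof -
      have "(of_nat (Suc m))^2 - ?w^2 = ((of_nat (Suc m))^2 * z^2 - (of_nat k)^2) / z^2"
        using z0 by (simp add: field_simps)
      then show ?thesis using z0 unfolding \<kappa>_def by (simp add: power2_eq_square del: of_nat_Suc)
    qed
    moreover have "(1 / ?w - of_real pi * cot (of_real pi * ?w)) * (1 / z) = K k"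
      using z0 False unfolding K_def by (simp add: field_simps)
    ultimately show ?thesis by simp
  qed
  have K_lim: "K \<longlonglongrightarrow> - (of_real pi * \<i> / z)"
  proof -
    have "Im (of_real pi / z) < 0" using z z0 by (simp add: Im_divide divide_neg_pos complex_neq_0[symmetric])
    then have "(\<lambda>k. 1 / of_nat k - of_real pi / z * cot (of_nat k * (of_real pi / z))) \<longlonglongrightarrow> 0 - of_real pi / z * \<i>"
      by (intro tendsto_intros cot_tendsto lim_1_over_n)
    moreover have "eventually (\<lambda>k. 1 / of_nat k - of_real pi / z * cot (of_nat k * (of_real pi / z)) = K k) sequentially"
      unfolding K_def by (rule eventually_sequentiallyI[of 1]) auto
    ultimately show ?thesis by (auto dest: Lim_transform_eventually)
  qed
  have h_split: "h p = (1 / (p - 1) - 1 / (p + 1)) / 2" if "p - 1 \<noteq> 0" "p + 1 \<noteq> 0" for p :: complex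
  proof -
    have "p^2 - 1 = (p - 1) * (p + 1)" by (simp add: power2_eq_square algebra_simps)
    moreover have "1 / (p - 1) - 1 / (p + 1) = 2 / ((p - 1) * (p + 1))"
      using that by (simp add: diff_frac_eq)
    ultimately show ?thesis unfolding h_def by simp
  qed
  have hN: "h (of_nat (Suc m) * z + of_nat (Suc n)) = (1 / (of_nat (Suc m) * z + of_nat n) - 1 / (of_nat (Suc m) * z + of_nat (n + 2))) / 2"
     "h (of_nat (Suc m) * z - of_nat (Suc n)) = (1 / (of_nat (Suc m) * z - of_nat (n + 2)) - 1 / (of_nat (Suc m) * z - of_nat n)) / 2" for m n
  proof -
    have e: "of_nat (Suc m) * z + of_nat (Suc n) - 1 = of_nat (Suc m) * z + of_nat n"
       "of_nat (Suc m) * z + of_nat (Suc n) + 1 = of_nat (Suc m) * z + of_nat (n + 2)"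
       "of_nat (Suc m) * z - of_nat (Suc n) - 1 = of_nat (Suc m) * z - of_nat (n + 2)"
       "of_nat (Suc m) * z - of_nat (Suc n) + 1 = of_nat (Suc m) * z - of_nat n" by simp_all
    have nz: "of_nat (Suc m) * z + of_nat k \<noteq> 0" "of_nat (Suc m) * z - of_nat k \<noteq> 0" for k
      using lin_nz[of m "int k"] lin_nz[of m "- int k"] by simp_all
    show "h (of_nat (Suc m) * z + of_nat (Suc n)) = (1 / (of_nat (Suc m) * z + of_nat n) - 1 / (of_nat (Suc m) * z + of_nat (n + 2))) / 2"
      using h_split[of "of_nat (Suc m) * z + of_nat (Suc n)"] nz(1)[of n] nz(1)[of "n + 2"] unfolding e by metis
    show "h (of_nat (Suc m) * z - of_nat (Suc n)) = (1 / (of_nat (Suc m) * z - of_nat (n + 2)) - 1 / (of_nat (Suc m) * z - of_nat n)) / 2"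
      using h_split[of "of_nat (Suc m) * z - of_nat (Suc n)"] nz(2)[of n] nz(2)[of "n + 2"] unfolding e by metis
  qed
  have kap: "\<kappa> k m = 1 / (of_nat (Suc m) * z - of_nat k) - 1 / (of_nat (Suc m) * z + of_nat k)" for k m
  proof -
    have nz: "of_nat (Suc m) * z + of_nat k \<noteq> 0" "of_nat (Suc m) * z - of_nat k \<noteq> 0"
      using lin_nz[of m "int k"] lin_nz[of m "- int k"] by simp_all
    have "(of_nat (Suc m))^2 * z^2 - (of_nat k)^2 = (of_nat (Suc m) * z - of_nat k) * (of_nat (Suc m) * z + of_nat k)"
      by (simp add: power2_eq_square algebra_simps)
    then show ?thesis unfolding \<kappa>_def using nz
      by (simp add: diff_frac_eq mult.commute)
  qed
  have bound: "norm (d m n) \<le> (8 / c^4 * (1 / (real (Suc m))^2)) * (1 / (real (Suc n))^2)" for m n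
  proof -
    let ?p = "of_nat (Suc m) * z + of_nat (Suc n)" and ?r = "of_nat (Suc m) * z - of_nat (Suc n)"
    let ?b = "c^4 / 4 * (real (Suc m))^2 * (real (Suc n))^2"
    have b0: "?b > 0" using c0 by simp
    have g: "norm (1 / p^2 - h p) \<le> 1 / ?b" if "p = ?p \<or> p = ?r" for p
    proof -
      have lb: "norm (p^2 * (p^2 - 1)) \<ge> ?b"
        unfolding c_def by (rule quartic_lower_bound[OF z _ _ that]) auto
      then have "p^2 * (p^2 - 1) \<noteq> 0" using b0 by (metis norm_zero not_le)
      then have "p \<noteq> 0" "p^2 - 1 \<noteq> 0" by auto
      then have "1 / p^2 - h p = - 1 / (p^2 * (p^2 - 1))" unfolding h_def by (simp add: field_simps)
      then have "norm (1 / p^2 - h p) = 1 / norm (p^2 * (p^2 - 1))" by (simp add: norm_divide)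
      also have "\<dots> \<le> 1 / ?b" using lb b0 by (intro divide_left_mono) (auto intro!: mult_pos_pos)
      finally show ?thesis .
    qed
    have "d m n = (1 / ?p^2 - h ?p) + (1 / ?r^2 - h ?r)" unfolding d_def by simp
    then have "norm (d m n) \<le> norm (1 / ?p^2 - h ?p) + norm (1 / ?r^2 - h ?r)" by (metis norm_triangle_ineq)
    also have "\<dots> \<le> 1 / ?b + 1 / ?b" by (intro add_mono g) auto
    also have "\<dots> = (8 / c^4 * (1 / (real (Suc m))^2)) * (1 / (real (Suc n))^2)" using c0 by (simp add: field_simps)
    finally show ?thesis .
  qed
  have R_sums: "d m sums R m" for m
  proof -
    let ?w = "of_nat (Suc m) * z"
    define f where "f n = (1 / (?w + of_nat n) - 1 / (?w - of_nat n)) / 2" for n :: nat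
    have im: "Im ?w \<noteq> 0" using z by auto
    have "f \<longlonglongrightarrow> (0 - 0) / 2"
      unfolding f_def using tendsto_inverse_shift[of 1 ?w] tendsto_inverse_shift[of "-1" ?w]
      by (intro tendsto_intros) auto
    then have "(\<lambda>n. f (Suc (Suc n)) - f n) sums (2 * 0 - f 0 - f 1)"
      by (intro telescope2_sums) simp
    moreover have "f (Suc (Suc n)) - f n = - (h (?w + of_nat (Suc n)) + h (?w - of_nat (Suc n)))" for n
      unfolding hN f_def by (simp add: field_simps)
    moreover have "2 * 0 - f 0 - f 1 = h ?w"
      using h_split[of ?w] lin_nz[of m 1] lin_nz[of m "-1"] unfolding f_def by (simp add: field_simps)
    ultimately have "(\<lambda>n. - (h (?w + of_nat (Suc n)) + h (?w - of_nat (Suc n)))) sums h ?w" by simp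
    from sums_add[OF csc_sq_sums[OF im] this] show ?thesis
      unfolding d_def R_def by (simp only: add_uminus_conv_diff)
  qed
  have C_sums: "(\<lambda>m. d m n) sums C n" for n
  proof -
    let ?v = "of_nat (Suc n) / z"
    have im: "Im ?v \<noteq> 0" using z by (auto simp: Im_divide simp del: of_nat_Suc)
    have "(\<lambda>m. (1 / (?v + of_nat (Suc m))^2 + 1 / (?v - of_nat (Suc m))^2) * (1 / z^2)) sums ((csc_sq ?v - 1 / ?v^2) * (1 / z^2))"
      by (intro sums_mult2 csc_sq_sums im)
    moreover have "(1 / (?v + of_nat (Suc m))^2 + 1 / (?v - of_nat (Suc m))^2) * (1 / z^2) =
        1 / (of_nat (Suc m) * z + of_nat (Suc n))^2 + 1 / (of_nat (Suc m) * z - of_nat (Suc n))^2" for m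
    proof -
      have e: "?v + of_nat (Suc m) = (of_nat (Suc m) * z + of_nat (Suc n)) / z"
           "?v - of_nat (Suc m) = - ((of_nat (Suc m) * z - of_nat (Suc n)) / z)"
        using z0 by (simp_all add: field_simps)
      show ?thesis unfolding e power2_minus power_divide using z0
        by (simp add: add_divide_distrib del: of_nat_Suc)
    qed
    moreover have "(csc_sq ?v - 1 / ?v^2) * (1 / z^2) = csc_sq ?v / z^2 - 1 / (of_nat (Suc n))^2"
      using z0 by (simp add: field_simps del: of_nat_Suc)
    ultimately have 1: "(\<lambda>m. 1 / (of_nat (Suc m) * z + of_nat (Suc n))^2 + 1 / (of_nat (Suc m) * z - of_nat (Suc n))^2)
        sums (csc_sq ?v / z^2 - 1 / (of_nat (Suc n))^2)" by simp
    have "(\<lambda>m. (\<kappa> (Suc (Suc n)) m - \<kappa> n m) / 2) sums ((K (Suc (Suc n)) - K n) / 2)"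
      by (intro sums_divide sums_diff K_sums)
    moreover have "(\<kappa> (Suc (Suc n)) m - \<kappa> n m) / 2 = h (of_nat (Suc m) * z + of_nat (Suc n)) + h (of_nat (Suc m) * z - of_nat (Suc n))" for m
      unfolding hN kap by (simp add: algebra_simps add_divide_distrib diff_divide_distrib)
    ultimately have 2: "(\<lambda>m. h (of_nat (Suc m) * z + of_nat (Suc n)) + h (of_nat (Suc m) * z - of_nat (Suc n)))
      sums ((K (Suc (Suc n)) - K n) / 2)" by simp
    from sums_diff[OF 1 2] show ?thesis unfolding d_def C_def by simp
  qed
  have sq: "(\<lambda>n. 1 / (real (Suc n))^2) sums (pi^2 / 6)" using inverse_squares_sums by (simp add: add.commute)
  obtain S where S: "R sums S" "C sums S"
  proof (rule dominated_double_series[of d "\<lambda>m. 8 / c^4 * (1 / (real (Suc m))^2)" "\<lambda>n. 1 / (real (Suc n))^2" R C])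
    show "summable (\<lambda>m. 8 / c^4 * (1 / (real (Suc m))^2))" "summable (\<lambda>n. 1 / (real (Suc n))^2)"
      by (rule summable_mult[OF sums_summable[OF sq]], rule sums_summable[OF sq])
  qed (use bound R_sums C_sums c0 in auto)
  have sqc: "(\<lambda>n. 1 / (of_nat (Suc n))^2 :: complex) sums of_real (pi^2 / 6)"
    using sums_of_real[OF sq, where 'a=complex] by simp
  have "(\<lambda>n. C n + 1 / (of_nat (Suc n))^2 + (K (Suc (Suc n)) - K n) / 2) sums
     (S + of_real (pi^2 / 6) + (2 * (- (of_real pi * \<i> / z)) - K 0 - K 1) / 2)"
    by (intro sums_add sums_divide S sqc telescope2_sums K_lim)
  then have B: "(\<lambda>n. csc_sq (of_nat (Suc n) / z) / z^2) sums (S + of_real (pi^2 / 6) - of_real pi * \<i> / z - K 1 / 2)"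
    by (simp add: C_def K_def[of 0] diff_divide_distrib add_diff_eq del: of_nat_Suc)
  then have B': "(\<lambda>n. csc_sq (of_nat (Suc n) / z)) sums ((S + of_real (pi^2 / 6) - of_real pi * \<i> / z - K 1 / 2) * z^2)"
    using sums_mult2[OF B, of "z^2"] z0 by simp
  \<comment> \<open>The n = 0 terms of \<open>h\<close> sum over m to \<open>K 1 / 2\<close>, the
    same quantity that is left over at the start of the telescoping in \<open>B\<close>; the two
    cancel in the final comparison.\<close>
  have hk: "\<kappa> 1 m / 2 = h (of_nat (Suc m) * z)" for m
  proof -
    have "2 * a / b / 2 = a / b" for a b :: complex by simp
    then show ?thesis unfolding \<kappa>_def h_def by (simp only: of_nat_1 power_one power_mult_distrib)
  qed
  have "(\<lambda>m. R m + 1 / (of_nat (Suc m))^2 * (1 / z^2) - \<kappa> 1 m / 2) sums (S + of_real (pi^2 / 6) * (1 / z^2) - K 1 / 2)"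
    by (intro sums_add sums_diff sums_mult2 sums_divide S sqc K_sums)
  then have A: "(\<lambda>m. csc_sq (of_nat (Suc m) * z)) sums (S + of_real (pi^2 / 6) * (1 / z^2) - K 1 / 2)"
    unfolding hk by (simp add: R_def power_mult_distrib del: of_nat_Suc)
  show ?thesis
    by (rule that[OF A B']) (use z0 in \<open>simp add: right_diff_distrib add_diff_eq\<close>)
qed

section \<open>From cosecant sums to q-series\<close>

lemma csc_sq_exp:
  fixes w :: complex
  assumes "Im w \<noteq> 0"
  shows "csc_sq w = - 4 * (of_real pi)^2 * (qpar w / (1 - qpar w)^2)"
proof -
  define u where "u = exp (\<i> * (of_real pi * w))"
  have q: "qpar w = u^2" unfolding qpar_def u_def by (simp add: exp_of_nat_mult[symmetric] algebra_simps)
  have u: "u \<noteq> 0" unfolding u_def by simp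
  have s: "sin (of_real pi * w) = - \<i> * (u - 1/u) / 2"
    unfolding sin_exp_eq u_def by (simp add: exp_minus field_simps)
  have "sin (of_real pi * w) \<noteq> 0" by (rule sin_pi_nonzero[OF assms])
  then have "u - 1/u \<noteq> 0" unfolding s by auto
  then have nz: "1 - u^2 \<noteq> 0" using u by (auto simp: field_simps power2_eq_square)
  have "u - 1/u = - (1 - u^2) / u" using u by (simp add: field_simps power2_eq_square)
  then have S2: "(sin (of_real pi * w))^2 = - ((1 - u^2)^2 / u^2) / 4"
    unfolding s by (simp add: power_mult_distrib power_divide power2_commute)
  show ?thesis unfolding csc_sq_eq[OF assms] q S2 using nz u by (simp add: field_simps)
qed

lemma csc_sq_minus:
  assumes "Im w \<noteq> 0" shows "csc_sq (- w) = csc_sq w"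
  using assms by (simp add: csc_sq_eq)

lemma qpar_of_nat_mult: "qpar (of_nat n * z) = qpar z ^ n"
  unfolding qpar_def by (simp add: exp_of_nat_mult[symmetric] algebra_simps)

lemma norm_qpar: "norm (qpar z) = exp (- 2 * pi * Im z)"
  unfolding qpar_def by (simp add: norm_exp_eq_Re)

lemma norm_qpar_less_1: "Im z > 0 \<Longrightarrow> norm (qpar z) < 1"
  by (simp add: norm_qpar)

lemma qpar_nonzero [simp]: "qpar z \<noteq> 0"
  by (simp add: qpar_def)

text \<open>Both series are iterated sums of n x^(m n) over m, n >= 1, taken in the two possible
  orders.\<close>

lemma lambert_series:
  fixes x :: complex
  assumes x: "norm x < 1" and S: "(\<lambda>m. x ^ Suc m / (1 - x ^ Suc m)^2) sums S"
  shows "(\<lambda>n. of_nat (Suc n) * x ^ Suc n / (1 - x ^ Suc n)) sums S"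
proof -
  have xp: "norm (x ^ Suc n) < 1" for n
    unfolding norm_power by (rule power_less_one_iff[THEN iffD2]) (use x in auto)
  have 1: "(\<lambda>n. of_nat (Suc n) * x ^ (Suc n * Suc m)) sums (x ^ Suc m / (1 - x ^ Suc m)^2)" for m
  proof -
    have "(\<lambda>n. of_nat (Suc n) * (x ^ Suc m) ^ n * x ^ Suc m) sums (1 / (1 - x ^ Suc m)^2 * x ^ Suc m)"
      using xp[of m] by (intro sums_mult2 geometric_deriv_sums)
    then show ?thesis by (simp add: power_mult[symmetric] power_add[symmetric] mult.assoc algebra_simps)
  qed
  have 2: "(\<lambda>m. of_nat (Suc n) * x ^ (Suc n * Suc m)) sums (of_nat (Suc n) * x ^ Suc n / (1 - x ^ Suc n))" for n
  proof -
    have "(\<lambda>m. of_nat (Suc n) * x ^ Suc n * (x ^ Suc n) ^ m) sums (of_nat (Suc n) * x ^ Suc n * (1 / (1 - x ^ Suc n)))"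
      using xp[of n] by (intro sums_mult geometric_sums)
    then show ?thesis by (simp add: add_divide_distrib power_mult[symmetric] power_add[symmetric] mult.assoc algebra_simps)
  qed
  obtain T where T: "(\<lambda>m. x ^ Suc m / (1 - x ^ Suc m)^2) sums T"
      "(\<lambda>n. of_nat (Suc n) * x ^ Suc n / (1 - x ^ Suc n)) sums T"
  proof (rule dominated_double_series[of "\<lambda>m n. of_nat (Suc n) * x ^ (Suc n * Suc m)" "\<lambda>m. norm x ^ m" "\<lambda>n. real (Suc n) * norm x ^ n"])
    fix m n
    \<comment> \<open>From (n + 1)(m + 1) >= m + n one gets a majorant that is a product of a
      function of m and a function of n.\<close>
    have "norm x ^ (Suc n * Suc m) \<le> norm x ^ (m + n)"
      using x by (intro power_decreasing) auto
    then show "norm (of_nat (Suc n) * x ^ (Suc n * Suc m)) \<le> norm x ^ m * (real (Suc n) * norm x ^ n)"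
      by (simp add: norm_mult norm_power power_add mult_left_mono algebra_simps del: of_nat_Suc power_Suc mult_Suc mult_Suc_right)
  next
    show "summable (\<lambda>m. norm x ^ m)" using x by simp
    show "summable (\<lambda>n. real (Suc n) * norm x ^ n)"
      using geometric_deriv_sums[of "norm x"] x by (auto simp: sums_iff)
  qed (use 1 2 in auto)
  then show ?thesis using S sums_unique2 by blast
qed

section \<open>The discriminant function and its modular transformation\<close>

definition euler_prod :: "complex \<Rightarrow> complex" where
  "euler_prod x = prodinf (\<lambda>n. 1 - x ^ Suc n)"

lemma Delta_eq: "Delta z = qpar z * euler_prod (qpar z) ^ 24"
  by (simp add: Delta_def euler_prod_def)

lemma euler_factor_nonzero:
  fixes x :: complex
  assumes "norm x < 1" shows "1 - x ^ Suc n \<noteq> 0"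
proof
  assume "1 - x ^ Suc n = 0"
  then have "norm (x ^ Suc n) = 1" by simp
  moreover have "norm (x ^ Suc n) < 1"
    unfolding norm_power by (rule power_less_one_iff[THEN iffD2]) (use assms in auto)
  ultimately show False by simp
qed

lemma euler_prod_convergent:
  fixes x :: complex
  assumes "norm x < 1" shows "convergent_prod (\<lambda>n. 1 - x ^ Suc n)"
proof -
  have "summable (\<lambda>n. norm x ^ Suc n)"
    using assms by (simp add: summable_mult del: power_Suc add: power_Suc)
  then have "summable (\<lambda>n. norm ((1 - x ^ Suc n) - 1))"
    by (simp add: norm_power norm_mult)
  then have "abs_convergent_prod (\<lambda>n. 1 - x ^ Suc n)"
    by (intro summable_imp_abs_convergent_prod)
  then show ?thesis by (rule abs_convergent_prod_imp_convergent_prod)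
qed

lemma euler_prod_nonzero:
  assumes "norm x < 1" shows "euler_prod x \<noteq> 0"
  unfolding euler_prod_def
  by (rule prodinf_nonzero[OF euler_prod_convergent[OF assms]]) (use euler_factor_nonzero[OF assms] in auto)

lemma euler_prod_uniform:
  assumes r: "0 \<le> r" "r < 1"
  shows "uniform_limit (cball 0 r) (\<lambda>n x. \<Prod>k<n. 1 - x ^ Suc k) euler_prod sequentially"
proof -
  have "uniformly_convergent_on (cball (0::complex) r) (\<lambda>n x. \<Prod>k<n. 1 - x ^ Suc k)"
  proof (rule uniformly_convergent_on_prod')
    show "uniformly_convergent_on (cball (0::complex) r) (\<lambda>N x. \<Sum>n<N. norm (1 - x ^ Suc n - 1))"
    proof (rule Weierstrass_m_test'[where M = "\<lambda>n. r ^ Suc n"])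
      show "norm (norm (1 - x ^ Suc n - 1)) \<le> r ^ Suc n" if "x \<in> cball 0 r" for n and x :: complex
        using that r by (auto simp: norm_mult norm_power intro!: mult_mono power_mono)
      show "summable (\<lambda>n. r ^ Suc n)"
        using r by (simp add: summable_mult)
    qed
  qed (auto intro!: continuous_intros)
  then have "uniform_limit (cball (0::complex) r) (\<lambda>n x. \<Prod>k<n. 1 - x ^ Suc k)
      (\<lambda>x. lim (\<lambda>n. \<Prod>k<n. 1 - x ^ Suc k)) sequentially"
    by (simp add: uniformly_convergent_uniform_limit_iff)
  moreover have "euler_prod x = lim (\<lambda>n. \<Prod>k<n. 1 - x ^ Suc k)" if "x \<in> cball 0 r" for x
    unfolding euler_prod_def
    by (rule prodinf_eq_lim') (use that r euler_prod_convergent euler_factor_nonzero in auto)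
  ultimately show ?thesis
    by (metis (mono_tags, lifting) uniform_limit_cong')
qed

lemma euler_prod_uniform_ball:
  assumes r: "0 \<le> r" "r < 1"
  shows "uniform_limit (ball 0 r) (\<lambda>n x. \<Prod>k<n. 1 - x ^ Suc k) euler_prod sequentially"
  using euler_prod_uniform[OF assms] by (rule uniform_limit_on_subset) auto

lemma euler_prod_holomorphic: "euler_prod holomorphic_on ball 0 1"
proof (rule holomorphic_uniform_sequence[where f = "\<lambda>n x. \<Prod>k<n. 1 - x ^ Suc k"])
  fix x :: complex assume x: "x \<in> ball 0 1"
  define d where "d = (1 - norm x) / 2"
  have d: "d > 0" "d \<le> 1" using x by (auto simp: d_def intro: order_trans[of _ 0])
  have sub: "cball x d \<subseteq> cball 0 (1 - d)"
  proof
    fix y assume "y \<in> cball x d"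
    then have "norm y \<le> norm x + d"
      using norm_triangle_ineq2[of y x] by (auto simp: dist_norm norm_minus_commute)
    then show "y \<in> cball 0 (1 - d)" by (auto simp: d_def field_simps)
  qed
  have "cball 0 (1 - d) \<subseteq> ball (0::complex) 1" using d by auto
  with sub have "cball x d \<subseteq> ball 0 1" by blast
  moreover have "uniform_limit (cball x d) (\<lambda>n x. \<Prod>k<n. 1 - x ^ Suc k) euler_prod sequentially"
    by (rule uniform_limit_on_subset[OF euler_prod_uniform sub]) (use d in auto)
  ultimately show "\<exists>d>0. cball x d \<subseteq> ball 0 1 \<and> uniform_limit (cball x d) (\<lambda>n x. \<Prod>k<n. 1 - x ^ Suc k) euler_prod sequentially"
    using d by blast
qed (auto intro!: holomorphic_intros)

lemma euler_prod_logderiv: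
  assumes x: "norm x < 1"
  shows "(\<lambda>n. - (of_nat (Suc n) * x ^ n) / (1 - x ^ Suc n)) sums (deriv euler_prod x / euler_prod x)"
proof -
  obtain r where r: "norm x < r" "r < 1" using x dense by blast
  have r0: "0 \<le> r" using r by (meson norm_ge_zero order_trans less_imp_le)
  have "(\<lambda>n. deriv (\<lambda>x. 1 - x ^ Suc n) x / (1 - x ^ Suc n)) sums (deriv euler_prod x / euler_prod x)"
    by (rule logderiv_prodinf_complex_uniform_limit[OF euler_prod_uniform_ball[OF r0 r(2)]])
      (use r x in \<open>auto intro!: holomorphic_intros euler_prod_nonzero\<close>)
  moreover have "deriv (\<lambda>x. 1 - x ^ Suc n) x = - (of_nat (Suc n) * x ^ n)" for n
    by (rule DERIV_imp_deriv) (auto intro!: derivative_eq_intros simp del: power_Suc)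
  ultimately show ?thesis by simp
qed

lemma euler_prod_0: "euler_prod 0 = 1"
  by (simp add: euler_prod_def)

text \<open>Multiplied by 24 this is the second coefficient tau(2) = -24 of the discriminant, the
  eigenvalue in \<open>Delta_Hecke2\<close>.\<close>

lemma deriv_euler_prod_0: "deriv euler_prod 0 = -1"
proof -
  have "(\<lambda>n. - (of_nat (Suc n) * 0 ^ n) / (1 - 0 ^ Suc n) :: complex) sums (deriv euler_prod 0 / euler_prod 0)"
    by (rule euler_prod_logderiv) simp
  moreover have "(\<lambda>n. - (of_nat (Suc n) * 0 ^ n) / (1 - 0 ^ Suc n) :: complex) = (\<lambda>n. if n = 0 then -1 else 0)"
    by (auto simp: fun_eq_iff)
  moreover have "(\<lambda>n. if n = 0 then -1 else 0 :: complex) sums -1"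
    using sums_single[of 0 "\<lambda>_. -1 :: complex"] by simp
  ultimately show ?thesis by (simp add: euler_prod_0 sums_iff)
qed

lemma Delta_nonzero: "Im z > 0 \<Longrightarrow> Delta z \<noteq> 0"
  by (simp add: Delta_eq euler_prod_nonzero norm_qpar_less_1)

text \<open>The factor 1 + 6 A / pi^2 is the Eisenstein series of weight 2: by
  \<open>csc_sq_exp\<close> and \<open>lambert_series\<close>, A is -4 pi^2 times the series of n
  q^n / (1 - q^n), which is also the logarithmic derivative of the Euler product up to sign.\<close>

lemma Delta_has_logderiv:
  assumes z: "Im z > 0" and A: "(\<lambda>m. csc_sq (of_nat (Suc m) * z)) sums A"
  shows "(Delta has_field_derivative 2 * of_real pi * \<i> * (1 + 6 / (of_real pi)^2 * A) * Delta z) (at z)"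
proof -
  let ?q = "qpar z"
  have q: "norm ?q < 1" by (rule norm_qpar_less_1[OF z])
  have im: "Im (of_nat (Suc m) * z) \<noteq> 0" for m using z by auto
  have "(\<lambda>m. csc_sq (of_nat (Suc m) * z) * (- 1 / (4 * (of_real pi)^2))) sums (A * (- 1 / (4 * (of_real pi)^2)))"
    by (intro sums_mult2 A)
  then have "(\<lambda>m. ?q ^ Suc m / (1 - ?q ^ Suc m)^2) sums (A * (- 1 / (4 * (of_real pi)^2)))"
    unfolding csc_sq_exp[OF im] qpar_of_nat_mult by simp
  then have L: "(\<lambda>n. of_nat (Suc n) * ?q ^ Suc n / (1 - ?q ^ Suc n)) sums (A * (- 1 / (4 * (of_real pi)^2)))"
    by (rule lambert_series[OF q])
  have "(\<lambda>n. ?q * (- (of_nat (Suc n) * ?q ^ n) / (1 - ?q ^ Suc n))) sums (?q * (deriv euler_prod ?q / euler_prod ?q))"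
    by (intro sums_mult euler_prod_logderiv q)
  moreover have "?q * (- (of_nat (Suc n) * ?q ^ n) / (1 - ?q ^ Suc n)) = - (of_nat (Suc n) * ?q ^ Suc n / (1 - ?q ^ Suc n))" for n
    by (simp del: of_nat_Suc)
  ultimately have "(\<lambda>n. - (of_nat (Suc n) * ?q ^ Suc n / (1 - ?q ^ Suc n))) sums (?q * (deriv euler_prod ?q / euler_prod ?q))"
    by (simp only:)
  with sums_minus[OF L] have "?q * (deriv euler_prod ?q / euler_prod ?q) = A / (4 * (of_real pi)^2)"
    using sums_unique2 by fastforce
  then have eq: "?q * deriv euler_prod ?q = A / (4 * (of_real pi)^2) * euler_prod ?q"
    using euler_prod_nonzero[OF q] by (simp add: field_simps)
  have dq: "(qpar has_field_derivative 2 * of_real pi * \<i> * ?q) (at z)"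
    unfolding qpar_def by (auto intro!: derivative_eq_intros)
  have dE: "(euler_prod has_field_derivative deriv euler_prod ?q) (at ?q)"
    by (rule holomorphic_derivI[OF euler_prod_holomorphic]) (use q in auto)
  have dEq: "((\<lambda>z. euler_prod (qpar z)) has_field_derivative deriv euler_prod ?q * (2 * of_real pi * \<i> * ?q)) (at z)"
    by (rule DERIV_chain2[OF dE dq])
  have D: "((\<lambda>z. qpar z * euler_prod (qpar z) ^ 24) has_field_derivative
     2 * of_real pi * \<i> * ?q * euler_prod ?q ^ 24 + of_nat 24 * (deriv euler_prod ?q * (2 * of_real pi * \<i> * ?q)) * euler_prod ?q ^ 23 * ?q) (at z)"
    using DERIV_mult[OF dq DERIV_power[OF dEq, of 24]] by (simp add: algebra_simps)
  have alg: "c * q * e ^ 24 + of_nat 24 * (X * (c * q)) * e ^ 23 * q = c * (1 + 6 / p^2 * A) * (q * e ^ 24)"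
    if "q * X = A / (4 * p^2) * e" for c q e X p A :: complex
  proof -
    have "c * q * e ^ 24 + of_nat 24 * (X * (c * q)) * e ^ 23 * q = c * q * e ^ 24 + 24 * c * q * e ^ 23 * (q * X)"
      by simp
    also have "\<dots> = c * q * e ^ 24 + c * q * (e * e ^ 23) * (24 * (A / (4 * p^2)))"
      unfolding that by (simp only: mult_ac)
    also have "e * e ^ 23 = e ^ 24" by (simp add: power_numeral_reduce)
    also have "24 * (A / (4 * p^2)) = 6 / p^2 * A" by simp
    also have "c * q * f + c * q * f * g = c * (1 + g) * (q * f)" for f g
      by (simp add: algebra_simps)
    finally show ?thesis .
  qed
  show ?thesis using D unfolding Delta_eq[abs_def] alg[OF eq] .
qed

lemma holomorphic_Delta: "Delta holomorphic_on {z. Im z > 0}"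
proof (rule holomorphic_onI)
  fix z assume "z \<in> {z. Im z > 0}"
  then have z: "Im z > 0" by simp
  then obtain A where "(\<lambda>m. csc_sq (of_nat (Suc m) * z)) sums A"
    by (rule csc_sq_lattice_identity)
  from Delta_has_logderiv[OF z this]
  show "Delta field_differentiable at z within {z. Im z > 0}"
    by (meson field_differentiable_at_within field_differentiable_def)
qed

lemma Im_neg_inverse: "Im (- 1 / z) = Im z / (norm z)^2"
  by (simp add: Im_divide cmod_power2)

lemma Im_neg_inverse_pos: "Im z > 0 \<Longrightarrow> Im (- 1 / z) > 0"
  unfolding Im_neg_inverse by (auto intro!: divide_pos_pos)

text \<open>The quotient of the two sides has derivative zero, since the anomalous term of the
  weight 2 series matches the logarithmic derivative of z^12. The constant is read off at the fixed
  point i, where i^12 = 1.\<close>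

theorem Delta_S:
  assumes z: "Im z > 0"
  shows "Delta (- 1 / z) = z ^ 12 * Delta z"
proof -
  let ?H = "{z. Im z > 0}"
  define R where "R z = Delta (- 1 / z) / (z ^ 12 * Delta z)" for z
  have "\<exists>c. \<forall>z\<in>?H. R z = c"
  proof (rule has_field_derivative_zero_constant)
    show "convex ?H" by (simp add: convex_halfspace_Im_gt)
    fix z assume "z \<in> ?H"
    then have z: "Im z > 0" by simp
    then have z0: "z \<noteq> 0" by auto
    let ?w = "- 1 / z"
    have w: "Im ?w > 0" by (rule Im_neg_inverse_pos[OF z])
    obtain A B where A: "(\<lambda>m. csc_sq (of_nat (Suc m) * z)) sums A"
      and B0: "(\<lambda>n. csc_sq (of_nat (Suc n) / z)) sums B"
      and AB: "A = B / z^2 + of_real (pi^2 / 6) * (1 / z^2 - 1) + of_real pi * \<i> / z"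
      by (rule csc_sq_lattice_identity[OF z])
    have "csc_sq (of_nat (Suc n) * ?w) = csc_sq (of_nat (Suc n) / z)" for n
      using csc_sq_minus[of "of_nat (Suc n) / z"] z by (simp add: Im_divide del: of_nat_Suc)
    with B0 have B: "(\<lambda>n. csc_sq (of_nat (Suc n) * ?w)) sums B" by simp
    let ?a = "2 * of_real pi * \<i> * (1 + 6 / (of_real pi)^2 * A)" and ?b = "2 * of_real pi * \<i> * (1 + 6 / (of_real pi)^2 * B)"
    have dw: "((\<lambda>z. - 1 / z) has_field_derivative 1 / z^2) (at z)"
      using z0 by (auto intro!: derivative_eq_intros simp: power2_eq_square)
    have d1: "((\<lambda>z. Delta (- 1 / z)) has_field_derivative ?b * Delta ?w * (1 / z^2)) (at z)"
      by (rule DERIV_chain2[OF Delta_has_logderiv[OF w B] dw])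
    have d2: "((\<lambda>z. z ^ 12 * Delta z) has_field_derivative 12 * z ^ 11 * Delta z + z ^ 12 * (?a * Delta z)) (at z)"
      by (rule derivative_eq_intros Delta_has_logderiv[OF z A] refl)+ (simp add: algebra_simps)
    have nz: "z ^ 12 * Delta z \<noteq> 0" using z0 Delta_nonzero[OF z] by simp
    \<comment> \<open>The term pi i / z of the lattice identity, multiplied by 2 pi i * 6 / pi^2, is
      -12 / z; the terms with pi^2 / 6 turn the summand 1 into 1 / z^2.\<close>
    have "?b / z^2 = ?a + 12 / z"
      unfolding AB using z0 by (simp add: field_simps power2_eq_square)
    then have "?b * Delta ?w * (1 / z^2) * (z ^ 12 * Delta z) - Delta ?w * (12 * z ^ 11 * Delta z + z ^ 12 * (?a * Delta z)) = 0"
    proof -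
      assume e: "?b / z^2 = ?a + 12 / z"
      have "?b * Delta ?w * (1 / z^2) * (z ^ 12 * Delta z) = (?b / z^2) * Delta ?w * z ^ 12 * Delta z" by simp
      also have "\<dots> = (?a + 12 / z) * Delta ?w * z ^ 12 * Delta z" unfolding e ..
      also have "\<dots> = Delta ?w * (12 * z ^ 11 * Delta z + z ^ 12 * (?a * Delta z))"
      proof -
        have "(12 / z) * z ^ 12 = 12 * z ^ 11" using z0 by (simp add: power_numeral_reduce field_simps)
        moreover have "(a + t) * D * w * E = D * (t * w * E + w * (a * E))" for a t D w E :: complex
          by (simp add: algebra_simps)
        ultimately show ?thesis by metis
      qed
      finally show ?thesis by simp
    qed
    then have "(R has_field_derivative 0) (at z)"
      unfolding R_def using DERIV_divide[OF d1 d2 nz] by (simp add: mult.commute)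
    then show "(R has_field_derivative 0) (at z within ?H)" by (rule has_field_derivative_at_within)
  qed
  then obtain c where c: "\<And>z. Im z > 0 \<Longrightarrow> R z = c" by auto
  have "R \<i> = 1"
    unfolding R_def using Delta_nonzero[of \<i>] by (simp add: power_numeral_reduce)
  then have "R z = 1" using c[OF z] c[of \<i>] by simp
  then show ?thesis unfolding R_def using Delta_nonzero[OF z] by (auto simp: divide_eq_1_iff)
qed

lemma Delta_add_of_int: "Delta (z + of_int n) = Delta z"
proof -
  have "qpar (z + of_int n) = qpar z * exp (2 * of_real pi * \<i> * of_int n)"
    unfolding qpar_def by (simp add: distrib_left exp_add)
  also have "exp (2 * of_real pi * \<i> * of_int n) = 1"
    using exp_integer_2pi[of "of_int n"] by (simp add: algebra_simps)
  finally show ?thesis by (simp add: Delta_eq)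
qed

section \<open>Decay at the cusps\<close>

lemma power_le_fact_exp:
  fixes x :: real
  assumes "0 \<le> x" shows "x ^ k \<le> fact k * exp x"
proof -
  have "(\<Sum>n\<in>{k}. inverse (fact n) *\<^sub>R x ^ n) \<le> (\<Sum>n. inverse (fact n) *\<^sub>R x ^ n)"
    using assms summable_exp_generic[of x] by (intro sum_le_suminf) auto
  then have "x ^ k / fact k \<le> exp x" by (simp add: exp_def field_simps)
  then show ?thesis by (simp add: field_simps)
qed

lemma Delta_bound_cusp:
  assumes y: "y > 0"
  obtains C where "C \<ge> 0" "\<And>z. Im z \<ge> y \<Longrightarrow> norm (Delta z) \<le> C * exp (- 2 * pi * Im z)"
proof -
  let ?S = "cball (0::complex) (exp (- 2 * pi * y))"
  have sub: "?S \<subseteq> ball 0 1" using y by (auto simp: subset_iff intro: le_less_trans)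
  then have "compact (euler_prod ` ?S)"
    by (intro compact_continuous_image holomorphic_on_imp_continuous_on
      holomorphic_on_subset[OF euler_prod_holomorphic]) auto
  then obtain B where B: "\<And>x. x \<in> ?S \<Longrightarrow> norm (euler_prod x) \<le> B"
    by (meson compact_imp_bounded bounded_iff imageI)
  have B0: "B \<ge> 0" using B[of 0] by (auto intro: order_trans[OF norm_ge_zero])
  show ?thesis
  proof (rule that[of "B ^ 24"])
    show "norm (Delta z) \<le> B ^ 24 * exp (- 2 * pi * Im z)" if "Im z \<ge> y" for z
    proof -
      have "qpar z \<in> ?S" using that by (simp add: norm_qpar)
      then have "norm (euler_prod (qpar z)) ^ 24 \<le> B ^ 24" by (intro power_mono B) auto
      then show ?thesis unfolding Delta_eq norm_mult norm_power norm_qpar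
        by (simp add: mult.commute mult_left_mono)
    qed
  qed (use B0 in simp)
qed

text \<open>Euclid's algorithm: after an integer translation a fraction is c/b with 0 <= c < b, and
  for c > 0 it is -1/r with r = -b/c, of smaller denominator.\<close>

lemma rat_modular_induct:
  fixes P :: "rat \<Rightarrow> bool"
  assumes zero: "P 0" and plus: "\<And>r. P r \<Longrightarrow> P (r + 1)" and minus: "\<And>r. P r \<Longrightarrow> P (r - 1)"
    and inv: "\<And>r. r \<noteq> 0 \<Longrightarrow> P r \<Longrightarrow> P (- 1 / r)"
  shows "P r"
proof -
  have shift: "P (r + of_int k)" if "P r" for r k
  proof (induction k rule: int_induct[where k = 0])
    case base then show ?case using that by simp
  next
    case (step1 i) then show ?case using plus[of "r + of_int i"] by (simp add: add.assoc)
  next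
    case (step2 i) then show ?case using minus[of "r + of_int i"] by (simp add: add_diff_eq)
  qed
  have "P (of_int a / of_nat b)" if "b > 0" for a :: int and b :: nat
    using that
  proof (induction b arbitrary: a rule: less_induct)
    case (less b)
    define c where "c = nat (a mod int b)"
    have c: "a mod int b = int c" "c < b" using less.prems by (auto simp: c_def nat_less_iff)
    have "(of_int a :: rat) = of_int (a div int b * int b + a mod int b)" by simp
    then have eq: "of_int a / of_nat b = of_nat c / of_nat b + (of_int (a div int b) :: rat)"
      unfolding c(1) using less.prems by (simp add: field_simps)
    have "P (of_nat c / of_nat b)"
    proof (cases "c = 0")
      case True then show ?thesis using zero by simp
    next
      case False
      then have "P (of_int (- int b) / of_nat c)" using less.IH[of c "- int b"] c by simp
      then have "P (- 1 / (of_int (- int b) / of_nat c))" using False less.prems by (intro inv) auto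
      then show ?thesis using False less.prems by simp
    qed
    then show ?case unfolding eq by (rule shift)
  qed
  moreover obtain a b where "r = of_int a / of_nat b" "b > 0"
  proof -
    obtain a b where ab: "quotient_of r = (a, b)" by force
    then have "b > 0" "r = of_int a / of_int b"
      using quotient_of_denom_pos quotient_of_div by auto
    then show ?thesis using that[of a "nat b"] by simp
  qed
  ultimately show ?thesis by simp
qed

text \<open>The region is a cone with vertex at r, truncated at height \<open>\<delta>\<close>. Its
  aperture \<open>K\<close> is kept arbitrary in the induction because inversion maps a cone at -1/r
  only into a wider cone at r.\<close>

lemma Delta_bound_rational_cusp:
  fixes r :: rat and K :: real
  shows "\<exists>\<delta>>0. \<exists>C. \<forall>z. 0 < Im z \<and> Im z < \<delta> \<and> norm (z - of_rat r) \<le> K * Im z \<longrightarrow> norm (Delta z) \<le> C"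
proof (induction r arbitrary: K rule: rat_modular_induct)
  case 1
  obtain C where C: "C \<ge> 0" "\<And>z. Im z \<ge> 1 \<Longrightarrow> norm (Delta z) \<le> C * exp (- 2 * pi * Im z)"
    using Delta_bound_cusp[of 1] by auto
  define K' where "K' = max K 1"
  have K': "K' \<ge> 1" "K \<le> K'" by (auto simp: K'_def)
  show ?case
  proof (intro exI conjI allI impI)
    show "0 < 1 / K'^2" using K' by simp
    fix z assume z: "0 < Im z \<and> Im z < 1 / K'^2 \<and> norm (z - of_rat 0) \<le> K * Im z"
    let ?w = "- 1 / z"
    have z0: "norm z > 0" using z by auto
    have nz: "norm z \<le> K' * Im z"
      using z K' by (auto intro: order_trans mult_right_mono)
    have Iw: "Im ?w = Im z / (norm z)^2" by (rule Im_neg_inverse)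
    have "Im ?w \<ge> 1 / (K' * norm z)"
    proof -
      have "norm z * norm z \<le> K' * Im z * norm z" using nz by (intro mult_right_mono) auto
      then show ?thesis unfolding Iw using z0 K' by (simp add: field_simps power2_eq_square)
    qed
    moreover have "1 / (K' * norm z) \<ge> 1"
    proof -
      have "K' * norm z \<le> K' * (K' * Im z)" using nz K' by (intro mult_left_mono) auto
      also have "\<dots> \<le> 1" using z K' by (simp add: field_simps power2_eq_square)
      finally show ?thesis using K' z0 by (simp add: field_simps)
    qed
    ultimately have Iw1: "Im ?w \<ge> 1" and Iw2: "Im ?w \<ge> 1 / (K' * norm z)" by auto
    \<comment> \<open>Inside the cone |w| <= K' Im w, so the automorphy factor w^12 is polynomial in
      Im w and is absorbed by the exponential decay of Delta(w).\<close>
    have "Delta z = Delta (- 1 / ?w)" using z0 by simp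
    also have "\<dots> = ?w ^ 12 * Delta ?w" using Delta_S[of ?w] Iw1 by simp
    finally have "norm (Delta z) = norm ?w ^ 12 * norm (Delta ?w)" by (simp add: norm_mult norm_power)
    also have "\<dots> \<le> norm ?w ^ 12 * (C * exp (- 2 * pi * Im ?w))"
      using C(2)[OF Iw1] by (intro mult_left_mono) auto
    also have "\<dots> \<le> (K' * Im ?w) ^ 12 * (C * exp (- Im ?w))"
    proof (intro mult_mono power_mono)
      show "norm ?w \<le> K' * Im ?w" using Iw2 K' z0 by (simp add: norm_divide field_simps)
      have "1 * Im ?w \<le> 2 * pi * Im ?w" using Iw1 pi_gt3 by (intro mult_right_mono) auto
      then show "exp (- 2 * pi * Im ?w) \<le> exp (- Im ?w)" by simp
    qed (use C K' Iw1 in auto)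
    also have "\<dots> = K' ^ 12 * C * ((Im ?w) ^ 12 * exp (- Im ?w))" by (simp add: power_mult_distrib)
    also have "\<dots> \<le> K' ^ 12 * C * fact 12"
    proof (intro mult_left_mono)
      have "(Im ?w) ^ 12 * exp (- Im ?w) \<le> (fact 12 * exp (Im ?w)) * exp (- Im ?w)"
        using Iw1 by (intro mult_right_mono power_le_fact_exp) auto
      then show "(Im ?w) ^ 12 * exp (- Im ?w) \<le> fact 12" by (simp add: mult.assoc exp_minus field_simps)
    qed (use C K' in auto)
    finally show "norm (Delta z) \<le> K' ^ 12 * C * fact 12" .
  qed
next
  case (2 r)
  then obtain \<delta> C where *: "\<delta> > 0" "\<And>z. 0 < Im z \<and> Im z < \<delta> \<and> norm (z - of_rat r) \<le> K * Im z \<Longrightarrow> norm (Delta z) \<le> C"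
    by blast
  have "norm (Delta z) \<le> C" if "0 < Im z \<and> Im z < \<delta> \<and> norm (z - of_rat (r + 1)) \<le> K * Im z" for z
    using *(2)[of "z - 1"] that Delta_add_of_int[of z "-1"] by (simp add: of_rat_add algebra_simps)
  then show ?case using *(1) by blast
next
  case (3 r)
  then obtain \<delta> C where *: "\<delta> > 0" "\<And>z. 0 < Im z \<and> Im z < \<delta> \<and> norm (z - of_rat r) \<le> K * Im z \<Longrightarrow> norm (Delta z) \<le> C"
    by blast
  have "norm (Delta z) \<le> C" if "0 < Im z \<and> Im z < \<delta> \<and> norm (z - of_rat (r - 1)) \<le> K * Im z" for z
    using *(2)[of "z + 1"] that Delta_add_of_int[of z "1"] by (simp add: of_rat_diff algebra_simps)
  then show ?case using *(1) by blast
next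
  case (4 r)
  define a where "a = norm (of_rat r :: complex)"
  define K' where "K' = max K 1"
  have K': "K' \<ge> 1" "K \<le> K'" by (auto simp: K'_def)
  have a: "a > 0" using 4 by (simp add: a_def)
  obtain \<delta> C where *: "\<delta> > 0" "\<And>z. 0 < Im z \<and> Im z < \<delta> \<and> norm (z - of_rat r) \<le> (2 * K') * Im z \<Longrightarrow> norm (Delta z) \<le> C"
    using "4.IH" by blast
  \<comment> \<open>The first bound keeps z within 1/(2a) of -1/r, hence 1/(2a) < |z| < 2/a; the
    second then gives Im(-1/z) < 4 a^2 Im z < \<open>\<delta>\<close>. The upper bound on |z| is
    also why the aperture at r is doubled.\<close>
  define d where "d = min (1 / (2 * a * K')) (\<delta> / (4 * a^2))"
  have "norm (Delta z) \<le> (2 * a) ^ 12 * C"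
    if z: "0 < Im z \<and> Im z < d \<and> norm (z - of_rat (- 1 / r)) \<le> K * Im z" for z
  proof -
    let ?w = "- 1 / z"
    have z0: "norm z > 0" using z by auto
    have rr: "(of_rat (- 1 / r) :: complex) = - 1 / of_rat r" by (simp add: of_rat_divide of_rat_minus)
    have nr: "norm (- 1 / of_rat r :: complex) = 1 / a" by (simp add: norm_divide a_def)
    have dist: "norm (z + 1 / of_rat r) \<le> K' * Im z"
      using z K' unfolding rr by (auto intro: order_trans mult_right_mono)
    have "K' * Im z < 1 / (2 * a)"
    proof -
      have "Im z < 1 / (2 * a * K')" using z by (simp add: d_def)
      then show ?thesis using K' a by (simp add: field_simps)
    qed
    with dist have d2: "norm (z - (- 1 / of_rat r)) < 1 / (2 * a)" by simp
    have half: "1 / a = 2 * (1 / (2 * a))" "2 / a = 4 * (1 / (2 * a))" "1 / (2 * a) > 0" using a by auto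
    have tri: "norm (- 1 / of_rat r :: complex) \<le> norm z + norm (z - (- 1 / of_rat r))"
      "norm z \<le> norm (- 1 / of_rat r :: complex) + norm (z - (- 1 / of_rat r))"
      using norm_triangle_ineq4[of z "z - (- 1 / of_rat r)"] norm_triangle_sub[of z "- 1 / of_rat r"] by auto
    have lo: "norm z > 1 / (2 * a)" using tri(1) d2 unfolding nr half(1) by linarith
    have hi: "norm z < 2 / a" using tri(2) d2 half(3) unfolding nr half(1,2) by linarith
    have Iw: "Im ?w = Im z / (norm z)^2" by (rule Im_neg_inverse)
    have Iw0: "Im ?w > 0" using z by (intro Im_neg_inverse_pos) auto
    have "Im ?w < \<delta>"
    proof -
      have "(1 / (2 * a))^2 < (norm z)^2" using lo a by (intro power_strict_mono) auto
      then have "Im z / (norm z)^2 < Im z / (1 / (2 * a))^2"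
        using z a z0 by (intro divide_strict_left_mono) (auto intro!: mult_pos_pos)
      also have "\<dots> = Im z * (4 * a^2)" by (simp add: power_divide power_mult_distrib)
      also have "\<dots> < \<delta>" using z a by (simp add: d_def field_simps)
      finally show ?thesis unfolding Iw .
    qed
    moreover have "norm (?w - of_rat r) \<le> (2 * K') * Im ?w"
    proof -
      have "z \<noteq> 0" "of_rat r \<noteq> (0::complex)" using z0 4 by auto
      then have "?w - of_rat r = - (of_rat r * (z + 1 / of_rat r)) / z" by (simp add: field_simps)
      then have "norm (?w - of_rat r) = a * norm (z + 1 / of_rat r) / norm z"
        by (simp add: norm_divide norm_mult a_def)
      also have "\<dots> \<le> a * (K' * Im z) / norm z" using dist a by (intro divide_right_mono mult_left_mono) auto
      also have "\<dots> = (a * norm z) * K' * Im ?w" unfolding Iw using z0 by (simp add: field_simps power2_eq_square)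
      also have "\<dots> \<le> 2 * K' * Im ?w"
        using hi a K' Iw0 by (intro mult_right_mono) (auto simp: field_simps)
      finally show ?thesis .
    qed
    ultimately have C: "norm (Delta ?w) \<le> C" using *(2) Iw0 by blast
    have "Delta z = Delta (- 1 / ?w)" using z0 by simp
    also have "\<dots> = ?w ^ 12 * Delta ?w" using Delta_S[OF Iw0] .
    finally have "norm (Delta z) = norm ?w ^ 12 * norm (Delta ?w)" by (simp add: norm_mult norm_power)
    also have "\<dots> \<le> (2 * a) ^ 12 * C"
      using C lo a z0 by (intro mult_mono power_mono) (auto simp: norm_divide field_simps)
    finally show ?thesis .
  qed
  moreover have "d > 0" using a K' * by (simp add: d_def)
  ultimately show ?case by blast
qed

section \<open>Moments along vertical lines\<close>

text \<open>The two end limits of the primitive are part of the conclusion: integrability of f alone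
  makes its partial integrals converge at 0 and at infinity.\<close>

lemma FTC_half_line:
  fixes F f :: "real \<Rightarrow> complex"
  assumes F: "\<And>t. t > 0 \<Longrightarrow> (F has_vector_derivative f t) (at t)"
    and cont: "continuous_on {0<..} f" and int: "set_integrable lborel {0<..} f"
  obtains A B where "(F \<longlongrightarrow> A) (at_right 0)" "(F \<longlongrightarrow> B) at_top" "set_lebesgue_integral lborel {0<..} f = B - A"
proof -
  have I: "set_lebesgue_integral lborel {a..b} f = F b - F a" if "0 < a" "a \<le> b" for a b
  proof -
    have "(LBINT x=a..b. f x) = F b - F a"
    proof (rule interval_integral_FTC_finite)
      show "continuous_on {min a b..max a b} f"
        by (rule continuous_on_subset[OF cont]) (use that in auto)
      show "(F has_vector_derivative f x) (at x within {min a b..max a b})"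
        if "min a b \<le> x" "x \<le> max a b" for x
        using F[of x] that \<open>0 < a\<close> \<open>a \<le> b\<close> by (auto intro: has_vector_derivative_at_within)
    qed
    then show ?thesis using that by (simp add: interval_integral_Icc)
  qed
  have int1: "set_integrable lborel {0<..1} f" and int2: "set_integrable lborel {1..} f"
    by (rule set_integrable_subset[OF int]; force)+
  have "((\<lambda>a. set_lebesgue_integral lborel {a..1} f) \<longlongrightarrow> set_lebesgue_integral lborel {0<..1} f) (at_right 0)"
    by (rule tendsto_set_lebesgue_integral_at_right) (use int1 in auto)
  then have "((\<lambda>a. F 1 - F a) \<longlongrightarrow> set_lebesgue_integral lborel {0<..1} f) (at_right 0)"
    by (rule Lim_transform_eventually)
      (auto simp: eventually_at_right_field I intro!: exI[of _ 1])
  then have "((\<lambda>a. F 1 - (F 1 - F a)) \<longlongrightarrow> F 1 - set_lebesgue_integral lborel {0<..1} f) (at_right 0)"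
    by (intro tendsto_intros)
  then have A: "(F \<longlongrightarrow> F 1 - set_lebesgue_integral lborel {0<..1} f) (at_right 0)" by simp
  have "((\<lambda>b. set_lebesgue_integral lborel {1..b} f) \<longlongrightarrow> set_lebesgue_integral lborel {1..} f) at_top"
    by (rule tendsto_set_lebesgue_integral_at_top) (use int2 in auto)
  then have "((\<lambda>b. F b - F 1) \<longlongrightarrow> set_lebesgue_integral lborel {1..} f) at_top"
    by (rule Lim_transform_eventually)
      (auto simp: I intro!: eventually_at_top_linorderI[of 1])
  then have "((\<lambda>b. (F b - F 1) + F 1) \<longlongrightarrow> set_lebesgue_integral lborel {1..} f + F 1) at_top"
    by (intro tendsto_intros)
  then have B: "(F \<longlongrightarrow> set_lebesgue_integral lborel {1..} f + F 1) at_top" by simp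
  have "(LBINT x=ereal 0..\<infinity>. f x) = (set_lebesgue_integral lborel {1..} f + F 1) - (F 1 - set_lebesgue_integral lborel {0<..1} f)"
  proof (rule interval_integral_FTC_integrable[where F = F])
    have "einterval (ereal 0) \<infinity> = {0<..}" by (auto simp: einterval_def)
    then show "set_integrable lborel (einterval (ereal 0) \<infinity>) f" using int by simp
    show "isCont f x" if "ereal 0 < ereal x" for x
      using cont that by (simp add: continuous_on_eq_continuous_at open_greaterThan)
    show "((F \<circ> real_of_ereal) \<longlongrightarrow> F 1 - set_lebesgue_integral lborel {0<..1} f) (at_right (ereal 0))"
      unfolding ereal_tendsto_simps1 by (rule A)
    show "((F \<circ> real_of_ereal) \<longlongrightarrow> set_lebesgue_integral lborel {1..} f + F 1) (at_left \<infinity>)"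
      unfolding ereal_tendsto_simps1 by (rule B)
  qed (auto intro: F)
  then show ?thesis using that[OF A B] by (simp add: interval_integral_to_infinity_eq)
qed

lemma complex_of_rat_eq: "(of_rat r :: complex) = of_real (of_rat r)"
  by (cases r) (simp add: of_rat_rat)

lemma Im_of_rat [simp]: "Im (of_rat r) = 0"
  by (simp add: complex_of_rat_eq)

text \<open>Near t = 0 the vertical line lies in the cone of aperture 1 at r, where
  \<open>Delta\<close> is bounded. For larger t the decay exp(-2 pi t) <= exp(-2 t) outweighs the
  bound exp(t) on the polynomial factor and leaves exp(-t).\<close>

lemma Delta_moment_bound:
  fixes r :: rat
  obtains C where "\<And>t. t > 0 \<Longrightarrow> norm (Delta (of_rat r + \<i> * of_real t) * (of_rat r + \<i> * of_real t) ^ k) \<le> C * exp (- t)"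
proof -
  obtain \<delta> C1 where d: "\<delta> > 0" and C1: "\<And>z. 0 < Im z \<and> Im z < \<delta> \<and> norm (z - of_rat r) \<le> 1 * Im z \<Longrightarrow> norm (Delta z) \<le> C1"
    using Delta_bound_rational_cusp[of r 1] by blast
  obtain C2 where C2: "C2 \<ge> 0" "\<And>z. Im z \<ge> \<delta> \<Longrightarrow> norm (Delta z) \<le> C2 * exp (- 2 * pi * Im z)"
    using Delta_bound_cusp[OF d] by blast
  have im_rat: "Im (of_rat r) = 0" by (rule Im_of_rat)
  define a where "a = norm (of_rat r :: complex)"
  have a0: "a \<ge> 0" by (simp add: a_def)
  have pw: "norm ((of_rat r + \<i> * of_real t) ^ k) \<le> fact k * exp (a + t)" if "t > 0" for t
  proof -
    have "norm (of_rat r + \<i> * of_real t) \<le> a + t"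
      unfolding a_def using that by (intro norm_triangle_le) (simp add: norm_mult)
    then have "norm ((of_rat r + \<i> * of_real t) ^ k) \<le> (a + t) ^ k"
      unfolding norm_power by (intro power_mono) auto
    also have "\<dots> \<le> fact k * exp (a + t)" using that a0 by (intro power_le_fact_exp) auto
    finally show ?thesis .
  qed
  define C where "C = max (\<bar>C1\<bar> * fact k * exp (a + 2 * \<delta>)) (C2 * fact k * exp a)"
  show ?thesis
  proof (rule that[of C])
    fix t :: real assume t: "t > 0"
    let ?z = "of_rat r + \<i> * of_real t"
    have Im: "Im ?z = t" by (simp add: im_rat)
    have "norm (Delta ?z) * (fact k * exp (a + t)) \<le> C * exp (- t)"
    proof (cases "t < \<delta>")
      case True
      have "norm (Delta ?z) \<le> C1" by (rule C1) (use True t im_rat in \<open>simp add: norm_mult\<close>)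
      then have "norm (Delta ?z) * (fact k * exp (a + t)) \<le> \<bar>C1\<bar> * (fact k * exp (a + t))"
        by (intro mult_right_mono) auto
      also have "\<dots> = (\<bar>C1\<bar> * fact k * exp (a + 2 * t)) * exp (- t)" by (simp flip: exp_add)
      also have "\<dots> \<le> (\<bar>C1\<bar> * fact k * exp (a + 2 * \<delta>)) * exp (- t)"
        using True by (intro mult_right_mono mult_left_mono) auto
      also have "\<dots> \<le> C * exp (- t)" unfolding C_def by (intro mult_right_mono) auto
      finally show ?thesis .
    next
      case False
      then have "norm (Delta ?z) * (fact k * exp (a + t)) \<le> (C2 * exp (- 2 * pi * t)) * (fact k * exp (a + t))"
        using C2(2)[of ?z] Im by (intro mult_right_mono) auto
      also have "\<dots> = (C2 * fact k * exp a) * exp (t - 2 * pi * t)" by (simp add: exp_add exp_diff exp_minus field_simps)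
      also have "\<dots> \<le> (C2 * fact k * exp a) * exp (- t)"
      proof (intro mult_left_mono)
        have "2 * t \<le> 2 * pi * t" using t pi_gt3 by (intro mult_right_mono) auto
        then show "exp (t - 2 * pi * t) \<le> exp (- t)" by simp
      qed (use C2 in simp)
      also have "\<dots> \<le> C * exp (- t)" unfolding C_def by (intro mult_right_mono) auto
      finally show ?thesis .
    qed
    moreover have "norm (Delta ?z * ?z ^ k) \<le> norm (Delta ?z) * (fact k * exp (a + t))"
      unfolding norm_mult by (intro mult_left_mono pw t) auto
    ultimately show "norm (Delta ?z * ?z ^ k) \<le> C * exp (- t)" by linarith
  qed
qed

lemma continuous_on_Delta_vertical:
  "continuous_on {0<..} (\<lambda>t. Delta (of_rat r + \<i> * of_real t) * (of_rat r + \<i> * of_real t) ^ k)"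
proof -
  have im_rat: "Im (of_rat r) = 0" by (rule Im_of_rat)
  show ?thesis
    by (intro continuous_intros continuous_on_compose2[OF holomorphic_on_imp_continuous_on[OF holomorphic_Delta]])
      (auto simp: im_rat)
qed

lemma set_integrable_exp_neg: "set_integrable lborel {0<..} (\<lambda>t::real. C * exp (- t))"
proof -
  have "(\<lambda>x::real. exp (-x)) integrable_on {0..}"
    using integrable_on_exp_minus_to_infinity[of 1 0] by simp
  then have "(\<lambda>x::real. exp (-x)) absolutely_integrable_on {0..}"
    by (intro nonnegative_absolutely_integrable_1) auto
  then have "set_integrable lborel {0..} (\<lambda>x::real. exp (-x))"
    unfolding set_integrable_def by (subst (asm) integrable_completion) auto
  then have "set_integrable lborel {0<..} (\<lambda>x::real. exp (-x))"
    by (rule set_integrable_subset) auto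
  then show ?thesis
    using set_integrable_mult_right[of C lborel "{0<..}" "\<lambda>x. exp (-x)"]
    by (cases "C = 0") (auto simp: set_integrable_def)
qed

lemma set_integrable_Delta_moment:
  "set_integrable lborel {0<..} (\<lambda>t. Delta (of_rat r + \<i> * of_real t) * (of_rat r + \<i> * of_real t) ^ k)"
proof -
  obtain C where C: "\<And>t. t > 0 \<Longrightarrow> norm (Delta (of_rat r + \<i> * of_real t) * (of_rat r + \<i> * of_real t) ^ k) \<le> C * exp (- t)"
    using Delta_moment_bound by blast
  show ?thesis
  proof (rule set_integrable_bound[OF set_integrable_exp_neg[of C]])
    show "set_borel_measurable lborel {0<..} (\<lambda>t. Delta (of_rat r + \<i> * of_real t) * (of_rat r + \<i> * of_real t) ^ k)"
      unfolding set_borel_measurable_def using continuous_on_Delta_vertical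
      by (simp add: borel_measurable_continuous_on_indicator)
  qed (use C in \<open>force intro!: AE_I2\<close>)
qed

definition moment :: "rat \<Rightarrow> nat \<Rightarrow> complex" where
  "moment r k = set_lebesgue_integral lborel {0<..}
     (\<lambda>t::real. Delta (of_rat r + \<i> * of_real t) * (of_rat r + \<i> * of_real t) ^ k * \<i>)"

lemma Phi_eq: "k \<le> 10 \<Longrightarrow> Phi r k = 2 * of_real pi * \<i> * of_nat (10 choose k) * moment r k"
  by (simp add: Phi_def moment_def)

lemma convex_upper_half_plane: "convex {z. Im z > 0}"
  by (simp add: convex_halfspace_Im_gt)

lemma open_upper_half_plane: "open {z. Im z > 0}"
  by (simp add: open_halfspace_Im_gt)

section \<open>Boundary values of primitives, and the inversion of moments\<close>

lemma Delta_moment_primitive: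
  obtains g where "\<And>z. Im z > 0 \<Longrightarrow> (g has_field_derivative Delta z * z ^ k) (at z)"
proof -
  have "(\<lambda>z. Delta z * z ^ k) holomorphic_on {z. Im z > 0}"
    by (intro holomorphic_intros holomorphic_Delta)
  then obtain g where "\<And>z. z \<in> {z. Im z > 0} \<Longrightarrow> (g has_field_derivative Delta z * z ^ k) (at z within {z. Im z > 0})"
    using holomorphic_convex_primitive'[OF convex_upper_half_plane open_upper_half_plane] by blast
  then show ?thesis
    using that at_within_open[OF _ open_upper_half_plane] by (metis (mono_tags, lifting) mem_Collect_eq)
qed

text \<open>This replaces contour integration: a change of path becomes a comparison of boundary
  values of one primitive.\<close>

lemma moment_eq_primitive_diff:
  assumes g: "\<And>z. Im z > 0 \<Longrightarrow> (g has_field_derivative Delta z * z ^ k) (at z)"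
  obtains A B where "((\<lambda>t. g (of_rat r + \<i> * of_real t)) \<longlongrightarrow> A) (at_right 0)"
    "((\<lambda>t. g (of_rat r + \<i> * of_real t)) \<longlongrightarrow> B) at_top" "moment r k = B - A"
proof (rule FTC_half_line[of "\<lambda>t. g (of_rat r + \<i> * of_real t)"
    "\<lambda>t. Delta (of_rat r + \<i> * of_real t) * (of_rat r + \<i> * of_real t) ^ k * \<i>"])
  fix t :: real assume t: "t > 0"
  have "((\<lambda>t. g (of_rat r + \<i> * of_real t)) has_vector_derivative \<i> * (Delta (of_rat r + \<i> * of_real t) * (of_rat r + \<i> * of_real t) ^ k)) (at t)"
    by (rule field_vector_diff_chain_at[unfolded o_def, OF _ g])
      (auto intro!: derivative_eq_intros simp: t)
  then show "((\<lambda>t. g (of_rat r + \<i> * of_real t)) has_vector_derivative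
      Delta (of_rat r + \<i> * of_real t) * (of_rat r + \<i> * of_real t) ^ k * \<i>) (at t)"
    by (simp add: mult.commute)
next
  show "continuous_on {0<..} (\<lambda>t. Delta (of_rat r + \<i> * of_real t) * (of_rat r + \<i> * of_real t) ^ k * \<i>)"
    by (intro continuous_intros continuous_on_Delta_vertical)
  show "set_integrable lborel {0<..} (\<lambda>t. Delta (of_rat r + \<i> * of_real t) * (of_rat r + \<i> * of_real t) ^ k * \<i>)"
    by (intro set_integrable_mult_left set_integrable_Delta_moment)
qed (use that in \<open>auto simp: moment_def\<close>)

text \<open>At height t the two points are joined by a horizontal segment of constant length |r|, on
  which the integrand is O(exp(-t)).\<close>

lemma primitive_limit_cusp_indep:
  assumes g: "\<And>z. Im z > 0 \<Longrightarrow> (g has_field_derivative Delta z * z ^ k) (at z)"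
    and lim: "((\<lambda>t. g (of_rat r + \<i> * of_real t)) \<longlongrightarrow> B) at_top"
  shows "((\<lambda>t. g (\<i> * of_real t)) \<longlongrightarrow> B) at_top"
proof -
  obtain C where C: "C \<ge> 0" "\<And>z. Im z \<ge> 1 \<Longrightarrow> norm (Delta z) \<le> C * exp (- 2 * pi * Im z)"
    using Delta_bound_cusp[of 1] by auto
  define a where "a = norm (of_rat r :: complex)"
  have a0: "a \<ge> 0" by (simp add: a_def)
  have bd: "norm (g (of_rat r + \<i> * of_real t) - g (\<i> * of_real t)) \<le> C * fact k * exp a * exp (- t) * a" if t: "t \<ge> 1" for t
  proof -
    let ?S = "closed_segment (\<i> * of_real t) (of_rat r + \<i> * of_real t)"
    have S: "Im z = t \<and> norm z \<le> a + t" if zS: "z \<in> ?S" for z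
    proof -
      obtain u where u0: "0 \<le> u \<and> u \<le> 1 \<and> z = (1 - u) *\<^sub>R (\<i> * of_real t) + u *\<^sub>R (of_rat r + \<i> * of_real t)"
        by (rule exE[OF in_segment(1)[THEN iffD1, OF zS]])
      note u = conjunct1[OF u0] conjunct1[OF conjunct2[OF u0]] conjunct2[OF conjunct2[OF u0]]
      then have z: "z = of_real u * of_rat r + \<i> * of_real t"
        by (simp add: scaleR_conv_of_real algebra_simps)
      have "norm z \<le> norm (of_real u * of_rat r :: complex) + norm (\<i> * of_real t)"
        unfolding z by (rule norm_triangle_ineq)
      also have "\<dots> \<le> 1 * a + t"
        using u t a0 unfolding a_def by (intro add_mono) (auto simp: norm_mult intro!: mult_left_le_one_le)
      finally show ?thesis unfolding z by simp
    qed
    have "norm (g (of_rat r + \<i> * of_real t) - g (\<i> * of_real t)) \<le>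
        (C * fact k * exp a * exp (- t)) * norm ((of_rat r + \<i> * of_real t) - \<i> * of_real t)"
    proof (rule field_differentiable_bound[of ?S g "\<lambda>z. Delta z * z ^ k"])
      fix z assume z: "z \<in> ?S"
      have Imz: "Im z = t" "norm z \<le> a + t" using S[OF z] by auto
      show "(g has_field_derivative Delta z * z ^ k) (at z within ?S)"
        by (rule has_field_derivative_at_within[OF g]) (use Imz t in simp)
      have "norm (Delta z * z ^ k) \<le> (C * exp (- 2 * pi * t)) * (a + t) ^ k"
        unfolding norm_mult norm_power using C(2)[of z] Imz t C(1) a0
        by (intro mult_mono power_mono) auto
      also have "\<dots> \<le> (C * exp (- 2 * t)) * (fact k * exp (a + t))"
      proof (intro mult_mono mult_left_mono)
        have "2 * t \<le> 2 * pi * t" using t pi_gt3 by (intro mult_right_mono) auto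
        then show "exp (- 2 * pi * t) \<le> exp (- 2 * t)" by simp
        show "(a + t) ^ k \<le> fact k * exp (a + t)" using t a0 by (intro power_le_fact_exp) auto
      qed (use C t a0 in auto)
      also have "\<dots> = C * fact k * exp a * exp (- t)"
      proof -
        have "exp (- 2 * t) * exp (a + t) = exp a * exp (- t)" by (simp flip: exp_add)
        then show ?thesis by (simp add: mult.assoc mult.left_commute)
      qed
      finally show "norm (Delta z * z ^ k) \<le> C * fact k * exp a * exp (- t)" .
    qed auto
    then show ?thesis by (simp add: a_def)
  qed
  have "((\<lambda>t. C * fact k * exp a * exp (- t) * a) \<longlongrightarrow> 0) at_top"
    by real_asymp
  then have "((\<lambda>t. g (of_rat r + \<i> * of_real t) - g (\<i> * of_real t)) \<longlongrightarrow> 0) at_top"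
    by (rule Lim_null_comparison[rotated]) (auto intro!: eventually_at_top_linorderI[of 1] bd)
  from tendsto_diff[OF lim this] show ?thesis by simp
qed

text \<open>The image of the vertical line over r is a semicircle meeting the real axis
  perpendicularly at -1/r. At equal height it differs from the vertical line over -1/r by O(t^2),
  and the joining horizontal segment stays in a cone where \<open>Delta\<close> is bounded, so the
  primitive has the same limit along both paths.\<close>

lemma primitive_limit_rational_cusp:
  assumes g: "\<And>z. Im z > 0 \<Longrightarrow> (g has_field_derivative Delta z * z ^ k) (at z)"
    and r: "r \<noteq> 0"
    and lim: "((\<lambda>t. g (of_rat (- 1 / r) + \<i> * of_real t)) \<longlongrightarrow> A) (at_right 0)"
  shows "((\<lambda>t. g (- 1 / (of_rat r + \<i> * of_real t))) \<longlongrightarrow> A) (at_right 0)"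
proof -
  define \<rho> where "\<rho> = (of_rat r :: real)"
  have \<rho>: "\<rho> \<noteq> 0" "(of_rat r :: complex) = of_real \<rho>" "(of_rat (- 1 / r) :: complex) = of_real (- 1 / \<rho>)"
    using r by (auto simp: \<rho>_def complex_of_rat_eq of_rat_divide of_rat_minus)
  obtain \<delta> B0 where \<delta>: "\<delta> > 0" and B0: "\<And>z. 0 < Im z \<and> Im z < \<delta> \<and> norm (z - of_rat (- 1 / r)) \<le> 2 * Im z \<Longrightarrow> norm (Delta z) \<le> B0"
    using Delta_bound_rational_cusp[of "- 1 / r" 2] by blast
  \<comment> \<open>\<open>x t\<close> and \<open>h t\<close> are the real and imaginary parts of -1
    / (r + i t); \<open>h\<close> also serves as the parameter of the vertical line over
    -1/r.\<close>
  define h where "h t = t / (\<rho>^2 + t^2)" for t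
  define x where "x t = - \<rho> / (\<rho>^2 + t^2)" for t
  have u: "- 1 / (of_rat r + \<i> * of_real t) = of_real (x t) + \<i> * of_real (h t)" for t
    unfolding \<rho>(2) x_def h_def by (simp add: complex_eq_iff Re_divide Im_divide power2_eq_square)
  have pos: "\<rho>^2 + t^2 > 0" for t using \<rho> by (simp add: sum_power2_gt_zero_iff)
  have h_lim: "(h \<longlongrightarrow> 0) (at_right 0)"
    unfolding h_def by (rule tendsto_eq_intros refl | use \<rho> in simp)+
  have h_pos: "h t > 0" if "t > 0" for t unfolding h_def using that pos by simp
  have h_filter: "filterlim h (at_right 0) (at_right 0)"
    unfolding filterlim_at using h_lim h_pos by (auto simp: eventually_at_right_field intro!: exI[of _ 1] less_imp_neq[THEN not_sym])
  have lim2: "((\<lambda>t. g (of_rat (- 1 / r) + \<i> * of_real (h t))) \<longlongrightarrow> A) (at_right 0)"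
    by (rule filterlim_compose[OF lim h_filter])
  have gap: "x t - (- 1 / \<rho>) = t^2 / (\<rho> * (\<rho>^2 + t^2))" for t
    unfolding x_def using \<rho> pos[of t] by (simp add: field_simps power2_eq_square)
  define M where "M = \<bar>B0\<bar> * (1 / \<bar>\<rho>\<bar> + \<delta>) ^ k"
  have bd: "norm (g (of_real (x t) + \<i> * of_real (h t)) - g (of_rat (- 1 / r) + \<i> * of_real (h t))) \<le> M * \<bar>x t - (- 1 / \<rho>)\<bar>"
    if t: "0 < t" "t < \<bar>\<rho>\<bar>" "h t < \<delta> / 2" for t
  proof -
    let ?v = "of_rat (- 1 / r) + \<i> * of_real (h t) :: complex" and ?u = "of_real (x t) + \<i> * of_real (h t) :: complex"
    let ?S = "closed_segment ?v ?u"
    \<comment> \<open>A horizontal gap of at most the height keeps the segment within aperture 2,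
      the aperture for which \<open>B0\<close> was chosen.\<close>
    have gh: "\<bar>x t - (- 1 / \<rho>)\<bar> \<le> h t"
    proof -
      have "t * t \<le> \<bar>\<rho>\<bar> * t" using t by (intro mult_right_mono) auto
      then have "t^2 / \<bar>\<rho>\<bar> \<le> t" using \<rho> by (simp add: field_simps power2_eq_square)
      then have "t^2 / \<bar>\<rho>\<bar> / (\<rho>^2 + t^2) \<le> h t"
        unfolding h_def using pos[of t] by (intro divide_right_mono) auto
      then show ?thesis unfolding gap by (simp add: abs_divide abs_mult)
    qed
    have S: "Im z = h t \<and> norm (z - of_real (- 1 / \<rho>)) \<le> 2 * h t" if zS: "z \<in> ?S" for z
    proof -
      obtain s where s0: "0 \<le> s \<and> s \<le> 1 \<and> z = (1 - s) *\<^sub>R ?v + s *\<^sub>R ?u"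
        by (rule exE[OF in_segment(1)[THEN iffD1, OF zS]])
      note s = conjunct1[OF s0] conjunct1[OF conjunct2[OF s0]] conjunct2[OF conjunct2[OF s0]]
      have z: "z - of_real (- 1 / \<rho>) = of_real (s * (x t - (- 1 / \<rho>))) + \<i> * of_real (h t)"
        unfolding s(3) \<rho>(3) by (simp add: scaleR_conv_of_real algebra_simps add_divide_distrib diff_divide_distrib)
      have "norm (z - of_real (- 1 / \<rho>)) \<le> norm (of_real (s * (x t - (- 1 / \<rho>))) :: complex) + norm (\<i> * of_real (h t))"
        unfolding z by (rule norm_triangle_ineq)
      also have "norm (of_real (s * (x t - (- 1 / \<rho>))) :: complex) \<le> 1 * h t"
        unfolding norm_of_real abs_mult using s gh by (intro mult_mono) auto
      also have "norm (\<i> * of_real (h t)) = h t" using h_pos[OF t(1)] by (simp add: norm_mult)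
      finally have "norm (z - of_real (- 1 / \<rho>)) \<le> 2 * h t" by simp
      moreover have "Im z = Im (z - of_real (- 1 / \<rho>))" by simp
      then have "Im z = h t" unfolding z by simp
      ultimately show ?thesis by simp
    qed
    have "norm (g ?u - g ?v) \<le> M * norm (?u - ?v)"
    proof (rule field_differentiable_bound[of ?S g "\<lambda>z. Delta z * z ^ k"])
      fix z assume z: "z \<in> ?S"
      have Imz: "Im z = h t" "norm (z - of_real (- 1 / \<rho>)) \<le> 2 * h t" using S[OF z] by auto
      show "(g has_field_derivative Delta z * z ^ k) (at z within ?S)"
        by (rule has_field_derivative_at_within[OF g]) (use Imz h_pos[OF t(1)] in simp)
      have "norm (Delta z) \<le> B0"
        by (rule B0, unfold \<rho>(3)) (use Imz h_pos[OF t(1)] t \<delta> in simp)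
      moreover have "norm z \<le> norm (of_real (- 1 / \<rho>) :: complex) + norm (z - of_real (- 1 / \<rho>))"
        by (rule norm_triangle_sub)
      then have "norm z \<le> 1 / \<bar>\<rho>\<bar> + \<delta>" using Imz t by (simp add: norm_divide)
      ultimately show "norm (Delta z * z ^ k) \<le> M"
        unfolding norm_mult norm_power M_def by (intro mult_mono power_mono) auto
    qed auto
    also have "?u - ?v = of_real (x t - (- 1 / \<rho>))" unfolding \<rho>(3) by simp
    finally show ?thesis by (simp only: norm_of_real)
  qed
  have "((\<lambda>t. M * \<bar>x t - (- 1 / \<rho>)\<bar>) \<longlongrightarrow> 0) (at_right 0)"
    unfolding gap by (rule tendsto_eq_intros refl | use \<rho> in simp)+
  moreover have "eventually (\<lambda>t. norm (g (of_real (x t) + \<i> * of_real (h t)) - g (of_rat (- 1 / r) + \<i> * of_real (h t))) \<le> M * \<bar>x t - (- 1 / \<rho>)\<bar>) (at_right 0)"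
  proof -
    have "eventually (\<lambda>t. h t < \<delta> / 2) (at_right 0)" using h_lim \<delta> by (intro order_tendstoD) auto
    moreover have "eventually (\<lambda>t. 0 < t \<and> t < \<bar>\<rho>\<bar>) (at_right 0)"
      using \<rho> by (auto simp: eventually_at_right_field intro!: exI[of _ "\<bar>\<rho>\<bar>"])
    ultimately show ?thesis by eventually_elim (rule bd, auto)
  qed
  ultimately have "((\<lambda>t. g (of_real (x t) + \<i> * of_real (h t)) - g (of_rat (- 1 / r) + \<i> * of_real (h t))) \<longlongrightarrow> 0) (at_right 0)"
    by (rule Lim_null_comparison[rotated])
  from tendsto_add[OF this lim2] show ?thesis unfolding u by simp
qed

text \<open>Weight 12 makes the substitution z -> -1/z turn Delta z^k dz into (-1)^k Delta z^(10-k)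
  dz, so the two primitives match up to a constant that cancels in differences. The path from -1/r
  to infinity becomes the path from r to 0, which is (r to infinity) minus (0 to infinity).\<close>

theorem moment_S:
  assumes k: "k \<le> 10"
  shows "moment 0 k = - ((- 1) ^ k * moment 0 (10 - k))"
    and "r \<noteq> 0 \<Longrightarrow> moment (- 1 / r) k = (- 1) ^ k * (moment r (10 - k) - moment 0 (10 - k))"
proof -
  obtain g where g: "\<And>z. Im z > 0 \<Longrightarrow> (g has_field_derivative Delta z * z ^ k) (at z)"
    using Delta_moment_primitive[of k] by blast
  obtain f where f: "\<And>z. Im z > 0 \<Longrightarrow> (f has_field_derivative Delta z * z ^ (10 - k)) (at z)"
    using Delta_moment_primitive[of "10 - k"] by blast
  have "\<exists>e. \<forall>z\<in>{z. Im z > 0}. g (- 1 / z) - (- 1) ^ k * f z = e"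
  proof (rule has_field_derivative_zero_constant[OF convex_upper_half_plane])
    fix z assume "z \<in> {z. Im z > 0}"
    then have z: "Im z > 0" by simp
    then have z0: "z \<noteq> 0" by auto
    have dw: "((\<lambda>z. - 1 / z) has_field_derivative 1 / z^2) (at z)"
      using z0 by (auto intro!: derivative_eq_intros simp: power2_eq_square)
    have "((\<lambda>z. g (- 1 / z) - (- 1) ^ k * f z) has_field_derivative
       Delta (- 1 / z) * (- 1 / z) ^ k * (1 / z^2) - (- 1) ^ k * (Delta z * z ^ (10 - k))) (at z)"
      by (intro DERIV_diff DERIV_chain2[OF g dw] DERIV_cmult f z Im_neg_inverse_pos)
    moreover have "Delta (- 1 / z) * (- 1 / z) ^ k * (1 / z^2) = (- 1) ^ k * (Delta z * z ^ (10 - k))"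
    proof -
      have "z ^ 12 = z ^ (10 - k) * z ^ k * z ^ 2" using k by (simp flip: power_add)
      then show ?thesis unfolding Delta_S[OF z] power_divide using z0
        by (simp add: field_simps)
    qed
    ultimately show "((\<lambda>z. g (- 1 / z) - (- 1) ^ k * f z) has_field_derivative 0) (at z within {z. Im z > 0})"
      by (auto intro: has_field_derivative_at_within)
  qed
  then obtain e where e0: "\<forall>z\<in>{z. Im z > 0}. g (- 1 / z) - (- 1) ^ k * f z = e" ..
  have e: "g (- 1 / z) = (- 1) ^ k * f z + e" if "Im z > 0" for z
    using bspec[OF e0, of z] that by (simp only: mem_Collect_eq diff_eq_eq add.commute)
  have inv: "- 1 / (\<i> * of_real t) = \<i> * of_real (1 / t)" for t
    by (simp add: divide_inverse)
  have ev: "g (\<i> * of_real (1 / t)) = (- 1) ^ k * f (\<i> * of_real t) + e" if "t > 0" for t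
    using e[of "\<i> * of_real t"] that unfolding inv by simp
  obtain A0 B where g0: "((\<lambda>t. g (of_rat 0 + \<i> * of_real t)) \<longlongrightarrow> A0) (at_right 0)"
    "((\<lambda>t. g (of_rat 0 + \<i> * of_real t)) \<longlongrightarrow> B) at_top" "moment 0 k = B - A0"
    using moment_eq_primitive_diff[OF g] by blast
  obtain A0' B' where f0: "((\<lambda>t. f (of_rat 0 + \<i> * of_real t)) \<longlongrightarrow> A0') (at_right 0)"
    "((\<lambda>t. f (of_rat 0 + \<i> * of_real t)) \<longlongrightarrow> B') at_top" "moment 0 (10 - k) = B' - A0'"
    using moment_eq_primitive_diff[OF f] by blast
  have inv_top: "filterlim (\<lambda>t::real. 1 / t) (at_right 0) at_top"
    using filterlim_inverse_at_right_top by (simp add: divide_inverse)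
  have inv_right: "filterlim (\<lambda>t::real. 1 / t) at_top (at_right 0)"
    using filterlim_inverse_at_top_right by (simp add: divide_inverse)
  have "((\<lambda>t. g (\<i> * of_real (1 / t))) \<longlongrightarrow> A0) at_top"
    using filterlim_compose[OF g0(1) inv_top] by simp
  moreover have "((\<lambda>t. (- 1) ^ k * f (\<i> * of_real t) + e) \<longlongrightarrow> (- 1) ^ k * B' + e) at_top"
    using f0(2) by (intro tendsto_intros) simp
  then have "((\<lambda>t. g (\<i> * of_real (1 / t))) \<longlongrightarrow> (- 1) ^ k * B' + e) at_top"
    by (rule Lim_transform_eventually)
      (rule eventually_at_top_linorderI[of 1], rule ev[symmetric], simp)
  ultimately have A0: "A0 = (- 1) ^ k * B' + e"
    by (rule tendsto_unique[OF trivial_limit_at_top_linorder])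
  have "((\<lambda>t. g (\<i> * of_real (1 / t))) \<longlongrightarrow> B) (at_right 0)"
    using filterlim_compose[OF g0(2) inv_right] by simp
  moreover have "((\<lambda>t. (- 1) ^ k * f (\<i> * of_real t) + e) \<longlongrightarrow> (- 1) ^ k * A0' + e) (at_right 0)"
    using f0(1) by (intro tendsto_intros) simp
  then have "((\<lambda>t. g (\<i> * of_real (1 / t))) \<longlongrightarrow> (- 1) ^ k * A0' + e) (at_right 0)"
    by (rule Lim_transform_eventually)
      (rule eventually_at_rightI[of 0 1], rule ev[symmetric], auto)
  ultimately have B: "B = (- 1) ^ k * A0' + e"
    by (rule tendsto_unique[rotated]) simp
  show "moment 0 k = - ((- 1) ^ k * moment 0 (10 - k))"
    unfolding g0(3) f0(3) A0 B by (simp add: algebra_simps)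
  show "moment (- 1 / r) k = (- 1) ^ k * (moment r (10 - k) - moment 0 (10 - k))" if r: "r \<noteq> 0"
  proof -
    obtain A1 B1 where g1: "((\<lambda>t. g (of_rat (- 1 / r) + \<i> * of_real t)) \<longlongrightarrow> A1) (at_right 0)"
      "((\<lambda>t. g (of_rat (- 1 / r) + \<i> * of_real t)) \<longlongrightarrow> B1) at_top" "moment (- 1 / r) k = B1 - A1"
      using moment_eq_primitive_diff[OF g] by blast
    obtain A2 B2 where f2: "((\<lambda>t. f (of_rat r + \<i> * of_real t)) \<longlongrightarrow> A2) (at_right 0)"
      "((\<lambda>t. f (of_rat r + \<i> * of_real t)) \<longlongrightarrow> B2) at_top" "moment r (10 - k) = B2 - A2"
      using moment_eq_primitive_diff[OF f] by blast
    have B1: "B1 = B"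
      by (rule tendsto_unique[OF trivial_limit_at_top_linorder primitive_limit_cusp_indep[OF g g1(2)]])
        (use g0(2) in simp_all)
    have B2: "B2 = B'"
      by (rule tendsto_unique[OF trivial_limit_at_top_linorder primitive_limit_cusp_indep[OF f f2(2)]])
        (use f0(2) in simp_all)
    have "((\<lambda>t. (- 1) ^ k * f (of_rat r + \<i> * of_real t) + e) \<longlongrightarrow> (- 1) ^ k * A2 + e) (at_right 0)"
      using f2(1) by (intro tendsto_intros)
    then have "((\<lambda>t. g (- 1 / (of_rat r + \<i> * of_real t))) \<longlongrightarrow> (- 1) ^ k * A2 + e) (at_right 0)"
      by (rule Lim_transform_eventually)
        (rule eventually_at_rightI[of 0 1], rule e[symmetric], auto)
    moreover have "((\<lambda>t. g (- 1 / (of_rat r + \<i> * of_real t))) \<longlongrightarrow> A1) (at_right 0)"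
      by (rule primitive_limit_rational_cusp[OF g r g1(1)])
    ultimately have "A1 = (- 1) ^ k * A2 + e"
      using tendsto_unique[OF trivial_limit_at_right_real] by blast
    then show ?thesis
      unfolding g1(3) f2(3) f0(3) B1 B2 B by (simp add: algebra_simps)
  qed
qed

section \<open>The Hecke operator at 2\<close>

lemma moment_shift:
  "moment (r + of_int n) k = (\<Sum>j\<le>k. of_nat (k choose j) * of_int n ^ (k - j) * moment r j)"
proof -
  let ?z = "\<lambda>t::real. of_rat r + \<i> * of_real t :: complex"
  have "moment (r + of_int n) k = set_lebesgue_integral lborel {0<..}
      (\<lambda>t. \<Sum>j\<le>k. of_nat (k choose j) * of_int n ^ (k - j) * (Delta (?z t) * ?z t ^ j * \<i>))"
    unfolding moment_def
  proof (rule set_lebesgue_integral_cong)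
    show "\<forall>t. t \<in> {0<..} \<longrightarrow> Delta (of_rat (r + of_int n) + \<i> * of_real t) * (of_rat (r + of_int n) + \<i> * of_real t) ^ k * \<i>
      = (\<Sum>j\<le>k. of_nat (k choose j) * of_int n ^ (k - j) * (Delta (?z t) * ?z t ^ j * \<i>))"
    proof (intro allI impI)
      fix t :: real
      have e: "of_rat (r + of_int n) + \<i> * of_real t = ?z t + of_int n" by (simp add: of_rat_add)
      show "Delta (of_rat (r + of_int n) + \<i> * of_real t) * (of_rat (r + of_int n) + \<i> * of_real t) ^ k * \<i>
        = (\<Sum>j\<le>k. of_nat (k choose j) * of_int n ^ (k - j) * (Delta (?z t) * ?z t ^ j * \<i>))"
        unfolding e Delta_add_of_int binomial_ring by (simp add: sum_distrib_left sum_distrib_right mult_ac)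
    qed
  qed simp
  also have "\<dots> = (\<Sum>j\<le>k. set_lebesgue_integral lborel {0<..}
      (\<lambda>t. of_nat (k choose j) * of_int n ^ (k - j) * (Delta (?z t) * ?z t ^ j * \<i>)))"
    unfolding set_lebesgue_integral_def scaleR_sum_right
    by (rule Bochner_Integration.integral_sum)
      (use set_integrable_Delta_moment[of r] in \<open>auto simp: set_integrable_def[symmetric] simp del: set_integrable_mult_right_iff
        intro!: set_integrable_mult_left\<close>)
  finally show ?thesis by (simp add: moment_def)
qed

text \<open>The binomial weight inside \<open>Phi\<close> is carried through the binomial expansion
  by (10 choose k)(k choose j) = (10 choose j)(10-j choose k-j); the coefficients become those of X,
  Y -> X, nX + Y on forms of degree 10.\<close>

lemma Phi_shift:
  assumes "k \<le> 10"
  shows "Phi (r + of_int n) k = (\<Sum>j\<le>k. of_nat ((10 - j) choose (k - j)) * of_int n ^ (k - j) * Phi r j)"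
proof -
  have "Phi (r + of_int n) k = (\<Sum>j\<le>k. 2 * of_real pi * \<i> * of_nat ((10 choose k) * (k choose j)) * of_int n ^ (k - j) * moment r j)"
    unfolding Phi_eq[OF assms] moment_shift by (simp add: sum_distrib_left mult_ac)
  also have "\<dots> = (\<Sum>j\<le>k. of_nat ((10 - j) choose (k - j)) * of_int n ^ (k - j) * Phi r j)"
  proof (rule sum.cong)
    fix j assume j: "j \<in> {..k}"
    have "(10 choose k) * (k choose j) = (10 choose j) * ((10 - j) choose (k - j))"
      using choose_mult[of j k 10] j assms by simp
    then show "2 * of_real pi * \<i> * of_nat ((10 choose k) * (k choose j)) * of_int n ^ (k - j) * moment r j =
        of_nat ((10 - j) choose (k - j)) * of_int n ^ (k - j) * Phi r j"
      using Phi_eq[of j r] j assms by simp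
  qed simp
  finally show ?thesis .
qed

lemma Phi_S:
  assumes "k \<le> 10"
  shows "Phi 0 k = - ((- 1) ^ k * Phi 0 (10 - k))"
    and "r \<noteq> 0 \<Longrightarrow> Phi (- 1 / r) k = (- 1) ^ k * (Phi r (10 - k) - Phi 0 (10 - k))"
proof -
  have b: "10 choose (10 - k) = 10 choose k" using assms by (metis binomial_symmetric)
  have s: "Phi r (10 - k) = 2 * of_real pi * \<i> * of_nat (10 choose k) * moment r (10 - k)" for r
    using Phi_eq[of "10 - k" r] b by simp
  show "Phi 0 k = - ((- 1) ^ k * Phi 0 (10 - k))"
    unfolding Phi_eq[OF assms] s by (subst moment_S(1)[OF assms]) simp
  show "Phi (- 1 / r) k = (- 1) ^ k * (Phi r (10 - k) - Phi 0 (10 - k))" if "r \<noteq> 0"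
    unfolding Phi_eq[OF assms] s moment_S(2)[OF assms that] by (simp add: algebra_simps)
qed

section \<open>Positivity on the imaginary axis\<close>

lemma euler_prod_real: "euler_prod (of_real x) \<in> \<real>" if "norm x < 1"
proof -
  have c: "convergent_prod (\<lambda>n. 1 - (of_real x :: complex) ^ Suc n)"
    using that by (intro euler_prod_convergent) simp
  have lim: "(\<lambda>n. \<Prod>k\<le>n. 1 - (of_real x :: complex) ^ Suc k) \<longlonglongrightarrow> euler_prod (of_real x)"
    unfolding euler_prod_def by (rule convergent_prod_LIMSEQ[OF c])
  have mem: "(\<Prod>k\<le>n. 1 - (of_real x :: complex) ^ Suc k) \<in> \<real>" for n
    by (intro prod_in_Reals) auto
  show ?thesis
    by (rule Lim_in_closed_set[OF closed_complex_Reals _ sequentially_bot lim], rule always_eventually, rule allI, rule mem)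
qed

lemma Delta_imaginary_axis:
  assumes "t > 0"
  obtains d where "d > 0" "Delta (\<i> * of_real t) = of_real d"
proof -
  let ?x = "exp (- 2 * pi * t)"
  have "2 * of_real pi * \<i> * (\<i> * of_real t) = complex_of_real (- 2 * pi * t)" by (simp add: complex_eq_iff)
  then have q: "qpar (\<i> * of_real t) = of_real ?x"
    unfolding qpar_def by (simp only: exp_of_real)
  have x: "norm ?x < 1" using assms by simp
  obtain e where e: "euler_prod (of_real ?x) = of_real e" using euler_prod_real[OF x] by (auto elim: Reals_cases)
  have "euler_prod (of_real ?x) \<noteq> 0" by (rule euler_prod_nonzero) (use assms in simp)
  then have "e \<noteq> 0" using e by auto
  then have "?x * e ^ 24 > 0" by (simp add: zero_less_power_eq)
  moreover have "Delta (\<i> * of_real t) = of_real (?x * e ^ 24)" unfolding Delta_eq q e by simp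
  ultimately show ?thesis using that by blast
qed

text \<open>Since i^8 = 1, the integrand on the imaginary axis is i times the positive function
  Delta(it) t^8. Its nonvanishing allows this moment to normalise the plus symbol.\<close>

lemma moment_0_8_nonzero: "moment 0 8 \<noteq> 0"
proof
  assume "moment 0 8 = 0"
  define f where "f t = Re (Delta (\<i> * of_real t)) * t ^ 8" for t
  have eq: "Delta (\<i> * of_real t) * (\<i> * of_real t) ^ 8 = of_real (f t)" "f t > 0" if t: "t > 0" for t
  proof -
    obtain d where d: "d > 0" "Delta (\<i> * of_real t) = of_real d" using Delta_imaginary_axis[OF t] .
    have "\<i> ^ 8 = (1 :: complex)" by (simp add: power_numeral_reduce)
    then have "(\<i> * of_real t) ^ 8 = of_real (t ^ 8)" by (simp add: power_mult_distrib)
    then show "Delta (\<i> * of_real t) * (\<i> * of_real t) ^ 8 = of_real (f t)" "f t > 0"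
      unfolding f_def using d t by auto
  qed
  have "set_integrable lborel {0<..} (\<lambda>t. Delta (of_rat 0 + \<i> * of_real t) * (of_rat 0 + \<i> * of_real t) ^ 8)"
    by (rule set_integrable_Delta_moment)
  then have "set_integrable lborel {0<..} (\<lambda>t. complex_of_real (f t))"
    by (rule set_integrable_cong[THEN iffD1, rotated 3]) (auto simp: eq(1)[symmetric])
  then have int: "integrable lborel (\<lambda>t. indicator {0<..} t * f t)"
    unfolding set_integrable_def by (drule_tac integrable_Re) (simp add: scaleR_conv_of_real)
  have "moment 0 8 = set_lebesgue_integral lborel {0<..} (\<lambda>t. of_real (f t)) * \<i>"
    unfolding moment_def set_integral_mult_left by (subst set_lebesgue_integral_cong[of _ _ _ "\<lambda>t. of_real (f t)"]) (auto simp: eq(1))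
  also have "set_lebesgue_integral lborel {0<..} (\<lambda>t. of_real (f t) :: complex) = of_real (\<integral>t. indicator {0<..} t * f t \<partial>lborel)"
    unfolding set_lebesgue_integral_def integral_complex_of_real[symmetric]
    by (intro Bochner_Integration.integral_cong) (auto simp: indicator_def)
  finally have "(\<integral>t. indicator {0<..} t * f t \<partial>lborel) = 0" using \<open>moment 0 8 = 0\<close> by simp
  then have "AE t in lborel. indicator {0<..} t * f t = 0"
    by (subst (asm) integral_nonneg_eq_0_iff_AE[OF int]) (auto simp: indicator_def eq(2) less_imp_le)
  then have "AE t in lborel. t \<notin> {0<..<1::real}"
    by eventually_elim (use eq(2) in \<open>force simp: indicator_def\<close>)
  then have "{0<..<1::real} \<in> null_sets lborel"
    by (subst (asm) AE_iff_null_sets[symmetric]) auto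
  then show False by (simp add: null_sets_def)
qed

text \<open>The quotient of both sides by \<open>Delta z\<close> is a holomorphic even function \<open>G\<close> of \<open>s = exp (\<pi> \<i> z)\<close> on the unit
  disc, invariant under \<open>z \<mapsto> - 1 / z\<close>. A point where \<open>\<bar>G\<bar>\<close> is maximal on \<open>Im z \<ge> 1 / 2\<close> may be taken
  with \<open>\<bar>Re z\<bar> \<le> 1 / 2\<close>; if it lies on the boundary, its image under \<open>z \<mapsto> - 1 / z\<close> lies in the interior.\<close>

lemma Delta_Hecke2:
  assumes z: "Im z > 0"
  shows "2 ^ 11 * Delta (2 * z) + (Delta (z / 2) + Delta ((z + 1) / 2)) / 2 = - 24 * Delta z"
proof -
  define t where "t z = 2 ^ 11 * Delta (2 * z) + (Delta (z / 2) + Delta ((z + 1) / 2)) / 2" for z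
  define U where "U x = euler_prod x ^ 24" for x
  \<comment> \<open>With s = qpar (z / 2), the two half-argument terms combine to s times the odd
    part \<open>V\<close> of \<open>U\<close>. Dividing by \<open>Delta z\<close> = s^2 U(s^2)
    leaves V(s)/s, whose removable singularity is filled by \<open>W\<close>; hence \<open>G\<close>
    is defined at the cusp s = 0.\<close>
  define V where "V x = (U x - U (- x)) / 2" for x
  define W where "W x = (if x = 0 then deriv V 0 else (V x - V 0) / (x - 0))" for x
  define G where "G s = (2 ^ 11 * s^2 * U (s ^ 4) + W s) / U (s^2)" for s
  have holU: "U holomorphic_on ball 0 1" unfolding U_def by (intro holomorphic_intros euler_prod_holomorphic)
  have holUm: "(\<lambda>x. U (- x)) holomorphic_on ball 0 1"
    by (rule holomorphic_on_compose_gen[of uminus "ball 0 1" U "ball 0 1", unfolded o_def])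
      (auto intro!: holomorphic_intros holU)
  have holV: "V holomorphic_on ball 0 1" unfolding V_def by (intro holomorphic_intros holU holUm) auto
  have holW: "W holomorphic_on ball 0 1" unfolding W_def by (rule pole_lemma_open[OF holV]) auto
  have pw: "s ^ n \<in> ball 0 1" if "s \<in> ball 0 1" "n > 0" for s :: complex and n
    using that by (simp add: norm_power power_less_one_iff)
  have holUp: "(\<lambda>s. U (s ^ n)) holomorphic_on ball 0 1" if "n > 0" for n
    by (rule holomorphic_on_compose_gen[of "\<lambda>s. s ^ n" "ball 0 1" U "ball 0 1", unfolded o_def])
      (use pw that in \<open>auto intro!: holomorphic_intros holU\<close>)
  have U_nz: "U s \<noteq> 0" if "s \<in> ball 0 1" for s
    using that euler_prod_nonzero by (simp add: U_def)
  have holG: "G holomorphic_on ball 0 1"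
    unfolding G_def by (intro holomorphic_intros holUp holW U_nz pw) auto
  have dU: "(U has_field_derivative -24) (at 0)"
  proof -
    have "(euler_prod has_field_derivative deriv euler_prod 0) (at 0)"
      by (rule holomorphic_derivI[OF euler_prod_holomorphic]) auto
    from DERIV_power[OF this, of 24] show ?thesis
      unfolding U_def deriv_euler_prod_0 euler_prod_0 by simp
  qed
  have dUm: "((\<lambda>x. U (- x)) has_field_derivative 24) (at 0)"
  proof -
    have "(U has_field_derivative -24) (at (- 0))" using dU by simp
    from DERIV_chain2[OF this DERIV_minus[OF DERIV_ident]] show ?thesis by simp
  qed
  have dV: "deriv V 0 = - 24"
    unfolding V_def using DERIV_imp_deriv[OF DERIV_cdivide[OF DERIV_diff[OF dU dUm], of 2]] by simp
  have V0: "V 0 = 0" by (simp add: V_def)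
  have G0: "G 0 = - 24" by (simp add: G_def W_def dV U_def euler_prod_0)
  have W_even: "W (- s) = W s" for s
  proof -
    have "V (- s) = - V s" by (simp only: V_def minus_divide_left minus_diff_eq minus_minus)
    then show ?thesis by (simp add: W_def V0)
  qed
  have G_even: "G (- s) = G s" for s by (simp add: G_def W_even)
  have tG: "t z = G (qpar (z / 2)) * Delta z" if z: "Im z > 0" for z
  proof -
    define s where "s = qpar (z / 2)"
    have s: "s \<in> ball 0 1" "s \<noteq> 0" unfolding s_def using z by (auto intro: norm_qpar_less_1)
    have q1: "qpar z = s^2" unfolding s_def using qpar_of_nat_mult[of 2 "z/2"] by simp
    have q2: "qpar (2 * z) = s^4" unfolding s_def using qpar_of_nat_mult[of 4 "z/2"] by simp
    have q3: "qpar ((z + 1) / 2) = - s"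
      unfolding s_def qpar_def by (simp add: add_divide_distrib distrib_left exp_add)
    have "t z = 2 ^ 11 * (s^4 * U (s^4)) + (s * U s - s * U (- s)) / 2"
      unfolding t_def Delta_eq q1 q2 q3 U_def s_def[symmetric] by simp
    also have "(s * U s - s * U (- s)) / 2 = s^2 * W s"
    proof -
      have "(a * x - a * y) / 2 = a^2 * (((x - y) / 2 - 0) / (a - 0))" if "a \<noteq> 0" for a x y :: complex
        using that by (simp add: power2_eq_square flip: right_diff_distrib)
      then show ?thesis using s unfolding W_def V0 V_def by simp
    qed
    also have "2 ^ 11 * (s^4 * U (s^4)) + s^2 * W s = G s * (s^2 * U (s^2))"
    proof -
      have "G s * U (s^2) = 2 ^ 11 * s^2 * U (s ^ 4) + W s"
        unfolding G_def using U_nz[OF pw[OF s(1), of 2]] by simp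
      then have "G s * (s^2 * U (s^2)) = s^2 * (2 ^ 11 * s^2 * U (s ^ 4) + W s)" by simp
      also have "\<dots> = 2 ^ 11 * (s^4 * U (s^4)) + s^2 * W s"
        by (simp add: distrib_left power_numeral_reduce)
      finally show ?thesis by simp
    qed
    also have "s^2 * U (s^2) = Delta z" unfolding Delta_eq q1 U_def ..
    finally show ?thesis unfolding s_def .
  qed
  have tS: "t (- 1 / z) = z ^ 12 * t z" if z: "Im z > 0" for z
  proof -
    have z0: "z \<noteq> 0" using z by auto
    have 1: "Delta (2 * (- 1 / z)) = (z / 2) ^ 12 * Delta (z / 2)"
      using Delta_S[of "z / 2"] z by simp
    have 2: "Delta ((- 1 / z) / 2) = (2 * z) ^ 12 * Delta (2 * z)"
      using Delta_S[of "2 * z"] z by (simp add: mult.commute)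
    \<comment> \<open>Inversion exchanges the other two terms but maps this one to itself: (-1/z +
      1)/2 arises from v by v -> v - 1, inversion, translation by -2 and inversion again. The two
      automorphy factors multiply to (x (v - 1))^12 = z^12.\<close>
    define v where "v = (z + 1) / 2"
    have v: "Im v > 0" "z = 2 * v - 1" using z by (auto simp: v_def add_divide_distrib distrib_left)
    define x where "x = - 1 / (v - 1) + of_int (- 2)"
    have Ix: "Im x > 0" unfolding x_def using Im_neg_inverse_pos[of "v - 1"] v by simp
    have nz: "v - 1 \<noteq> 0" "2 * v - 1 \<noteq> 0" using v z0 by auto
    have x: "x = - (2 * v - 1) / (v - 1)" unfolding x_def using nz by (simp add: field_simps)
    have "Delta x = (v - 1) ^ 12 * Delta v"
      unfolding x_def Delta_add_of_int using Delta_S[of "v - 1"] v Delta_add_of_int[of v "-1"] by simp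
    moreover have "(- 1 / z + 1) / 2 = - 1 / x"
      unfolding x v(2) using nz by (simp add: field_simps)
    ultimately have "Delta ((- 1 / z + 1) / 2) = (x * (v - 1)) ^ 12 * Delta v"
      using Delta_S[OF Ix] by (simp add: power_mult_distrib)
    also have "x * (v - 1) = - z" unfolding x v(2) using nz by simp
    finally have 3: "Delta ((- 1 / z + 1) / 2) = z ^ 12 * Delta ((z + 1) / 2)" unfolding v_def by simp
    show ?thesis unfolding t_def 1 2 3 by (simp add: algebra_simps power_mult_distrib power_divide add_divide_distrib)
  qed
  have G_inv: "G (qpar (- 1 / z / 2)) = G (qpar (z / 2))" if z: "Im z > 0" for z
  proof -
    have z0: "z \<noteq> 0" using z by auto
    have "G (qpar (- 1 / z / 2)) * (z ^ 12 * Delta z) = z ^ 12 * (G (qpar (z / 2)) * Delta z)"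
      using tG[OF Im_neg_inverse_pos[OF z]] tS[OF z] tG[OF z] Delta_S[OF z] by simp
    then show ?thesis using Delta_nonzero[OF z] z0 by simp
  qed
  \<comment> \<open>The modulus of qpar (z / 2) at Im z = 1/2, so the disc |s| <=
    \<open>\<rho>\<close> is the half-plane Im z >= 1/2 together with the cusp.\<close>
  define \<rho> where "\<rho> = exp (- pi / 2)"
  have \<rho>: "0 < \<rho>" "\<rho> < 1" unfolding \<rho>_def by auto
  have "\<exists>\<xi>\<in>cball 0 \<rho>. \<forall>x\<in>cball 0 \<rho>. norm (G x) \<le> norm (G \<xi>)"
    by (rule continuous_attains_sup)
      (use \<rho> in \<open>auto intro!: continuous_intros holomorphic_on_imp_continuous_on holomorphic_on_subset[OF holG]\<close>)
  then obtain \<xi> where \<xi>: "\<xi> \<in> cball 0 \<rho>" "\<And>x. x \<in> cball 0 \<rho> \<Longrightarrow> norm (G x) \<le> norm (G \<xi>)" by blast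
  obtain \<eta> where \<eta>: "\<eta> \<in> ball 0 \<rho>" "norm (G \<eta>) = norm (G \<xi>)"
  proof (cases "norm \<xi> < \<rho>")
    case True then show ?thesis using that by auto
  next
    case False
    then have n\<xi>: "norm \<xi> = \<rho>" using \<xi> by simp
    \<comment> \<open>Changing the sign of s is the translation z -> z + 1; a nonnegative real part
      of s gives |Re w| <= 1/2. Then |w|^2 <= 1/2, and -1/w has imaginary part at least 1.\<close>
    define \<zeta> where "\<zeta> = (if Re \<xi> \<ge> 0 then \<xi> else - \<xi>)"
    have \<zeta>: "Re \<zeta> \<ge> 0" "norm \<zeta> = \<rho>" "\<zeta> \<noteq> 0" "G \<zeta> = G \<xi>"
      unfolding \<zeta>_def using n\<xi> \<rho> G_even by auto
    define w where "w = Ln \<zeta> / (of_real pi * \<i>)"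
    have w2: "qpar (w / 2) = \<zeta>" unfolding qpar_def w_def using \<zeta>(3) by simp
    have iw: "Im w = - Re (Ln \<zeta>) / pi" and rw: "Re w = Im (Ln \<zeta>) / pi"
      unfolding w_def by (simp_all add: Im_divide Re_divide power2_eq_square)
    have l1: "Re (Ln \<zeta>) = - pi / 2" using \<zeta> by (simp add: \<rho>_def)
    have l2: "\<bar>Im (Ln \<zeta>)\<bar> \<le> pi / 2" using Re_Ln_pos_le[OF \<zeta>(3)] \<zeta>(1) by simp
    have "\<bar>Re w\<bar> \<le> (pi / 2) / pi"
      unfolding rw abs_divide using l2 by (simp add: divide_right_mono)
    then have w: "Im w = 1 / 2" "\<bar>Re w\<bar> \<le> 1 / 2" unfolding iw l1 by simp_all
    have "(Re w)^2 \<le> (1/2)^2" using w(2) by (metis abs_ge_zero power_mono power2_abs)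
    then have "(norm w)^2 \<le> 1 / 2" unfolding cmod_power2 w(1) by (simp add: power2_eq_square)
    moreover have "(norm w)^2 > 0" using w(1) by auto
    ultimately have iv: "Im (- 1 / w) \<ge> 1" unfolding Im_neg_inverse w(1) by (simp add: field_simps)
    have "norm (qpar (v / 2)) < \<rho>" if "Im v \<ge> 1" for v
    proof -
      have "pi * 1 \<le> pi * Im v" using that by (intro mult_left_mono) auto
      then have "- 2 * pi * Im (v / 2) < - pi / 2" using pi_gt_zero by simp
      then show ?thesis unfolding norm_qpar \<rho>_def by (simp only: exp_less_cancel_iff)
    qed
    from this[OF iv] have "norm (qpar (- 1 / w / 2)) < \<rho>" .
    moreover have "G (qpar (- 1 / w / 2)) = G \<xi>" using G_inv[of w] w w2 \<zeta>(4) by simp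
    ultimately show ?thesis using that[of "qpar (- 1 / w / 2)"] by simp
  qed
  have "G constant_on ball 0 1"
    by (rule maximum_modulus_principle[OF holG, of "ball 0 \<rho>" \<eta>]) (use \<eta> \<rho> \<xi>(2) in auto)
  then obtain c where c: "\<And>s. s \<in> ball 0 1 \<Longrightarrow> G s = c" unfolding constant_on_def by blast
  have "qpar (z / 2) \<in> ball 0 1" using z by (auto intro: norm_qpar_less_1)
  then have "G (qpar (z / 2)) = - 24" using c[of 0] c[of "qpar (z / 2)"] G0 by simp
  then show ?thesis using tG[OF z] unfolding t_def by simp
qed

lemma set_integral_scale:
  fixes f :: "real \<Rightarrow> complex"
  assumes "c > 0"
  shows "set_lebesgue_integral lborel {0<..} (\<lambda>t. f (c * t)) = set_lebesgue_integral lborel {0<..} f / of_real c"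
proof -
  have "set_lebesgue_integral lborel {0<..} f = c *\<^sub>R (\<integral>t. indicator {0<..} (0 + c * t) *\<^sub>R f (0 + c * t) \<partial>lborel)"
    unfolding set_lebesgue_integral_def using assms by (subst lborel_integral_real_affine[of c _ 0]) auto
  also have "(\<lambda>t. indicator {0<..} (0 + c * t) *\<^sub>R f (0 + c * t)) = (\<lambda>t. indicator {0<..} t *\<^sub>R f (c * t))"
    using assms by (auto simp: fun_eq_iff indicator_def zero_less_mult_iff)
  finally show ?thesis using assms by (simp add: set_lebesgue_integral_def scaleR_conv_of_real)
qed

text \<open>Integrate the eigenform relation along the imaginary axis. The rescalings give 2^10 and
  1 times the moment at 0 plus the moment at 1/2, equal to -24 times the moment at 0, and 1024 + 1 +
  24 = 1049.\<close>

lemma moment_half: "moment (1 / 2) 0 = - 1049 * moment 0 0"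
proof -
  let ?I = "\<lambda>f. set_lebesgue_integral lborel {0<..} f"
  define d where "d = (\<lambda>t. Delta (\<i> * of_real t))"
  define h where "h = (\<lambda>t. Delta (1 / 2 + \<i> * of_real t))"
  have int: "set_integrable lborel {0<..} d" "set_integrable lborel {0<..} h"
    using set_integrable_Delta_moment[of 0 0] set_integrable_Delta_moment[of "1/2" 0] by (simp_all add: d_def h_def of_rat_divide)
  have sc: "set_integrable lborel {0<..} (\<lambda>t. f (c * t))" if "set_integrable lborel {0<..} f" "c > 0" for c and f :: "real \<Rightarrow> complex"
  proof -
    have "integrable lborel (\<lambda>t. indicator {0<..} (0 + c * t) *\<^sub>R f (0 + c * t))"
      by (rule lborel_integrable_real_affine) (use that in \<open>auto simp: set_integrable_def\<close>)
    moreover have "(\<lambda>t. indicator {0<..} (0 + c * t) *\<^sub>R f (0 + c * t)) = (\<lambda>t. indicator {0<..} t *\<^sub>R f (c * t))"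
      using that by (auto simp: fun_eq_iff indicator_def zero_less_mult_iff)
    ultimately show ?thesis by (simp add: set_integrable_def)
  qed
  have "?I (\<lambda>t. - 24 * d t) = ?I (\<lambda>t. 2 ^ 11 * d (2 * t) + (d ((1/2) * t) + h ((1/2) * t)) / 2)"
  proof (rule set_lebesgue_integral_cong)
    show "\<forall>t. t \<in> {0<..} \<longrightarrow> - 24 * d t = 2 ^ 11 * d (2 * t) + (d ((1/2) * t) + h ((1/2) * t)) / 2"
    proof (intro allI impI)
      fix t :: real assume "t \<in> {0<..}"
      then have "Im (\<i> * of_real t) > 0" by simp
      from Delta_Hecke2[OF this] show "- 24 * d t = 2 ^ 11 * d (2 * t) + (d ((1/2) * t) + h ((1/2) * t)) / 2"
        unfolding d_def h_def by (simp add: add_divide_distrib algebra_simps)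
    qed
  qed simp
  also have "\<dots> = ?I (\<lambda>t. 2 ^ 11 * d (2 * t)) + ?I (\<lambda>t. (d ((1/2) * t) + h ((1/2) * t)) / 2)"
    by (rule set_integral_add) (auto intro!: set_integral_add sc int simp del: times_divide_eq_left mult_1_left)
  also have "?I (\<lambda>t. (d ((1/2) * t) + h ((1/2) * t)) / 2) = (?I (\<lambda>t. d ((1/2) * t)) + ?I (\<lambda>t. h ((1/2) * t))) / 2"
    by (subst set_integral_add(2)[symmetric]) (auto intro!: sc int simp del: times_divide_eq_left mult_1_left)
  finally have "- 24 * ?I d = 2 ^ 11 * (?I d / 2) + (?I d / (1/2) + ?I h / (1/2)) / 2"
    unfolding set_integral_mult_right by (simp only: set_integral_scale zero_less_numeral zero_less_divide_1_iff of_real_numeral of_real_divide of_real_1)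
  then have "2 * (?I h + 1049 * ?I d) = 0" by (simp add: field_simps)
  then have "?I h + 1049 * ?I d = 0" by (metis mult_eq_0_iff zero_neq_numeral)
  then have "?I h = - 1049 * ?I d" by (simp add: eq_neg_iff_add_eq_0)
  moreover have "moment 0 0 = ?I d * \<i>" "moment (1 / 2) 0 = ?I h * \<i>"
    by (simp_all add: moment_def d_def h_def of_rat_divide)
  ultimately show ?thesis by simp
qed

section \<open>The plus part and its rational structure\<close>

definition Phi_plus :: "rat \<Rightarrow> nat \<Rightarrow> complex" where
  "Phi_plus r k = (Phi r k + (- 1) ^ k * Phi (- r) k) / 2"

lemma Phi_plus_shift:
  assumes "k \<le> 10"
  shows "Phi_plus (r + of_int n) k = (\<Sum>j\<le>k. of_nat ((10 - j) choose (k - j)) * of_int n ^ (k - j) * Phi_plus r j)"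
proof -
  have "Phi (- (r + of_int n)) k = (\<Sum>j\<le>k. of_nat ((10 - j) choose (k - j)) * of_int (- n) ^ (k - j) * Phi (- r) j)"
    using Phi_shift[OF assms, of "- r" "- n"] by simp
  then have "(- 1) ^ k * Phi (- (r + of_int n)) k =
      (\<Sum>j\<le>k. of_nat ((10 - j) choose (k - j)) * of_int n ^ (k - j) * ((- 1) ^ j * Phi (- r) j))"
  proof -
    have s: "(- 1) ^ k * of_int (- n) ^ (k - j) = of_int n ^ (k - j) * ((- 1) ^ j :: complex)" if "j \<le> k" for j
    proof -
      have "of_int (- n) ^ (k - j) = (- 1) ^ (k - j) * (of_int n ^ (k - j) :: complex)"
        by (simp add: power_minus[of "of_int n"])
      moreover have "(- 1) ^ k = (- 1) ^ (k - j) * ((- 1) ^ j :: complex)" using that by (simp flip: power_add)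
      moreover have "(- 1) ^ (k - j) * (- 1) ^ (k - j) = (1 :: complex)" by (simp flip: power_mult_distrib)
      ultimately show ?thesis by (metis (no_types, lifting) mult.assoc mult.commute mult_1)
    qed
    assume "Phi (- (r + of_int n)) k = (\<Sum>j\<le>k. of_nat ((10 - j) choose (k - j)) * of_int (- n) ^ (k - j) * Phi (- r) j)"
    then have "(- 1) ^ k * Phi (- (r + of_int n)) k =
       (\<Sum>j\<le>k. of_nat ((10 - j) choose (k - j)) * ((- 1) ^ k * of_int (- n) ^ (k - j)) * Phi (- r) j)"
      by (simp only: sum_distrib_left mult_ac)
    also have "\<dots> = (\<Sum>j\<le>k. of_nat ((10 - j) choose (k - j)) * of_int n ^ (k - j) * ((- 1) ^ j * Phi (- r) j))"
      by (intro sum.cong refl) (simp only: s atMost_iff mult_ac)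
    finally show ?thesis .
  qed
  then show ?thesis unfolding Phi_plus_def Phi_shift[OF assms, of r n]
    by (simp add: sum.distrib[symmetric] sum_divide_distrib distrib_left)
qed

lemma Phi_plus_S:
  assumes k: "k \<le> 10"
  shows "Phi_plus 0 k = - ((- 1) ^ k * Phi_plus 0 (10 - k))"
    and "r \<noteq> 0 \<Longrightarrow> Phi_plus (- 1 / r) k = (- 1) ^ k * (Phi_plus r (10 - k) - Phi_plus 0 (10 - k))"
proof -
  have e: "(- 1) ^ (10 - k) = ((- 1) ^ k :: complex)" using k
    by (cases "even k") auto
  have sq: "(- 1) ^ k * ((- 1) ^ k * x) = (x :: complex)" for x
    by (cases "even k") auto
  show "Phi_plus 0 k = - ((- 1) ^ k * Phi_plus 0 (10 - k))"
    using Phi_S(1)[OF k] by (cases "even k") (simp_all add: Phi_plus_def e)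
  show "Phi_plus (- 1 / r) k = (- 1) ^ k * (Phi_plus r (10 - k) - Phi_plus 0 (10 - k))" if r: "r \<noteq> 0"
  proof -
    have "- (- 1 / r) = - 1 / (- r)" using r by simp
    then have h: "Phi (- (- 1 / r)) k = (- 1) ^ k * (Phi (- r) (10 - k) - Phi 0 (10 - k))"
      using Phi_S(2)[OF k, of "- r"] r by simp
    show ?thesis unfolding Phi_plus_def e Phi_S(2)[OF k r] h
      by (cases "even k") (simp_all add: algebra_simps add_divide_distrib diff_divide_distrib)
  qed
qed

text \<open>The coefficient with k = 8 is chosen because all others are multiples of it by integers
  over 691, while its own multiple is 1: this makes it a cohomological period at 3.\<close>

definition base_period :: complex where "base_period = Phi_plus 0 8"

lemma base_period_nonzero: "base_period \<noteq> 0"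
proof -
  have "base_period = Phi 0 8" by (simp add: base_period_def Phi_plus_def)
  moreover have "10 choose 8 = (45 :: nat)" by (simp add: eval_nat_numeral)
  ultimately have eq: "base_period = 90 * (of_real pi * \<i>) * moment 0 8" by (simp add: Phi_eq)
  show ?thesis unfolding eq using moment_0_8_nonzero by simp
qed

text \<open>The coefficients of the even period polynomial, scaled by 691 so that they are integers.\<close>

definition period_num :: "nat \<Rightarrow> int" where
  "period_num k = (if k = 0 then 36 else if k = 2 then - 691 else if k = 4 then 2073
     else if k = 6 then - 2073 else if k = 8 then 691 else if k = 10 then - 36 else 0)"

text \<open>Parity and the inversion at 0 leave the coefficients 6, 8 and 10; comparing the cusps 1
  and -1 at k = 2 gives P6 = -3 P8. The value at 1/2 gives 2073 P10 + 108 P8 = 0, where 2073 = 3 *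
  691 = (1 + 2^11) - (-24) is the gap between the Eisenstein eigenvalue at 2 and tau(2).\<close>

lemma Phi_plus_0: 
  assumes "k \<le> 10"
  shows "Phi_plus 0 k = base_period * of_int (period_num k) / 691"
proof -
  let ?P = "Phi_plus 0"
  have odd: "?P k = 0" if "odd k" for k using that by (simp add: Phi_plus_def)
  have P0: "?P 0 = - ?P 10" and P2: "?P 2 = - ?P 8" and P4: "?P 4 = - ?P 6"
    using Phi_plus_S(1)[of 0] Phi_plus_S(1)[of 2] Phi_plus_S(1)[of 4] by simp_all
  have odds: "?P 1 = 0" "?P (Suc 0) = 0" "?P 3 = 0" "?P 5 = 0" "?P 7 = 0" "?P 9 = 0" by (simp_all add: odd)
  have sum2: "(\<Sum>j\<le>2. f j) = f 0 + f 1 + f 2" for f :: "nat \<Rightarrow> complex"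
    by (simp add: eval_nat_numeral)
  have sum8: "(\<Sum>j\<le>8. f j) = f 0 + f 1 + f 2 + f 3 + f 4 + f 5 + f 6 + f 7 + f 8" for f :: "nat \<Rightarrow> complex"
    by (simp add: eval_nat_numeral)
  have sum10: "(\<Sum>j\<le>10. f j) = f 0 + f 1 + f 2 + f 3 + f 4 + f 5 + f 6 + f 7 + f 8 + f 9 + f 10" for f :: "nat \<Rightarrow> complex"
    by (simp add: eval_nat_numeral)
  have binoms: "10 choose 2 = (45::nat)" "10 choose 8 = (45::nat)" "8 choose 6 = (28::nat)" "6 choose 4 = (15::nat)" "4 choose 2 = (6::nat)"
    by (simp_all add: eval_nat_numeral)
  have "Phi_plus (- 1) 2 = 45 * ?P 0 + ?P 2"
    using Phi_plus_shift[of 2 0 "- 1"] by (simp add: sum2 odds binoms)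
  moreover have "Phi_plus 1 8 = 45 * ?P 0 + 28 * ?P 2 + 15 * ?P 4 + 6 * ?P 6 + ?P 8"
    using Phi_plus_shift[of 8 0 1] by (simp add: sum8 odds binoms)
  moreover have "Phi_plus (- 1) 2 = Phi_plus 1 8 - ?P 8"
    using Phi_plus_S(2)[of 2 1] by simp
  ultimately have "9 * (?P 6 + 3 * ?P 8) = 0"
    unfolding P2 P4 by (simp add: algebra_simps)
  then have P6: "?P 6 = - 3 * ?P 8"
    by (metis add.inverse_inverse add_eq_0_iff2 minus_mult_left mult_eq_0_iff zero_neq_numeral)
  have half: "Phi_plus (1 / 2) 0 = - 1049 * ?P 0"
  proof -
    have "Phi (1 / 2) 0 = - 1049 * Phi 0 0" by (simp add: Phi_eq moment_half)
    moreover have "Phi (- (1 / 2)) 0 = Phi (1 / 2) 0" using Phi_shift[of 0 "1 / 2" "- 1"] by simp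
    ultimately show ?thesis by (simp add: Phi_plus_def)
  qed
  have "Phi_plus (- 2) 10 = - 1023 * ?P 10 - 108 * ?P 8" if "Phi_plus (- 2) 10 = 1024 * ?P 0 + 256 * ?P 2 + 64 * ?P 4 + 16 * ?P 6 + 4 * ?P 8 + ?P 10"
    unfolding that P0 P2 P4 P6 by (simp add: algebra_simps)
  moreover have "Phi_plus (- 2) 10 = 1024 * ?P 0 + 256 * ?P 2 + 64 * ?P 4 + 16 * ?P 6 + 4 * ?P 8 + ?P 10"
    using Phi_plus_shift[of 10 0 "- 2"] by (simp add: sum10 odds)
  moreover have "Phi_plus (1 / 2) 0 = Phi_plus (- 2) 10 - ?P 10"
    using Phi_plus_S(2)[of 0 "- 2"] by simp
  ultimately have "1049 * ?P 10 - (- 1023 * ?P 10 - 108 * ?P 8 - ?P 10) = 0"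
    unfolding half by (simp add: P0)
  moreover have "1049 * b - (- 1023 * b - 108 * c - b) = 3 * (691 * b + 36 * c)" for b c :: complex
    by (simp add: algebra_simps)
  ultimately have "3 * (691 * ?P 10 + 36 * ?P 8) = 0" by metis
  then have "691 * ?P 10 = - 36 * ?P 8"
    by (metis add.inverse_inverse add_eq_0_iff2 minus_mult_left mult_eq_0_iff zero_neq_numeral)
  then have P10: "?P 10 = - 36 * ?P 8 / 691" by (simp add: field_simps)
  have "k = 0 \<or> k = 1 \<or> k = 2 \<or> k = 3 \<or> k = 4 \<or> k = 5 \<or> k = 6 \<or> k = 7 \<or> k = 8 \<or> k = 9 \<or> k = 10"
    using assms by presburger
  then show ?thesis
    by (elim disjE) (simp_all add: period_num_def base_period_def odds P0 P2 P4 P6 P10)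
qed

text \<open>Translation and inversion act on coefficient vectors with integer matrices, so the
  lattice containing the vector at the cusp 0 contains those at all rational cusps.\<close>

lemma Phi_plus_integral: "\<forall>k\<le>10. \<exists>m::int. Phi_plus r k = base_period * of_int m / 691"
proof (induction r rule: rat_modular_induct)
  case 1 then show ?case using Phi_plus_0 by blast
next
  have shift: "\<forall>k\<le>10. \<exists>m::int. Phi_plus (r + of_int n) k = base_period * of_int m / 691"
    if r: "\<forall>k\<le>10. \<exists>m::int. Phi_plus r k = base_period * of_int m / 691" for r n
  proof (intro allI impI)
    fix k :: nat assume k: "k \<le> 10"
    obtain m :: "nat \<Rightarrow> int" where m: "\<And>j. j \<le> 10 \<Longrightarrow> Phi_plus r j = base_period * of_int (m j) / 691"
      using r by metis
    have "Phi_plus (r + of_int n) k = (\<Sum>j\<le>k. of_nat ((10 - j) choose (k - j)) * of_int n ^ (k - j) * (base_period * of_int (m j) / 691))"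
      unfolding Phi_plus_shift[OF k] using m k by (intro sum.cong) auto
    also have "\<dots> = base_period * of_int (\<Sum>j\<le>k. int ((10 - j) choose (k - j)) * n ^ (k - j) * m j) / 691"
      by (simp add: sum_distrib_left sum_divide_distrib mult_ac)
    finally show "\<exists>m::int. Phi_plus (r + of_int n) k = base_period * of_int m / 691" by blast
  qed
  { case (2 r) then show ?case using shift[of r 1] by simp }
  { case (3 r) then show ?case using shift[of r "- 1"] by simp }
next
  case (4 r)
  show ?case
  proof (intro allI impI)
    fix k :: nat assume k: "k \<le> 10"
    then obtain m where "Phi_plus r (10 - k) = base_period * of_int m / 691" using 4 by (meson diff_le_self)
    then have "Phi_plus (- 1 / r) k = base_period * of_int ((- 1) ^ k * (m - period_num (10 - k))) / 691"
      unfolding Phi_plus_S(2)[OF k \<open>r \<noteq> 0\<close>] by (simp add: Phi_plus_0 algebra_simps diff_divide_distrib)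
    then show "\<exists>m::int. Phi_plus (- 1 / r) k = base_period * of_int m / 691" by blast
  qed
qed

text \<open>Coordinates in units of \<open>base_period / 691\<close>, unique because the period is
  nonzero. As 691 is prime to 3, integer congruences for them carry the 3-adic information.\<close>

definition sym_coeff :: "rat \<Rightarrow> nat \<Rightarrow> int" where
  "sym_coeff r k = (SOME m. Phi_plus r k = base_period * of_int m / 691)"

lemma Phi_plus_eq: "k \<le> 10 \<Longrightarrow> Phi_plus r k = base_period * of_int (sym_coeff r k) / 691"
  unfolding sym_coeff_def using Phi_plus_integral by (metis (mono_tags, lifting) someI_ex)

lemma sym_coeff_eqI:
  assumes "k \<le> 10" "Phi_plus r k = base_period * of_int m / 691"
  shows "sym_coeff r k = m"
  using assms base_period_nonzero Phi_plus_eq[OF assms(1), of r] by simp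

lemma sym_coeff_0: "k \<le> 10 \<Longrightarrow> sym_coeff 0 k = period_num k"
  by (rule sym_coeff_eqI) (auto simp: Phi_plus_0)

lemma sym_coeff_shift:
  assumes k: "k \<le> 10"
  shows "sym_coeff (r + of_int n) k = (\<Sum>j\<le>k. int ((10 - j) choose (k - j)) * n ^ (k - j) * sym_coeff r j)"
proof (rule sym_coeff_eqI[OF k])
  have "Phi_plus (r + of_int n) k = (\<Sum>j\<le>k. of_nat ((10 - j) choose (k - j)) * of_int n ^ (k - j) * (base_period * of_int (sym_coeff r j) / 691))"
    unfolding Phi_plus_shift[OF k] using k by (intro sum.cong) (auto simp: Phi_plus_eq)
  also have "\<dots> = base_period * of_int (\<Sum>j\<le>k. int ((10 - j) choose (k - j)) * n ^ (k - j) * sym_coeff r j) / 691"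
    by (simp add: sum_distrib_left sum_divide_distrib mult_ac)
  finally show "Phi_plus (r + of_int n) k = base_period * of_int (\<Sum>j\<le>k. int ((10 - j) choose (k - j)) * n ^ (k - j) * sym_coeff r j) / 691" .
qed

lemma sym_coeff_S:
  assumes k: "k \<le> 10" and r: "r \<noteq> 0"
  shows "sym_coeff (- 1 / r) k = (- 1) ^ k * (sym_coeff r (10 - k) - period_num (10 - k))"
  by (rule sym_coeff_eqI[OF k], unfold Phi_plus_S(2)[OF k r])
    (simp add: Phi_plus_eq[of "10 - k" r] Phi_plus_0[of "10 - k"] algebra_simps diff_divide_distrib)

section \<open>Integral polynomials at cusps and unimodular edges\<close>

definition sym_poly :: "rat \<Rightarrow> int \<Rightarrow> int \<Rightarrow> int" where
  "sym_poly r x y = (\<Sum>k\<le>10. sym_coeff r k * x ^ k * y ^ (10 - k))"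

definition period_poly :: "int \<Rightarrow> int \<Rightarrow> int" where
  "period_poly x y = 691 * x^2 * y^2 * (x^2 - y^2)^3 - 36 * (x ^ 10 - y ^ 10)"

lemma period_poly_sum: "(\<Sum>k\<le>10. period_num k * x ^ k * y ^ (10 - k)) = period_poly x y"
proof -
  have sum10: "(\<Sum>j\<le>10. f j) = f 0 + f 1 + f 2 + f 3 + f 4 + f 5 + f 6 + f 7 + f 8 + f 9 + f 10" for f :: "nat \<Rightarrow> int"
    by (simp add: eval_nat_numeral)
  have "period_poly x y = - 36 * x ^ 10 + 691 * (x^8 * y^2) - 2073 * (x^6 * y^4) + 2073 * (x^4 * y^6) - 691 * (x^2 * y^8) + 36 * y ^ 10"
    unfolding period_poly_def by (simp add: power_numeral_reduce algebra_simps)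
  then show ?thesis unfolding sum10 by (simp add: period_num_def)
qed

lemma sym_poly_0: "sym_poly 0 x y = period_poly x y"
  unfolding sym_poly_def period_poly_sum[symmetric] by (intro sum.cong) (auto simp: sym_coeff_0)

lemma sym_poly_shift: "sym_poly (r + of_int n) x y = sym_poly r x (n * x + y)"
proof -
  have "sym_poly (r + of_int n) x y =
     (\<Sum>k\<le>10. \<Sum>j\<le>k. sym_coeff r j * x ^ j * (of_nat ((10 - j) choose (k - j)) * (n * x) ^ (k - j) * y ^ (10 - k)))"
    unfolding sym_poly_def
  proof (intro sum.cong refl)
    fix k :: nat assume k: "k \<in> {..10}"
    have "sym_coeff (r + of_int n) k * x ^ k * y ^ (10 - k) =
      (\<Sum>j\<le>k. int ((10 - j) choose (k - j)) * n ^ (k - j) * sym_coeff r j * x ^ k * y ^ (10 - k))"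
      using k by (simp add: sym_coeff_shift sum_distrib_right)
    also have "\<dots> = (\<Sum>j\<le>k. sym_coeff r j * x ^ j * (of_nat ((10 - j) choose (k - j)) * (n * x) ^ (k - j) * y ^ (10 - k)))"
    proof (intro sum.cong refl)
      fix j assume "j \<in> {..k}"
      then have xk: "x ^ k = x ^ j * x ^ (k - j)" by (simp flip: power_add)
      show "int ((10 - j) choose (k - j)) * n ^ (k - j) * sym_coeff r j * x ^ k * y ^ (10 - k) =
        sym_coeff r j * x ^ j * (of_nat ((10 - j) choose (k - j)) * (n * x) ^ (k - j) * y ^ (10 - k))"
        unfolding xk by (simp add: power_mult_distrib)
    qed
    finally show "sym_coeff (r + of_int n) k * x ^ k * y ^ (10 - k) =
      (\<Sum>j\<le>k. sym_coeff r j * x ^ j * (of_nat ((10 - j) choose (k - j)) * (n * x) ^ (k - j) * y ^ (10 - k)))" .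
  qed
  also have "\<dots> = (\<Sum>j\<le>10. \<Sum>i\<le>10 - j. sym_coeff r j * x ^ j * (of_nat ((10 - j) choose i) * (n * x) ^ i * y ^ (10 - j - i)))"
  proof -
    have "(\<Sum>k\<le>10. \<Sum>j\<le>k. f k j) = (\<Sum>j\<le>(10::nat). \<Sum>i\<le>10 - j. f (i + j) j)" for f :: "nat \<Rightarrow> nat \<Rightarrow> int"
    proof -
      have "(\<Sum>k\<le>10. \<Sum>j\<le>k. f k j) = (\<Sum>(k, j)\<in>Sigma {..10} (\<lambda>k. {..k}). f k j)"
        by (subst sum.Sigma) auto
      also have "\<dots> = (\<Sum>(j, i)\<in>Sigma {..10} (\<lambda>j. {..10 - j}). f (i + j) j)"
        by (rule sum.reindex_bij_witness[of _ "\<lambda>(j, i). (i + j, j)" "\<lambda>(k, j). (j, k - j)"]) auto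
      also have "\<dots> = (\<Sum>j\<le>(10::nat). \<Sum>i\<le>10 - j. f (i + j) j)"
        by (subst sum.Sigma) auto
      finally show ?thesis .
    qed
    from this[of "\<lambda>k j. sym_coeff r j * x ^ j * (of_nat ((10 - j) choose (k - j)) * (n * x) ^ (k - j) * y ^ (10 - k))"]
    show ?thesis by (simp add: add.commute)
  qed
  also have "\<dots> = sym_poly r x (n * x + y)"
    unfolding sym_poly_def binomial_ring by (simp add: sum_distrib_left mult_ac)
  finally show ?thesis .
qed

lemma sym_poly_S:
  assumes r: "r \<noteq> 0"
  shows "sym_poly (- 1 / r) x y = sym_poly r y (- x) - period_poly y (- x)"
proof -
  have "sym_poly (- 1 / r) x y = (\<Sum>k\<le>10. (sym_coeff r (10 - k) - period_num (10 - k)) * y ^ (10 - k) * (- x) ^ k)"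
    unfolding sym_poly_def
    by (intro sum.cong refl, subst sym_coeff_S[OF _ r]) (simp_all add: power_minus[of x] mult_ac)
  also have "\<dots> = (\<Sum>k\<le>10. (sym_coeff r k - period_num k) * y ^ k * (- x) ^ (10 - k))"
    by (rule sum.reindex_bij_witness[of _ "\<lambda>k. 10 - k" "\<lambda>k. 10 - k"]) auto
  also have "\<dots> = sym_poly r y (- x) - period_poly y (- x)"
    unfolding sym_poly_def period_poly_sum[symmetric] by (simp add: left_diff_distrib sum_subtractf)
  finally show ?thesis .
qed

text \<open>The value of the (scaled) plus symbol on \<open>{\<infinity>} - {p / q}\<close> at \<open>(x, y)\<close>, the fraction with \<open>q = 0\<close>
  standing for the cusp \<open>\<infinity>\<close>.\<close>

definition cusp_poly :: "int \<Rightarrow> int \<Rightarrow> int \<Rightarrow> int \<Rightarrow> int" where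
  "cusp_poly p q x y = (if q = 0 then 0 else sym_poly (of_int p / of_int q) x y)"

lemma period_poly_neg: "period_poly (- x) (- y) = period_poly x y"
  by (simp add: period_poly_def)

lemma period_poly_rot: "period_poly y (- x) = - period_poly x y"
  by (simp add: period_poly_def power_numeral_reduce algebra_simps)

lemma cusp_poly_shift: "cusp_poly (p + n * q) q x y = cusp_poly p q x (n * x + y)"
proof (cases "q = 0")
  case False
  then have "of_int (p + n * q) / of_int q = of_int p / of_int q + (of_int n :: rat)" by (simp add: field_simps)
  then show ?thesis using False by (simp add: cusp_poly_def sym_poly_shift)
qed (simp add: cusp_poly_def)

text \<open>The value 0 at the cusp infinity is what extends the inversion relation to 0 and
  infinity: at p = 0 the two right-hand terms cancel, and at q = 0 the relation is the antisymmetry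
  \<open>period_poly_rot\<close>.\<close>

lemma cusp_poly_S:
  assumes "p \<noteq> 0 \<or> q \<noteq> 0"
  shows "cusp_poly (- q) p x y = cusp_poly p q y (- x) - period_poly y (- x)"
proof -
  consider "p = 0" "q \<noteq> 0" | "p \<noteq> 0" "q = 0" | "p \<noteq> 0" "q \<noteq> 0" using assms by blast
  then show ?thesis
  proof cases
    case 1 then show ?thesis by (simp add: cusp_poly_def sym_poly_0)
  next
    case 2 then show ?thesis by (simp add: cusp_poly_def sym_poly_0 period_poly_rot)
  next
    case 3
    then have e: "of_int (- q) / of_int p = - 1 / (of_int p / of_int q :: rat)" by simp
    have "sym_poly (of_int (- q) / of_int p) x y = sym_poly (of_int p / of_int q) y (- x) - period_poly y (- x)"
      unfolding e by (rule sym_poly_S) (use 3 in simp)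
    then show ?thesis using 3 by (simp add: cusp_poly_def)
  qed
qed

text \<open>Equivariance: the edge {a/c} - {b/d} is the image of {infinity} - {0} under the matrix
  with rows (a, b) and (c, d), and its value is the period polynomial transformed by that matrix.
  Euclid's algorithm on the column (a, c) reduces the matrix to c = 0.\<close>

lemma cusp_poly_edge:
  assumes "a * d - b * c = 1"
  shows "cusp_poly b d x y - cusp_poly a c x y = period_poly (x * a + y * c) (x * b + y * d)"
  using assms
proof (induction "nat \<bar>c\<bar>" arbitrary: a b c d x y rule: less_induct)
  case less
  show ?case
  proof (cases "c = 0")
    case True
    then have ad: "a * d = 1" using less.prems by simp
    then have "a = 1 \<and> d = 1 \<or> a = - 1 \<and> d = - 1" using zmult_eq_1_iff by blast
    then show ?thesis
    proof
      assume "a = 1 \<and> d = 1"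
      then show ?thesis using True cusp_poly_shift[of 0 b 1 x y]
        by (simp add: cusp_poly_def sym_poly_0 mult.commute)
    next
      assume ad: "a = - 1 \<and> d = - 1"
      then have "cusp_poly b d x y = period_poly x (- b * x + y)"
        using cusp_poly_shift[of 0 "- b" "- 1" x y] by (simp add: cusp_poly_def sym_poly_0)
      moreover have "period_poly (x * a + y * c) (x * b + y * d) = period_poly (- x) (- (- b * x + y))"
        using ad True by (simp add: mult.commute)
      ultimately show ?thesis using True by (simp only: period_poly_neg) (simp add: cusp_poly_def)
    qed
  next
    case False
    define n where "n = a div c"
    define a' where "a' = a mod c"
    define b' where "b' = b - n * d"
    have a: "a = a' + n * c" unfolding a'_def n_def by simp
    have b: "b = b' + n * d" unfolding b'_def by simp
    have det: "a' * d - b' * c = 1" using less.prems unfolding a b by (simp add: algebra_simps)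
    have small: "nat \<bar>- a'\<bar> < nat \<bar>c\<bar>" using False unfolding a'_def by (simp add: abs_mod_less)
    \<comment> \<open>Inversion turns the rows (a', b'), (c, d) into (c, d), (-a', -b'); the new
      lower left entry is a remainder modulo c.\<close>
    have IH: "cusp_poly d (- b') x y - cusp_poly c (- a') x y = period_poly (x * c + y * (- a')) (x * d + y * (- b'))" for x y
      by (rule less.hyps[OF small]) (use det in \<open>simp add: algebra_simps\<close>)
    have nz: "c \<noteq> 0 \<or> - a' \<noteq> 0" "d \<noteq> 0 \<or> - b' \<noteq> 0" using False det by auto
    have step: "cusp_poly b' d x y - cusp_poly a' c x y = period_poly (x * a' + y * c) (x * b' + y * d)" for x y
      using cusp_poly_S[OF nz(1), of x y] cusp_poly_S[OF nz(2), of x y] IH[of y "- x"]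
      by (simp add: algebra_simps)
    show ?thesis unfolding a b cusp_poly_shift step by (simp add: algebra_simps)
  qed
qed

section \<open>Values modulo 81\<close>

lemma square_mod_3:
  fixes c :: int
  assumes "\<not> 3 dvd c" obtains u where "c^2 = 1 + 3 * u"
proof -
  have "c mod 3 = 1 \<or> c mod 3 = 2" using assms by presburger
  moreover have "c^2 mod 3 = (c mod 3)^2 mod 3" by (simp add: power_mod)
  ultimately have "c^2 mod 3 = 1" by auto
  then have "c^2 = 1 + 3 * (c^2 div 3)" by presburger
  then show ?thesis using that by blast
qed

lemma cube_minus_self_mod_3: "(3::int) dvd w^3 - w"
proof -
  have "w^3 - w = (w - 1) * w * (w + 1)" by (simp add: power_numeral_reduce algebra_simps)
  moreover have "3 dvd w - 1 \<or> 3 dvd w \<or> 3 dvd w + 1" by presburger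
  ultimately show ?thesis by (auto intro: dvd_mult dvd_mult2)
qed

text \<open>With c^2 - d^2 = 3w the first term is 27 w^3 and the second is -540 w modulo 81. Since
  w^3 = w modulo 3, each equals 27 w modulo 81, and 54 w = 18 (c^2 - d^2). As a difference of a
  function of c and one of d, this telescopes along a path.\<close>

lemma period_poly_mod_units:
  assumes "\<not> 3 dvd c" "\<not> 3 dvd d"
  shows "[period_poly c d = 18 * (c^2 - d^2)] (mod 81)"
proof -
  obtain u where u: "c^2 = 1 + 3 * u" by (rule square_mod_3[OF assms(1)])
  obtain v where v: "d^2 = 1 + 3 * v" by (rule square_mod_3[OF assms(2)])
  define w where "w = u - v"
  obtain h where h: "w^3 - w = 3 * h" using cube_minus_self_mod_3[of w] by (auto elim: dvdE)
  have x10: "x ^ 10 = (x^2)^5" for x :: int by (simp flip: power_mult)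
  define m where "m = u + v + 3 * u * v"
  have xy: "(1 + 3 * u) * (1 + 3 * v) = 1 + 3 * m" unfolding m_def by (simp add: algebra_simps)
  define x y where "x = 1 + 3 * u" "y = 1 + 3 * v"
  have xy5: "x ^ 5 - y ^ 5 = (x - y) * (x^4 + x^3 * y + x^2 * y^2 + x * y^3 + y^4)" for x y :: int
    by (simp add: power_numeral_reduce algebra_simps)
  have "\<exists>l. x^4 + x^3 * y + x^2 * y^2 + x * y^3 + y^4 = 5 + 3 * l"
  proof -
    have "[x = 1] (mod 3)" "[y = 1] (mod 3)" unfolding x_y_def by (simp_all add: cong_def)
    then have "[x^4 + x^3 * y + x^2 * y^2 + x * y^3 + y^4 = 1^4 + 1^3 * 1 + 1^2 * 1^2 + 1 * 1^3 + 1^4] (mod 3)"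
      by (intro cong_add cong_mult cong_pow)
    then have "3 dvd (x^4 + x^3 * y + x^2 * y^2 + x * y^3 + y^4) - 5" by (simp add: cong_iff_dvd_diff)
    then obtain l where "(x^4 + x^3 * y + x^2 * y^2 + x * y^3 + y^4) - 5 = 3 * l" by (elim dvdE)
    then show ?thesis by (intro exI[of _ l]) linarith
  qed
  then obtain l where l: "x^4 + x^3 * y + x^2 * y^2 + x * y^3 + y^4 = 5 + 3 * l" by blast
  have d: "x - y = 3 * w" unfolding x_y_def w_def by simp
  have "period_poly c d = 691 * (x * y) * (x - y)^3 - 36 * (x ^ 5 - y ^ 5)"
    unfolding period_poly_def x10 u v x_y_def by simp
  also have "\<dots> = 691 * (1 + 3 * m) * (3 * w)^3 - 36 * (3 * w * (5 + 3 * l))"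
    unfolding xy5 l d by (simp add: xy x_y_def)
  also have "\<dots> = 18 * (3 * w) + 81 * (230 * w^3 + h + 691 * m * w^3 - 4 * w * l - 7 * w)"
    using h by (simp add: power_mult_distrib algebra_simps)
  also have "3 * w = c^2 - d^2" unfolding u v w_def by simp
  finally show ?thesis by (simp add: cong_iff_dvd_diff)
qed

definition cusp_val :: "int \<Rightarrow> int \<Rightarrow> int" where
  "cusp_val p q = cusp_poly p q 0 1"

lemma cusp_val_eq: "q \<noteq> 0 \<Longrightarrow> cusp_val p q = sym_coeff (of_int p / of_int q) 0"
  unfolding cusp_val_def cusp_poly_def sym_poly_def
  by (simp add: power_0_left if_distrib if_distribR sum.delta cong: if_cong)

lemma cusp_val_diff:
  assumes "a * d - b * c = 1"
  shows "cusp_val b d = cusp_val a c + period_poly c d"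
  using cusp_poly_edge[OF assms, of 0 1] by (simp add: cusp_val_def)

lemma cusp_val_neg: "cusp_val (- p) (- q) = cusp_val p q"
  by (simp add: cusp_val_def cusp_poly_def)

lemma neighbour_exists:
  fixes p q :: int
  assumes "coprime p q" "q > 1"
  obtains a c where "a * q - p * c = 1" "0 < c" "c < q"
proof -
  obtain x where x: "[p * x = 1] (mod q)" using cong_solve_coprime_int assms(1) by blast
  define c where "c = (- x) mod q"
  have c: "0 \<le> c" "c < q" using assms(2) by (auto simp: c_def)
  have "[p * c = p * (- x)] (mod q)" unfolding c_def by (intro cong_mult) (simp_all add: cong_def)
  also have "[p * (- x) = - 1] (mod q)" using x cong_minus_minus_iff[of "p * x" 1 q] by simp
  finally have "q dvd p * c + 1" by (simp add: cong_iff_dvd_diff)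
  then obtain a where a: "p * c + 1 = q * a" by (elim dvdE)
  have "c \<noteq> 0" using a assms(2) by (metis add_0 mult_zero_right pos_zmult_eq_1_iff zero_less_one order_less_trans less_irrefl)
  then show ?thesis using that[of a c] a c by (simp add: mult.commute algebra_simps)
qed

text \<open>If \<open>c\<close> is the denominator of a Farey neighbour of \<open>p/q\<close>, then so is \<open>c - q\<close>, and one of the two is
  prime to 3; hence the induction stays among denominators prime to 3.\<close>

lemma cusp_val_unit_denominator:
  assumes "q > 0" "coprime p q" "\<not> 3 dvd q"
  shows "[cusp_val p q = 54 - 18 * q^2] (mod 81)"
  using assms
proof (induction "nat q" arbitrary: p q rule: less_induct)
  case less
  show ?case
  proof (cases "q = 1")
    case True
    \<comment> \<open>Here 36 = 54 - 18 * 1^2, which fixes the constant 54.\<close>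
    have "cusp_val p 1 = 36"
      using sym_coeff_shift[of 0 0 p] by (simp add: cusp_val_eq sym_coeff_0 period_num_def)
    then show ?thesis using True by simp
  next
    case False
    then have "q > 1" using less.prems by simp
    then obtain a c where ac: "a * q - p * c = 1" "0 < c" "c < q"
      using neighbour_exists less.prems by blast
    have "\<exists>a c. a * q - p * c = 1 \<and> 0 < \<bar>c\<bar> \<and> \<bar>c\<bar> < q \<and> \<not> 3 dvd c"
    proof (cases "3 dvd c")
      case False then show ?thesis using ac by (intro exI[of _ a] exI[of _ c]) auto
    next
      case True
      have "\<not> 3 dvd c - q" using True less.prems by (metis diff_diff_eq2 add_diff_cancel_left' dvd_diff)
      moreover have "(a - p) * q - p * (c - q) = 1" using ac by (simp add: algebra_simps)
      ultimately show ?thesis using ac by (intro exI[of _ "a - p"] exI[of _ "c - q"]) auto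
    qed
    then obtain a c where ac: "a * q - p * c = 1" "0 < \<bar>c\<bar>" "\<bar>c\<bar> < q" "\<not> 3 dvd c" by blast
    \<comment> \<open>The replacement c - q is negative; its sign is moved to the numerator so that
      the induction hypothesis, stated for positive denominators, applies.\<close>
    define s where "s = sgn c"
    have s: "\<bar>c\<bar> = s * c" "s = 1 \<or> s = - 1" using ac(2) by (auto simp: s_def sgn_if)
    have cop: "coprime (s * a) \<bar>c\<bar>"
    proof (rule coprimeI)
      fix d assume "d dvd s * a" "d dvd \<bar>c\<bar>"
      then have "d dvd a" "d dvd c" using s(2) by auto
      then have "d dvd a * q - p * c" by simp
      then show "is_unit d" using ac(1) by simp
    qed
    have "[cusp_val (s * a) \<bar>c\<bar> = 54 - 18 * \<bar>c\<bar>^2] (mod 81)"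
      by (rule less.hyps) (use ac cop in auto)
    moreover have "cusp_val (s * a) \<bar>c\<bar> = cusp_val a c"
      unfolding s(1) using s(2) cusp_val_neg by auto
    ultimately have "[cusp_val a c = 54 - 18 * c^2] (mod 81)" by simp
    from cong_add[OF this period_poly_mod_units[OF ac(4) less.prems(3)]]
    show ?thesis unfolding cusp_val_diff[OF ac(1)] by (simp add: right_diff_distrib)
  qed
qed

text \<open>One edge leads to a neighbour whose denominator c is prime to 3. On that edge q^2
  vanishes modulo 81, leaving -36 c^10, and p c = -1 modulo 9 expresses the resulting function of c
  through p.\<close>

lemma cusp_val_9_dvd_denominator:
  assumes "9 dvd q" "q > 0" "coprime p q"
  shows "[cusp_val p q = 9 * (p^2 - 1)] (mod 81)"
proof -
  have q1: "q > 1" using zdvd_imp_le[OF assms(1,2)] by simp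
  have "\<not> 3 dvd p"
  proof
    assume "3 dvd p"
    moreover have "3 dvd q" using assms(1) by (rule dvd_trans[rotated]) simp
    ultimately have "is_unit (3::int)" using assms(3) coprime_common_divisor by blast
    then show False by simp
  qed
  then obtain u where u: "p^2 = 1 + 3 * u" by (rule square_mod_3)
  obtain a c where ac: "a * q - p * c = 1" "0 < c" "c < q" by (rule neighbour_exists[OF assms(3) q1])
  have "\<not> 3 dvd c"
  proof
    assume "3 dvd c"
    moreover have "3 dvd q" using assms(1) by (rule dvd_trans[rotated]) simp
    ultimately have "3 dvd a * q - p * c" by simp
    then show False using ac(1) by simp
  qed
  then obtain v where v: "c^2 = 1 + 3 * v" by (rule square_mod_3)
  obtain k where k: "q = 9 * k" using assms(1) by (elim dvdE)
  have "p * c = a * q - 1" using ac(1) by simp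
  then have "(p * c)^2 = (a * q - 1)^2" by simp
  then have pc: "(1 + 3 * u) * (1 + 3 * v) = (9 * k * a - 1)^2"
    unfolding power_mult_distrib u v k by (simp add: mult_ac)
  then have "3 * (u + v + 3 * u * v) = 9 * (9 * k^2 * a^2 - 2 * k * a)"
    by (simp add: power2_eq_square algebra_simps)
  \<comment> \<open>This is p^2 c^2 = 1 modulo 9 written for the logarithms u and v of p^2 and c^2;
    it replaces -27 v by 27 u modulo 81.\<close>
  then have uv: "u + v = 3 * (9 * k^2 * a^2 - 2 * k * a - u * v)" by simp
  have cop: "coprime a c"
  proof (rule coprimeI)
    fix d assume "d dvd a" "d dvd c"
    then have "d dvd a * q - p * c" by simp
    then show "is_unit d" using ac(1) by simp
  qed
  have "[cusp_val a c = 54 - 18 * c^2] (mod 81)"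
    by (rule cusp_val_unit_denominator[OF ac(2) cop \<open>\<not> 3 dvd c\<close>])
  moreover have "[period_poly c q = - 36 * c ^ 10] (mod 81)"
  proof -
    have "period_poly c q - (- 36 * c ^ 10) = q^2 * (691 * c^2 * (c^2 - q^2)^3 + 36 * q ^ 8)"
      unfolding period_poly_def by (simp add: power_numeral_reduce algebra_simps)
    also have "\<dots> = 81 * (k^2 * (691 * c^2 * (c^2 - q^2)^3 + 36 * q ^ 8))"
      by (subst k) (simp add: power2_eq_square)
    finally show ?thesis by (simp add: cong_iff_dvd_diff)
  qed
  ultimately have "[cusp_val p q = (54 - 18 * c^2) + (- 36 * c ^ 10)] (mod 81)"
    unfolding cusp_val_diff[OF ac(1)] by (rule cong_add)
  moreover have "[(54 - 18 * c^2) + (- 36 * c ^ 10) = 9 * (p^2 - 1)] (mod 81)"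
  proof -
    have "c ^ 10 = (1 + 3 * v)^5" unfolding v[symmetric] by (simp flip: power_mult)
    also have "\<dots> = 1 + 15 * v + 9 * (10 * v^2 + 30 * v^3 + 45 * v^4 + 27 * v^5)"
      by (simp add: power_numeral_reduce algebra_simps)
    finally have c10: "c ^ 10 = 1 + 15 * v + 9 * (10 * v^2 + 30 * v^3 + 45 * v^4 + 27 * v^5)" .
    have "(54 - 18 * c^2) + (- 36 * c ^ 10) - 9 * (p^2 - 1)
       = - 27 * (u + v) - 81 * (7 * v + 4 * (10 * v^2 + 30 * v^3 + 45 * v^4 + 27 * v^5))"
      unfolding c10 v u by (simp add: algebra_simps)
    also have "\<dots> = 81 * (- (9 * k^2 * a^2 - 2 * k * a - u * v) - (7 * v + 4 * (10 * v^2 + 30 * v^3 + 45 * v^4 + 27 * v^5)))"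
      unfolding uv by (simp add: algebra_simps)
    finally show ?thesis by (simp add: cong_iff_dvd_diff)
  qed
  ultimately show ?thesis by (rule cong_trans)
qed

section \<open>The Mazur-Tate elements\<close>

lemma quotient_of_cross:
  assumes "q = of_int a / of_int b" "b \<noteq> 0" "quotient_of q = (c, d)"
  shows "a * d = c * b" "d > 0" "coprime c d"
proof -
  show d: "d > 0" using quotient_of_denom_pos[OF assms(3)] .
  show "coprime c d" using quotient_of_coprime[OF assms(3)] .
  have "of_int a / of_int b = (of_int c / of_int d :: rat)" using quotient_of_div[OF assms(3)] assms(1) by simp
  then have "(of_int (a * d) :: rat) = of_int (c * b)" using assms(2) d by (simp add: frac_eq_eq)
  then show "a * d = c * b" by (simp only: of_int_eq_iff)
qed

lemma denominator_dvd:
  assumes "b \<noteq> 0" shows "snd (quotient_of (of_int a / of_int b)) dvd b"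
proof -
  obtain c d where cd: "quotient_of (of_int a / of_int b) = (c, d)" by force
  note * = quotient_of_cross[OF refl assms cd]
  have "d dvd c * b" using *(1) by (metis dvd_triv_right)
  then have "d dvd b" using *(3) by (simp add: coprime_commute coprime_dvd_mult_right_iff)
  then show ?thesis by (simp add: cd)
qed

lemma ord3_frac:
  assumes "a \<noteq> 0" "b \<noteq> 0"
  shows "ord3 (of_int a / of_int b) = int (multiplicity 3 a) - int (multiplicity 3 b)"
proof -
  obtain c d where cd: "quotient_of (of_int a / of_int b) = (c, d)" by force
  note * = quotient_of_cross[OF refl assms(2) cd]
  have c: "c \<noteq> 0" using *(1,2) assms by auto
  have p: "prime_elem (3::int)" by simp
  have "multiplicity 3 (a * d) = multiplicity 3 (c * b)" using *(1) by simp
  then have "multiplicity 3 a + multiplicity 3 d = multiplicity 3 c + multiplicity 3 b"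
    using prime_elem_multiplicity_mult_distrib[OF p] assms c *(2) by simp
  then show ?thesis unfolding ord3_def cd by simp
qed

lemma ord3_mult_int:
  assumes "\<rho> \<noteq> 0" "t \<noteq> 0"
  shows "ord3 (\<rho> * of_int t) = ord3 \<rho> + int (multiplicity 3 t)"
proof -
  obtain c d where cd: "quotient_of \<rho> = (c, d)" by force
  have d: "d > 0" "\<rho> = of_int c / of_int d" using quotient_of_denom_pos[OF cd] quotient_of_div[OF cd] by auto
  have c: "c \<noteq> 0" using assms(1) d by auto
  have "\<rho> * of_int t = of_int (c * t) / of_int d" using d by simp
  then have "ord3 (\<rho> * of_int t) = int (multiplicity 3 (c * t)) - int (multiplicity 3 d)"
    using ord3_frac[of "c * t" d] c d assms(2) by simp
  moreover have "multiplicity 3 (c * t) = multiplicity 3 c + multiplicity 3 t"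
    by (rule prime_elem_multiplicity_mult_distrib) (use c assms(2) in auto)
  moreover have "ord3 \<rho> = int (multiplicity 3 c) - int (multiplicity 3 d)" by (simp add: ord3_def cd)
  ultimately show ?thesis by simp
qed

lemma inZ3loc_of_int_691: "inZ3loc (of_int m / 691)"
  unfolding inZ3loc_def
proof (intro exI conjI)
  show "of_int m / 691 = (of_rat (of_int m / of_int 691) :: complex)" by (simp add: of_rat_divide)
  show "\<not> 3 dvd snd (quotient_of (of_int m / of_int 691))"
  proof
    assume "3 dvd snd (quotient_of (of_int m / of_int 691))"
    then have "(3::int) dvd 691" by (rule dvd_trans) (rule denominator_dvd, simp)
    then show False by simp
  qed
qed

lemma not_inZ3loc_third: "\<not> inZ3loc (1 / 3)"
proof
  assume "inZ3loc (1 / 3)"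
  then obtain q where q: "(1 / 3 :: complex) = of_rat q" "\<not> 3 dvd snd (quotient_of q)" unfolding inZ3loc_def by blast
  have "(of_rat q :: complex) = of_rat (of_int 1 / of_int 3)" using q(1) by (simp add: of_rat_divide)
  then have q3: "q = of_int 1 / of_int 3" by (simp only: of_rat_eq_iff)
  obtain c d where cd: "quotient_of q = (c, d)" by force
  have "1 * d = c * 3" by (rule quotient_of_cross(1)[OF q3 _ cd]) simp
  then show False using q(2) cd by simp
qed

section \<open>The cohomological period\<close>

lemma cusp_neg_involution [simp]: "cusp_neg (cusp_neg x) = x"
  by (cases x) (simp_all add: cusp_neg_def)

text \<open>Reindexing by the involution moves the averaging from the divisor to the values at the
  cusps.\<close>

lemma phiDelta_plus_eq:
  "phiDelta_plus D k = - (\<Sum>x\<in>{x. D x \<noteq> 0}. of_int (D x) * (case x of None \<Rightarrow> 0 | Some r \<Rightarrow> Phi_plus r k))"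
proof -
  have "(\<Sum>x\<in>{x. D (cusp_neg x) \<noteq> 0}. of_int (D (cusp_neg x)) * PhiC x k) =
      (\<Sum>x\<in>{x. D x \<noteq> 0}. of_int (D x) * PhiC (cusp_neg x) k)"
    by (rule sum.reindex_bij_witness[of _ cusp_neg cusp_neg]) auto
  then have "phiDelta_plus D k = - (((\<Sum>x\<in>{x. D x \<noteq> 0}. of_int (D x) * PhiC x k) +
      (- 1) ^ k * (\<Sum>x\<in>{x. D x \<noteq> 0}. of_int (D x) * PhiC (cusp_neg x) k)) / 2)"
    unfolding phiDelta_plus_def phiDelta_def by (simp add: minus_divide_left)
  also have "((\<Sum>x\<in>{x. D x \<noteq> 0}. of_int (D x) * PhiC x k) +
      (- 1) ^ k * (\<Sum>x\<in>{x. D x \<noteq> 0}. of_int (D x) * PhiC (cusp_neg x) k)) / 2 =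
      (\<Sum>x\<in>{x. D x \<noteq> 0}. of_int (D x) * ((PhiC x k + (- 1) ^ k * PhiC (cusp_neg x) k) / 2))"
    unfolding sum_distrib_left sum.distrib[symmetric] sum_divide_distrib
    by (intro sum.cong refl) (simp add: algebra_simps add_divide_distrib)
  also have "(\<lambda>x. (PhiC x k + (- 1) ^ k * PhiC (cusp_neg x) k) / 2) = (\<lambda>x. case x of None \<Rightarrow> 0 | Some r \<Rightarrow> Phi_plus r k)"
    by (auto simp: fun_eq_iff PhiC_def cusp_neg_def Phi_plus_def split: option.splits)
  finally show ?thesis by (simp add: fun_eq_iff)
qed

lemma phiDelta_plus_div_inf_minus: "phiDelta_plus (div_inf_minus r) k = Phi_plus r k"
proof -
  have "{x. div_inf_minus r x \<noteq> 0} = {None, Some r}" by (auto simp: div_inf_minus_def)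
  then show ?thesis by (simp add: phiDelta_plus_eq div_inf_minus_def)
qed

lemma phiDelta_plus_integral: "\<exists>m::int. phiDelta_plus D k = base_period * of_int m / 691"
proof (cases "k \<le> 10")
  case True
  have "phiDelta_plus D k = - (\<Sum>x\<in>{x. D x \<noteq> 0}. of_int (D x) * (base_period * of_int (case x of None \<Rightarrow> 0 | Some r \<Rightarrow> sym_coeff r k) / 691))"
    unfolding phiDelta_plus_eq using True by (auto simp: Phi_plus_eq split: option.splits intro!: sum.cong)
  also have "\<dots> = base_period * of_int (- (\<Sum>x\<in>{x. D x \<noteq> 0}. D x * (case x of None \<Rightarrow> 0 | Some r \<Rightarrow> sym_coeff r k))) / 691"
    by (simp add: sum_distrib_left sum_divide_distrib mult_ac)
  finally show ?thesis by blast
next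
  case False
  then have "Phi_plus r k = 0" for r by (simp add: Phi_plus_def Phi_def)
  then show ?thesis unfolding phiDelta_plus_eq by (intro exI[of _ 0]) (auto intro!: sum.neutral split: option.splits)
qed

lemma deg0_div_inf_minus: "deg0_div (div_inf_minus r)"
proof -
  have "{x. div_inf_minus r x \<noteq> 0} = {None, Some r}" by (auto simp: div_inf_minus_def)
  then show ?thesis by (simp add: deg0_div_def div_inf_minus_def)
qed

lemma coh_period3_base_period: "coh_period3 base_period"
  unfolding coh_period3_def
proof (intro conjI allI impI)
  show "base_period \<noteq> 0" by (rule base_period_nonzero)
  show "inZ3loc (phiDelta_plus D k / base_period)" for D k
  proof -
    obtain m where "phiDelta_plus D k = base_period * of_int m / 691" using phiDelta_plus_integral by blast
    then have "phiDelta_plus D k / base_period = of_int m / 691" using base_period_nonzero by simp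
    then show ?thesis by (simp only: inZ3loc_of_int_691)
  qed
  \<comment> \<open>The path from 0 to infinity at k = 8 takes the value 1 after normalisation, so
    not all values are divisible by 3.\<close>
  have "phiDelta_plus (div_inf_minus 0) 8 / (3 * base_period) = 1 / 3"
    using base_period_nonzero by (simp add: phiDelta_plus_div_inf_minus base_period_def)
  then show "\<exists>D k. deg0_div D \<and> \<not> inZ3loc (phiDelta_plus D k / (3 * base_period))"
    using deg0_div_inf_minus not_inZ3loc_third by metis
qed

text \<open>A nonzero rational ratio suffices to pass to an arbitrary period: it adds one constant
  to all valuations, so the index of the first minimum is the same.\<close>

lemma coh_period3_ratio:
  assumes "coh_period3 \<Omega>"
  obtains \<rho> :: rat where "\<rho> \<noteq> 0" "base_period / \<Omega> = of_rat \<rho>"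
proof -
  have \<Omega>: "\<Omega> \<noteq> 0" using assms by (simp add: coh_period3_def)
  have "inZ3loc (phiDelta_plus (div_inf_minus 0) 8 / \<Omega>)"
    using assms deg0_div_inf_minus unfolding coh_period3_def by blast
  then obtain \<rho> where \<rho>: "base_period / \<Omega> = of_rat \<rho>"
    unfolding inZ3loc_def phiDelta_plus_div_inf_minus base_period_def by blast
  moreover have "\<rho> \<noteq> 0" using \<rho> \<Omega> base_period_nonzero by auto
  ultimately show ?thesis using that by blast
qed

lemma ratval_of_rat: "ratval (of_rat q) = q"
  unfolding ratval_def by (rule the_equality) auto

lemma ratval_mt_val:
  assumes "base_period / \<Omega> = of_rat \<rho>"
  shows "ratval (mt_val \<Omega> r) = \<rho> / 691 * of_int (sym_coeff r 0)"
proof -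
  have "mt_val \<Omega> r = Phi_plus r 0 / \<Omega>"
    unfolding mt_val_def V_eval_def phiDelta_plus_div_inf_minus
    by (simp add: power_0_left if_distrib if_distribR sum.delta cong: if_cong)
  also have "\<dots> = of_int (sym_coeff r 0) / 691 * (base_period / \<Omega>)" by (simp add: Phi_plus_eq)
  also have "\<dots> = of_rat (\<rho> / 691 * of_int (sym_coeff r 0))" unfolding assms by (simp add: of_rat_mult of_rat_divide)
  finally show ?thesis by (simp only: ratval_of_rat)
qed

text \<open>Applied with 1 + 3s = g^2, this is the homomorphism a -> (a^2 - 1)/3 modulo 3 evaluated
  on the powers of g.\<close>

lemma power_1_plus_3:
  fixes s :: int shows "[(1 + 3 * s) ^ j = 1 + 3 * s * int j] (mod 9)"
proof (induction j)
  case (Suc j)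
  have "[(1 + 3 * s) * (1 + 3 * s) ^ j = (1 + 3 * s) * (1 + 3 * s * int j)] (mod 9)"
    using Suc by (intro cong_mult) auto
  moreover have "(1 + 3 * s) * (1 + 3 * s * int j) = (1 + 3 * s * int (Suc j)) + 9 * (s^2 * int j)"
    by (simp add: power2_eq_square algebra_simps)
  ultimately show ?case by (simp add: cong_def)
qed simp

text \<open>The fibre over gamma^j consists of the residues of g^j and -g^j. The value at
  denominator 3^(n+1), divisible by 9 as n >= 1, depends modulo 81 only on the square of the
  numerator modulo 9; so both residues contribute 27 s j, together 54 s j.\<close>

lemma theta_coeff_mod_81:
  assumes \<rho>: "base_period / \<Omega> = of_rat \<rho>" and n: "n \<ge> 1" and g: "\<not> 3 dvd g" "g^2 = 1 + 3 * s"
  obtains t where "theta_coeff \<Omega> n g j = \<rho> / 691 * of_int t" "[t = 54 * s * int j] (mod 81)"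
proof -
  define M where "M = (3::int) ^ (n + 1)"
  have M: "M > 1" "odd M" "9 dvd M" "3 dvd M"
  proof -
    show "M > 1" unfolding M_def by (rule one_less_power) auto
    show "odd M" unfolding M_def by simp
    have "M = 9 * 3 ^ (n - 1)" unfolding M_def using n by (cases n) auto
    then show "9 dvd M" by simp
    show "3 dvd M" unfolding M_def by simp
  qed
  define a0 where "a0 = g ^ j mod M"
  let ?S = "{a::int. 1 \<le> a \<and> a \<le> 3^(n+1) \<and> \<not> 3 dvd a \<and> ([a = g ^ j] (mod 3^(n+1)) \<or> [a = - (g ^ j)] (mod 3^(n+1)))}"
  have p3: "prime (3::int)" by simp
  have gj: "\<not> 3 dvd g ^ j" using g(1) prime_dvd_power[OF p3] by blast
  have a0g: "[a0 = g ^ j] (mod M)" unfolding a0_def by (simp add: cong_def)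
  have a03: "\<not> 3 dvd a0" unfolding a0_def using gj M(4) by (simp add: dvd_mod_iff)
  have a0: "0 < a0" "a0 < M"
  proof -
    have "a0 \<noteq> 0" using a03 by auto
    moreover have "0 \<le> a0" "a0 < M" unfolding a0_def using M(1) by simp_all
    ultimately show "0 < a0" "a0 < M" by simp_all
  qed
  have S: "?S = {a0, M - a0}"
  proof (rule equalityI; rule subsetI)
    fix a assume "a \<in> ?S"
    then have a: "1 \<le> a" "a \<le> M" "\<not> 3 dvd a" "[a = g ^ j] (mod M) \<or> [a = - (g ^ j)] (mod M)" unfolding M_def by auto
    have "a < M" using a(2,3) M(4) by (cases "a = M") auto
    from a(4) show "a \<in> {a0, M - a0}"
    proof
      assume "[a = g ^ j] (mod M)"
      then have "[a = a0] (mod M)" using a0g cong_sym cong_trans by blast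
      then have "a = a0" using cong_less_imp_eq_int[of a M a0] a \<open>a < M\<close> a0 by simp
      then show ?thesis by simp
    next
      assume "[a = - (g ^ j)] (mod M)"
      moreover have "[- (g ^ j) = - a0] (mod M)" using a0g by (simp add: cong_minus_minus_iff cong_sym)
      ultimately have "[a = - a0] (mod M)" using cong_trans by blast
      moreover have "[- a0 = M - a0] (mod M)" by (simp add: cong_iff_dvd_diff)
      ultimately have "[a = M - a0] (mod M)" using cong_trans by blast
      then have "a = M - a0" using cong_less_imp_eq_int[of a M "M - a0"] a \<open>a < M\<close> a0 by simp
      then show ?thesis by simp
    qed
  next
    fix a assume "a \<in> {a0, M - a0}"
    moreover have "\<not> 3 dvd M - a0" using a03 M(4) by (metis diff_diff_eq2 add_diff_cancel_left' dvd_diff)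
    moreover have "[M - a0 = - (g ^ j)] (mod M)"
    proof -
      have "[M - a0 = 0 - g ^ j] (mod M)" by (intro cong_diff a0g) (simp add: cong_def)
      then show ?thesis by simp
    qed
    ultimately show "a \<in> ?S" using a0 a0g a03 unfolding M_def by auto
  qed
  define t where "t = cusp_val a0 M + cusp_val (M - a0) M"
  have "theta_coeff \<Omega> n g j = (\<Sum>a\<in>{a0, M - a0}. ratval (mt_val \<Omega> (of_int a / 3^(n+1))))"
    unfolding theta_coeff_def S ..
  also have "\<dots> = (\<Sum>a\<in>{a0, M - a0}. \<rho> / 691 * of_int (cusp_val a M))"
    using M(1) by (intro sum.cong refl) (simp add: ratval_mt_val[OF \<rho>] cusp_val_eq, simp add: M_def)
  also have "\<dots> = \<rho> / 691 * of_int t"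
  proof -
    \<comment> \<open>The modulus is odd, so the fibre really has two elements and the sum two
      terms.\<close>
    have "a0 \<noteq> M - a0" using M(2) by (metis add_diff_cancel_right' diff_add_cancel even_add)
    then show ?thesis by (simp add: t_def distrib_left)
  qed
  finally have 1: "theta_coeff \<Omega> n g j = \<rho> / 691 * of_int t" .
  have val: "[cusp_val a M = 27 * s * int j] (mod 81)" if a3: "\<not> 3 dvd a" and a2: "[a^2 = (g ^ j)^2] (mod 9)" for a
  proof -
    have "coprime a M"
      unfolding M_def using a3 p3 by (metis coprime_commute coprime_power_left_iff prime_imp_coprime)
    then have "[cusp_val a M = 9 * (a^2 - 1)] (mod 81)"
      using M by (intro cusp_val_9_dvd_denominator) auto
    also have "[9 * (a^2 - 1) = 27 * s * int j] (mod 81)"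
    proof -
      have "(g ^ j)^2 = (1 + 3 * s) ^ j" unfolding g(2)[symmetric] by (simp add: power_mult[symmetric] mult.commute)
      then have "[a^2 = 1 + 3 * s * int j] (mod 9)" using a2 power_1_plus_3 cong_trans by metis
      then obtain k where "a^2 - (1 + 3 * s * int j) = 9 * k" unfolding cong_iff_dvd_diff by (elim dvdE)
      then have "9 * (a^2 - 1) - 27 * s * int j = 81 * k" by simp
      then show ?thesis by (simp add: cong_iff_dvd_diff)
    qed
    finally show ?thesis .
  qed
  have c9: "[x = y] (mod 9)" if "[x = y] (mod M)" for x y using that M(3) cong_dvd_modulus by blast
  have "[cusp_val a0 M = 27 * s * int j] (mod 81)"
    by (rule val[OF a03 cong_pow[OF c9[OF a0g]]])
  moreover have "[cusp_val (M - a0) M = 27 * s * int j] (mod 81)"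
  proof (rule val)
    show "\<not> 3 dvd M - a0" using a03 M(4) by (metis diff_diff_eq2 add_diff_cancel_left' dvd_diff)
    have "[M - a0 = 0 - g ^ j] (mod M)" by (intro cong_diff a0g) (simp add: cong_def)
    from cong_pow[OF c9[OF this], of 2] show "[(M - a0)^2 = (g ^ j)^2] (mod 9)" by simp
  qed
  ultimately have "[t = 27 * s * int j + 27 * s * int j] (mod 81)" unfolding t_def by (rule cong_add)
  then have 2: "[t = 54 * s * int j] (mod 81)" by (simp add: algebra_simps)
  show ?thesis by (rule that[OF 1 2])
qed

text \<open>The coefficient of T^i in the sum of j gamma^j with gamma = 1 + T. It follows from j (j
  choose i) = (i+1)(j choose i+1) + i (j choose i) and summation over the upper index.\<close>

lemma sum_index_binomial: "(\<Sum>j<N. j * (j choose i)) = Suc i * (N choose Suc (Suc i)) + i * (N choose Suc i)"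
proof (induction N)
  case (Suc N)
  have "Suc i * (Suc N choose Suc i) = Suc N * (N choose i)" by (rule Suc_times_binomial)
  then have "N * (N choose i) = Suc i * (N choose Suc i) + i * (N choose i)" by (simp add: algebra_simps)
  then show ?case using Suc by (simp add: algebra_simps)
qed simp

text \<open>By absorption 3^n divides k (3^n choose k); were the binomial prime to 3, all of 3^n
  would divide k < 3^n.\<close>

lemma three_dvd_binomial:
  assumes "0 < k" "k < 3 ^ n" shows "3 dvd ((3 ^ n) choose k :: nat)"
proof (rule ccontr)
  assume "\<not> 3 dvd ((3 ^ n) choose k :: nat)"
  then have "coprime (3 ^ n) ((3 ^ n) choose k :: nat)"
    using prime_imp_coprime[of "3::nat"] by simp
  moreover have "k * ((3 ^ n) choose k) = 3 ^ n * ((3 ^ n - 1) choose (k - 1))"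
    using binomial_absorption[of "k - 1" "3 ^ n"] assms by simp
  then have "3 ^ n dvd k * ((3 ^ n) choose k)" by simp
  ultimately have "3 ^ n dvd k" by (simp add: coprime_dvd_mult_left_iff)
  then show False using assms by (auto dest: dvd_imp_le)
qed

text \<open>The first conjunct ensures that the universal claim over periods is not vacuous.\<close>

theorem theorem4p9:
  fixes n :: nat
  assumes "n \<ge> 1"
  shows "(\<exists>\<Omega>. coh_period3 \<Omega>) \<and>
         (\<forall>\<Omega> g. coh_period3 \<Omega> \<longrightarrow> gen_Gn n g \<longrightarrow>
            lambda_inv (3 ^ n) (theta_T_coeff \<Omega> n g) = enat (3 ^ n - 2))"
proof (intro conjI allI impI)
  show "\<exists>\<Omega>. coh_period3 \<Omega>" using coh_period3_base_period by blast
  fix \<Omega> g assume \<Omega>: "coh_period3 \<Omega>" and g: "gen_Gn n g"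
  obtain \<rho> where \<rho>: "\<rho> \<noteq> 0" "base_period / \<Omega> = of_rat \<rho>" by (rule coh_period3_ratio[OF \<Omega>])
  define \<sigma> where "\<sigma> = \<rho> / 691"
  have \<sigma>: "\<sigma> \<noteq> 0" using \<rho> by (simp add: \<sigma>_def)
  define N :: nat where "N = 3 ^ n"
  have N: "N \<ge> 3" "3 dvd N" using assms self_le_power[of "3::nat" n] by (auto simp: N_def)
  have g3: "\<not> 3 dvd g" using g by (simp add: gen_Gn_def)
  obtain s where s: "g^2 = 1 + 3 * s" by (rule square_mod_3[OF g3])
  \<comment> \<open>This is the nontriviality of the homomorphism: if 3 divided s, all powers of g
    up to sign would have square 1 modulo 9, whereas the unit 2 has square 4.\<close>
  have s3: "\<not> 3 dvd s"
  proof
    assume "3 dvd s"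
    then have g9: "[g^2 = 1] (mod 9)" unfolding s by (auto simp: cong_iff_dvd_diff elim!: dvdE)
    obtain j where j: "[2 = g ^ j] (mod 3 ^ (n + 1)) \<or> [2 = - (g ^ j)] (mod 3 ^ (n + 1))"
    proof -
      have "\<not> (3::int) dvd 2" by simp
      then show ?thesis using g that unfolding gen_Gn_def by blast
    qed
    have "(3::int) ^ (n + 1) = 9 * 3 ^ (n - 1)" using assms by (cases n) auto
    then have "9 dvd (3::int) ^ (n + 1)" by simp
    with j have "[2 = g ^ j] (mod 9) \<or> [2 = - (g ^ j)] (mod 9)" using cong_dvd_modulus by blast
    then have "[2^2 = (g ^ j)^2] (mod 9)"
      using cong_pow[of 2 "g ^ j" 9 2] cong_pow[of 2 "- (g ^ j)" 9 2] by auto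
    also have "(g ^ j)^2 = (g^2) ^ j" by (simp add: power_mult[symmetric] mult.commute)
    also have "[(g^2) ^ j = 1 ^ j] (mod 9)" by (rule cong_pow[OF g9])
    finally show False by (simp add: cong_def)
  qed
  have "\<forall>j. \<exists>t. theta_coeff \<Omega> n g j = \<sigma> * of_int t \<and> [t = 54 * s * int j] (mod 81)"
    unfolding \<sigma>_def using theta_coeff_mod_81[OF \<rho>(2) assms g3 s] by metis
  then obtain t where t: "\<And>j. theta_coeff \<Omega> n g j = \<sigma> * of_int (t j)" "\<And>j. [t j = 54 * s * int j] (mod 81)" by metis
  define T where "T i = (\<Sum>j<N. t j * int (j choose i))" for i
  define J where "J i = (\<Sum>j<N. j * (j choose i))" for i
  have c: "theta_T_coeff \<Omega> n g i = \<sigma> * of_int (T i)" for i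
    unfolding theta_T_coeff_def T_def t N_def by (simp add: sum_distrib_left mult.assoc)
  have TJ: "[T i = 54 * s * int (J i)] (mod 81)" for i
  proof -
    have "[T i = (\<Sum>j<N. 54 * s * int j * int (j choose i))] (mod 81)"
      unfolding T_def by (intro cong_sum cong_mult t) simp
    then show ?thesis by (simp add: J_def sum_distrib_left mult.assoc)
  qed
  have J: "J i = Suc i * (N choose Suc (Suc i)) + i * (N choose Suc i)" for i
    unfolding J_def by (rule sum_index_binomial)
  have div27: "27 dvd T i" for i
  proof -
    have "[T i = 54 * s * int (J i)] (mod 27)" by (rule cong_dvd_modulus[OF TJ]) simp
    moreover have "[54 * s * int (J i) = 0] (mod 27)" by (simp add: cong_0_iff)
    ultimately show ?thesis using cong_trans cong_0_iff by blast
  qed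
  \<comment> \<open>Below N - 2 both binomials in \<open>J i\<close> have a lower index strictly
    between 0 and 3^n, so they supply the missing factor 3.\<close>
  have div81: "81 dvd T i" if "i < N - 2" for i
  proof -
    have "3 dvd J i" unfolding J using that N three_dvd_binomial[of "Suc (Suc i)" n] three_dvd_binomial[of "Suc i" n]
      by (intro dvd_add dvd_mult) (auto simp: N_def)
    then obtain k where "J i = 3 * k" by (elim dvdE)
    then have "54 * s * int (J i) = 81 * (2 * s * int k)" by simp
    then have "81 dvd 54 * s * int (J i)" by (rule dvdI)
    then have "[54 * s * int (J i) = 0] (mod 81)" by (simp only: cong_0_iff)
    then show ?thesis using TJ[of i] cong_trans cong_0_iff by blast
  qed
  \<comment> \<open>At i = N - 2 the first binomial is N choose N = 1, and J = (N - 1) + (N - 2) N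
    is -1 modulo 3.\<close>
  have not81: "\<not> 81 dvd T (N - 2)"
  proof
    assume "81 dvd T (N - 2)"
    then have "[T (N - 2) = 0] (mod 81)" by (simp add: cong_0_iff)
    then have "81 dvd 54 * s * int (J (N - 2))" using TJ[of "N - 2"] by (metis cong_0_iff cong_dvd_iff)
    then obtain k where "54 * s * int (J (N - 2)) = 81 * k" by (elim dvdE)
    then have "2 * s * int (J (N - 2)) = 3 * k" by linarith
    then have "3 dvd 2 * s * int (J (N - 2))" by (rule dvdI)
    moreover have "prime (3::int)" by simp
    ultimately have "3 dvd int (J (N - 2))" using s3 by (auto simp: prime_dvd_mult_iff)
    then have J3: "3 dvd J (N - 2)" by presburger
    have "Suc (Suc (N - 2)) = N" "Suc (N - 2) = N - 1" using N by auto
    moreover have "N choose (N - 1) = N" using N binomial_symmetric[of "N - 1" N] by simp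
    ultimately have "J (N - 2) = (N - 1) + (N - 2) * N" unfolding J by simp
    then have "J (N - 2) + 1 = N + (N - 2) * N" using N by simp
    moreover have "3 dvd N + (N - 2) * N" using N(2) by simp
    ultimately show False using J3 by presburger
  qed
  have T_nz: "T (N - 2) \<noteq> 0" using not81 by auto
  have ord: "ord3 (theta_T_coeff \<Omega> n g i) = ord3 \<sigma> + int (multiplicity 3 (T i))" if "T i \<noteq> 0" for i
    unfolding c by (rule ord3_mult_int[OF \<sigma> that])
  have nz: "theta_T_coeff \<Omega> n g i \<noteq> 0 \<longleftrightarrow> T i \<noteq> 0" for i unfolding c using \<sigma> by simp
  have pd: "3 ^ m dvd x \<longleftrightarrow> m \<le> multiplicity 3 x" if "x \<noteq> 0" for x :: int and m
    by (rule power_dvd_iff_le_multiplicity) (use that in auto)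
  \<comment> \<open>Up to the common shift by the valuation of \<open>\<sigma>\<close>, the minimum
    over the coefficients is 3, and N - 2 is the first index attaining it.\<close>
  have mult3: "multiplicity 3 (T i) \<ge> 3" if "T i \<noteq> 0" for i
    using div27[of i] pd[OF that, of 3] by simp
  have mult4: "multiplicity 3 (T i) \<ge> 4" if "T i \<noteq> 0" "i < N - 2" for i
    using div81[OF that(2)] pd[OF that(1), of 4] by simp
  have multN: "multiplicity 3 (T (N - 2)) = 3"
    using not81 mult3[OF T_nz] pd[OF T_nz, of 4] by simp
  let ?c = "theta_T_coeff \<Omega> n g"
  have "(LEAST i. i < N \<and> ?c i \<noteq> 0 \<and> (\<forall>j<N. ?c j \<noteq> 0 \<longrightarrow> ord3 (?c i) \<le> ord3 (?c j))) = N - 2"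
  proof (rule Least_equality)
    show "N - 2 < N \<and> ?c (N - 2) \<noteq> 0 \<and> (\<forall>j<N. ?c j \<noteq> 0 \<longrightarrow> ord3 (?c (N - 2)) \<le> ord3 (?c j))"
      using N T_nz mult3 by (auto simp: nz ord multN)
    fix i assume i: "i < N \<and> ?c i \<noteq> 0 \<and> (\<forall>j<N. ?c j \<noteq> 0 \<longrightarrow> ord3 (?c i) \<le> ord3 (?c j))"
    show "N - 2 \<le> i"
    proof (rule ccontr)
      assume "\<not> N - 2 \<le> i"
      then have "i < N - 2" by simp
      moreover have "ord3 (?c i) \<le> ord3 (?c (N - 2))" using i N T_nz nz by simp
      ultimately show False using mult4[of i] i ord[of i] ord[OF T_nz] multN nz by simp
    qed
  qed
  moreover have "\<not> (\<forall>i<N. ?c i = 0)" using N T_nz nz by (metis diff_less less_le_trans zero_less_numeral)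
  ultimately show "lambda_inv (3 ^ n) ?c = enat (3 ^ n - 2)"
    unfolding lambda_inv_def N_def by simp
qed

end
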